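(* Let $k$ be an algebraically closed field and let $\Lambda$ be a discrete valuation ring with maximal ideal generator $p$ which is a $k$-algebra with residue field $k$ (for example $k[[T]]$ or $k[T]_{(T)}$). Suppose $\Gamma,\widetilde\Gamma$ are LR-tableaux such that $\widetilde\Gamma$ is obtained from $\Gamma$ by an increasing box move. Then there is a one-parameter family of embeddings $Q(\mu)$, $\mu\in k$, such that $Q(\mu)$ has tableau $\Gamma$ for $\mu\ne0$ and $Q(\mu)$ has tableau $\widetilde\Gamma$ for $\mu=0$.
   Context: All modules are finite length $\Lambda$-modules. For a partition $\beta=(\beta_1\ge\dots\ge\beta_s\ge1)$ put $N_\beta=\bigoplus_i\Lambda/(p^{\beta_i})$; a module isomorphic to $N_\beta$ has type $\beta$. $\beta'$ is the transpose. An embedding $(A\subset B)$ is a module $B$ with a submodule $A$. Tableaux. The Young diagram of $\beta$ is drawn with columns of lengths $\beta_1,\beta_2,\dots$ from left to right, aligned at the top; rows are numbered from the top, so row $i$ has $(\beta')_i$ boxes. A tableau is a sequence $\Gamma=[\gamma^{(0)}\subset\dots\subset\gamma^{(s)}]$ of partitions; boxes in $\gamma^{(0)}$ are empty, boxes in $\gamma^{(e)}\setminus\gamma^{(e-1)}$ carry the entry $e$ (repeating the last partition does not change the tableau). An LR-tableau of shape $\beta\setminus\gamma$ and content $\alpha$ is a tableau with $\gamma^{(0)}=\gamma$, $\gamma^{(s)}=\beta$, having $(\alpha')_e$ entries $e$ for each $e\ge1$, whose entries weakly increase along rows (left to right), strictly increase down columns, and such that for every vertical column and every $e\ge1$, on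 the right hand side of this column there occur at least as many entries $e$ as entries $e+1$. The tableau of an embedding $(A\subset B)$ is $[\gamma^{(0)},\dots,\gamma^{(r)}]$, where $p^rA=0$ and $\gamma^{(e)}$ is the type of $B/p^eA$. The union of tableaux $[\varepsilon^{(i)}]$, $[\zeta^{(i)}]$ is $[\varepsilon^{(i)}\cup\zeta^{(i)}]$ (union of multisets of parts, where the last partition of the shorter sequence is repeated). For $1\le e\le f$, the column tableau $C(e,f)_n$ is the one-column tableau of height $n$ whose lowest $f-e+1$ boxes contain $e,e+1,\dots,f$ from top to bottom, the other boxes being empty; $C(1,0)_n$ is the empty column of height $n$. Increasing box move. Let $\Gamma,\widetilde\Gamma$ be LR-tableaux of the same shape $\beta\setminus\gamma$ and content $\alpha$. $\widetilde\Gamma$ is obtained from $\Gamma$ by an increasing box move if both are unions of column tableaux which differ in exactly two columns: $\Gamma=\Delta\cup C(e,f)_n\cup C(e',f')_{n'}$ and $\widetilde\Gamma=\Delta\cup C(e',f')_n\cup C(e,f)_{n'}$, where $\Delta$ is a union of column tableaux and $n>n'$, $1\le e\le f$, $e<e'$, $f<f'$, $f-e=f'-e'$. One-parameter family. A one-parameter family of embeddings $Q(\mu)$, $\mu\in k$, is given by $\Lambda$-linear monomorphisms $\phi_\mu:N_\alpha\to N_\beta$ (with $\alpha,\beta$ fixed), such that $\mu\mapsto\phi_\mu$ is a polynomial map $k\to\mathrm{Hom}_k(N_\alpha,N_\beta)$ into the finite dimensional $k$-vector space of $k$-linear maps, and $Q(\mu)=(\phi_\mu(N_\alpha)\subset N_\beta)$.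 *)

theory Defs
  imports "HOL-Algebra.Algebra"
begin

section \<open>Partitions and tableaux\<close>

text \<open>A partition is the multiset of its (positive) parts; \<open>parts \<beta>\<close> lists them in decreasing
  order.  Union of partitions is then addition of multisets.\<close>

definition is_partition :: "nat multiset \<Rightarrow> bool" where
  "is_partition \<beta> \<longleftrightarrow> 0 \<notin># \<beta>"

definition parts :: "nat multiset \<Rightarrow> nat list" where
  "parts \<beta> = rev (sorted_list_of_multiset \<beta>)"

definition conjugate_part :: "nat multiset \<Rightarrow> nat \<Rightarrow> nat" where
  "conjugate_part \<beta> i = size {#b \<in># \<beta>. i \<le> b#}"

text \<open>Boxes are pairs (row, column), both counted from 1; column \<open>j\<close> has length \<open>\<beta>\<^sub>j\<close>.\<close>

definition diagram :: "nat multiset \<Rightarrow> (nat \<times> nat) set" where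
  "diagram \<beta> = {(i, j). 1 \<le> j \<and> j \<le> size \<beta> \<and> 1 \<le> i \<and> i \<le> parts \<beta> ! (j - 1)}"

text \<open>Since repeating the last partition does not change a tableau, a tableau
  \<open>[\<gamma>\<^sup>(\<^sup>0\<^sup>) \<subset> \<dots> \<subset> \<gamma>\<^sup>(\<^sup>s\<^sup>)]\<close> is represented by the eventually constant infinite sequence
  obtained by repeating \<open>\<gamma>\<^sup>(\<^sup>s\<^sup>)\<close> forever.\<close>

type_synonym tableau = "nat \<Rightarrow> nat multiset"

definition is_tableau :: "tableau \<Rightarrow> bool" where
  "is_tableau \<Gamma> \<longleftrightarrow>
     (\<forall>e. is_partition (\<Gamma> e)) \<and>
     (\<forall>e. diagram (\<Gamma> e) \<subseteq> diagram (\<Gamma> (Suc e))) \<and>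
     (\<exists>s. \<forall>e\<ge>s. \<Gamma> e = \<Gamma> s)"

text \<open>The boxes with entry \<open>e \<ge> 1\<close>.  For \<open>e = 0\<close> this is the empty set by truncated subtraction;
  the empty boxes of the tableau are not counted as having an entry.\<close>

definition entry_boxes :: "tableau \<Rightarrow> nat \<Rightarrow> (nat \<times> nat) set" where
  "entry_boxes \<Gamma> e = diagram (\<Gamma> e) - diagram (\<Gamma> (e - 1))"

definition LR_tableau ::
  "nat multiset \<Rightarrow> nat multiset \<Rightarrow> nat multiset \<Rightarrow> tableau \<Rightarrow> bool" where
  "LR_tableau \<alpha> \<beta> \<gamma> \<Gamma> \<longleftrightarrow>
     is_tableau \<Gamma> \<and> is_partition \<alpha> \<and>
     \<Gamma> 0 = \<gamma> \<and> (\<exists>s. \<forall>e\<ge>s. \<Gamma> e = \<beta>) \<and>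
     (\<forall>e\<ge>1. card (entry_boxes \<Gamma> e) = conjugate_part \<alpha> e) \<and>
     (\<forall>i j j' e e'. (i, j) \<in> entry_boxes \<Gamma> e \<and> (i, j') \<in> entry_boxes \<Gamma> e' \<and> j \<le> j' \<longrightarrow> e \<le> e') \<and>
     (\<forall>i i' j e e'. (i, j) \<in> entry_boxes \<Gamma> e \<and> (i', j) \<in> entry_boxes \<Gamma> e' \<and> i < i' \<longrightarrow> e < e') \<and>
     (\<forall>c\<ge>1. \<forall>e\<ge>1.
        card {(i, j) \<in> entry_boxes \<Gamma> (Suc e). c < j} \<le> card {(i, j) \<in> entry_boxes \<Gamma> e. c < j})"

definition tableau_union :: "tableau \<Rightarrow> tableau \<Rightarrow> tableau" (infixl \<open>\<union>\<^sub>T\<close> 65) where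
  "\<Gamma> \<union>\<^sub>T \<Gamma>' = (\<lambda>i. \<Gamma> i + \<Gamma>' i)"

definition one_part :: "nat \<Rightarrow> nat multiset" where
  "one_part h = (if h = 0 then {#} else {#h#})"

text \<open>In \<open>C(e,f)\<^sub>n\<close> the partition with index \<open>i\<close> is what remains of the column of height \<open>n\<close> after
  removing the boxes with entries \<open>> i\<close>.  For \<open>(e, f) = (1, 0)\<close> this is the empty column.\<close>

definition valid_column :: "nat \<Rightarrow> nat \<Rightarrow> nat \<Rightarrow> bool" where
  "valid_column e f n \<longleftrightarrow>
     n \<ge> 1 \<and> (1 \<le> e \<and> e \<le> f \<or> e = 1 \<and> f = 0) \<and> f + 1 - e \<le> n"

definition column_tableau :: "nat \<Rightarrow> nat \<Rightarrow> nat \<Rightarrow> tableau" where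
  "column_tableau e f n = (\<lambda>i. one_part (n - card {x \<in> {e..f}. i < x}))"

inductive union_of_columns :: "tableau \<Rightarrow> bool" where
  empty: "union_of_columns (\<lambda>_. {#})"
| insert: "union_of_columns \<Delta> \<Longrightarrow> valid_column e f n \<Longrightarrow>
    union_of_columns (\<Delta> \<union>\<^sub>T column_tableau e f n)"

definition increasing_box_move ::
  "nat multiset \<Rightarrow> nat multiset \<Rightarrow> nat multiset \<Rightarrow> tableau \<Rightarrow> tableau \<Rightarrow> bool" where
  "increasing_box_move \<alpha> \<beta> \<gamma> \<Gamma> \<Gamma>' \<longleftrightarrow>
     LR_tableau \<alpha> \<beta> \<gamma> \<Gamma> \<and> LR_tableau \<alpha> \<beta> \<gamma> \<Gamma>' \<and>
     (\<exists>\<Delta> e f n e' f' n'.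
        union_of_columns \<Delta> \<and>
        valid_column e f n \<and> valid_column e' f' n' \<and>
        valid_column e' f' n \<and> valid_column e f n' \<and>
        \<Gamma> = \<Delta> \<union>\<^sub>T column_tableau e f n \<union>\<^sub>T column_tableau e' f' n' \<and>
        \<Gamma>' = \<Delta> \<union>\<^sub>T column_tableau e' f' n \<union>\<^sub>T column_tableau e f n' \<and>
        n' < n \<and> 1 \<le> e \<and> e \<le> f \<and> e < e' \<and> f < f' \<and> f - e = f' - e')"


section \<open>Modules\<close>

text \<open>The records for modules in HOL-Algebra extend those for rings.  For a module only the fields
  \<open>carrier\<close>, \<open>zero\<close>, \<open>add\<close> and \<open>smult\<close> are meaningful (see the locale \<^locale>\<open>module\<close>), so \<open>mult\<close>
  and \<open>one\<close> are left unspecified below.\<close>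

definition regular_module :: "('a, 'm) ring_scheme \<Rightarrow> ('a, 'a) module" where
  "regular_module R =
     \<lparr>carrier = carrier R, monoid.mult = undefined, one = undefined,
      ring.zero = \<zero>\<^bsub>R\<^esub>, add = add R, smult = monoid.mult R\<rparr>"

definition quotient_module :: "('a, 'b, 'm) module_scheme \<Rightarrow> 'b set \<Rightarrow> ('a, 'b set) module" where
  "quotient_module M N =
     \<lparr>carrier = a_rcosets\<^bsub>M\<^esub> N, monoid.mult = undefined, one = undefined,
      ring.zero = N, add = set_add M, smult = (\<lambda>r C. \<Union>x\<in>C. N +>\<^bsub>M\<^esub> (r \<odot>\<^bsub>M\<^esub> x))\<rparr>"

text \<open>Used for finite index sets only.\<close>

definition direct_sum_module ::
  "'i set \<Rightarrow> ('i \<Rightarrow> ('a, 'b, 'm) module_scheme) \<Rightarrow> ('a, 'i \<Rightarrow> 'b) module" where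
  "direct_sum_module I M =
     \<lparr>carrier = (\<Pi>\<^sub>E i\<in>I. carrier (M i)), monoid.mult = undefined, one = undefined,
      ring.zero = (\<lambda>i\<in>I. \<zero>\<^bsub>M i\<^esub>), add = (\<lambda>x y. \<lambda>i\<in>I. x i \<oplus>\<^bsub>M i\<^esub> y i),
      smult = (\<lambda>r x. \<lambda>i\<in>I. r \<odot>\<^bsub>M i\<^esub> x i)\<rparr>"

text \<open>Module homomorphisms are extensional functions, so that homomorphisms with the same values
  on the carrier are equal.\<close>

definition module_homs ::
  "('a, 'r) ring_scheme \<Rightarrow> ('a, 'b, 'm) module_scheme \<Rightarrow> ('a, 'c, 'n) module_scheme \<Rightarrow> ('b \<Rightarrow> 'c) set"
  where
  "module_homs R M N =
     {h \<in> carrier M \<rightarrow>\<^sub>E carrier N.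
        (\<forall>x\<in>carrier M. \<forall>y\<in>carrier M. h (x \<oplus>\<^bsub>M\<^esub> y) = h x \<oplus>\<^bsub>N\<^esub> h y) \<and>
        (\<forall>r\<in>carrier R. \<forall>x\<in>carrier M. h (r \<odot>\<^bsub>M\<^esub> x) = r \<odot>\<^bsub>N\<^esub> h x)}"

definition module_isomorphic ::
  "('a, 'r) ring_scheme \<Rightarrow> ('a, 'b, 'm) module_scheme \<Rightarrow> ('a, 'c, 'n) module_scheme \<Rightarrow> bool" where
  "module_isomorphic R M N \<longleftrightarrow> (\<exists>h \<in> module_homs R M N. bij_betw h (carrier M) (carrier N))"

definition Hom_module ::
  "('a, 'r) ring_scheme \<Rightarrow> ('a, 'b, 'm) module_scheme \<Rightarrow> ('a, 'c, 'n) module_scheme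
    \<Rightarrow> ('a, 'b \<Rightarrow> 'c) module" where
  "Hom_module R M N =
     \<lparr>carrier = module_homs R M N, monoid.mult = undefined, one = undefined,
      ring.zero = (\<lambda>x\<in>carrier M. \<zero>\<^bsub>N\<^esub>), add = (\<lambda>g h. \<lambda>x\<in>carrier M. g x \<oplus>\<^bsub>N\<^esub> h x),
      smult = (\<lambda>r h. \<lambda>x\<in>carrier M. r \<odot>\<^bsub>N\<^esub> h x)\<rparr>"

text \<open>A module over a \<open>K\<close>-algebra \<open>L\<close>, viewed as a \<open>K\<close>-vector space.\<close>

definition restrict_scalars ::
  "('k, 'a, 'm) module_scheme \<Rightarrow> ('a, 'b, 'n) module_scheme \<Rightarrow> ('k, 'b) module" where
  "restrict_scalars L M =
     \<lparr>carrier = carrier M, monoid.mult = undefined, one = undefined,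
      ring.zero = \<zero>\<^bsub>M\<^esub>, add = add M, smult = (\<lambda>c x. (c \<odot>\<^bsub>L\<^esub> \<one>\<^bsub>L\<^esub>) \<odot>\<^bsub>M\<^esub> x)\<rparr>"


section \<open>Discrete valuation rings, types and embeddings\<close>

definition discrete_valuation_ring :: "('a, 'm) ring_scheme \<Rightarrow> bool" where
  "discrete_valuation_ring R \<longleftrightarrow>
     principal_domain R \<and> \<not> field R \<and> (\<exists>!I. maximalideal I R)"

text \<open>The composition \<open>K \<rightarrow> L \<rightarrow> L/(p)\<close> of the structure map of the \<open>K\<close>-algebra \<open>L\<close> with the
  projection is an isomorphism.\<close>

definition has_residue_field ::
  "('k, 'r) ring_scheme \<Rightarrow> ('k, 'a, 'm) module_scheme \<Rightarrow> 'a \<Rightarrow> bool" where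
  "has_residue_field K L p \<longleftrightarrow>
     (\<lambda>c. (PIdl\<^bsub>L\<^esub> p) +>\<^bsub>L\<^esub> (c \<odot>\<^bsub>L\<^esub> \<one>\<^bsub>L\<^esub>)) \<in> ring_iso K (L Quot (PIdl\<^bsub>L\<^esub> p))"

definition N_module ::
  "('a, 'm) ring_scheme \<Rightarrow> 'a \<Rightarrow> nat multiset \<Rightarrow> ('a, nat \<Rightarrow> 'a set) module" where
  "N_module R p \<beta> =
     direct_sum_module {..<size \<beta>}
       (\<lambda>i. quotient_module (regular_module R) (PIdl\<^bsub>R\<^esub> (p [^]\<^bsub>R\<^esub> (parts \<beta> ! i))))"

definition has_type ::
  "('a, 'r) ring_scheme \<Rightarrow> 'a \<Rightarrow> ('a, 'b, 'm) module_scheme \<Rightarrow> nat multiset \<Rightarrow> bool" where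
  "has_type R p M \<beta> \<longleftrightarrow> is_partition \<beta> \<and> module_isomorphic R M (N_module R p \<beta>)"

text \<open>The embedding \<open>A \<subset> B\<close> has tableau \<open>\<Gamma>\<close>.  As a tableau is represented by an infinite sequence,
  the condition ranges over all \<open>e\<close>; once \<open>p\<^sup>eA = 0\<close>, it says that the last partition is repeated.\<close>

definition has_tableau ::
  "('a, 'r) ring_scheme \<Rightarrow> 'a \<Rightarrow> ('a, 'b, 'm) module_scheme \<Rightarrow> 'b set \<Rightarrow> tableau \<Rightarrow> bool" where
  "has_tableau R p B A \<Gamma> \<longleftrightarrow>
     submodule A R B \<and>
     (\<exists>r::nat. (\<lambda>a. (p [^]\<^bsub>R\<^esub> r) \<odot>\<^bsub>B\<^esub> a) ` A = {\<zero>\<^bsub>B\<^esub>}) \<and>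
     (\<forall>e::nat. has_type R p (quotient_module B ((\<lambda>a. (p [^]\<^bsub>R\<^esub> e) \<odot>\<^bsub>B\<^esub> a) ` A)) (\<Gamma> e))"


section \<open>One-parameter families\<close>

definition polynomial_map ::
  "('k, 'r) ring_scheme \<Rightarrow> ('k, 'v, 'm) module_scheme \<Rightarrow> ('k \<Rightarrow> 'v) \<Rightarrow> bool" where
  "polynomial_map K V F \<longleftrightarrow>
     (\<exists>(d::nat) \<psi>. \<psi> \<in> {..d} \<rightarrow> carrier V \<and>
        (\<forall>\<mu>\<in>carrier K. F \<mu> = (\<Oplus>\<^bsub>V\<^esub> i\<in>{..d}. (\<mu> [^]\<^bsub>K\<^esub> i) \<odot>\<^bsub>V\<^esub> \<psi> i)))"

definition one_parameter_family ::
  "('k, 'r) ring_scheme \<Rightarrow> ('k, 'a, 'm) module_scheme \<Rightarrow> 'a \<Rightarrow> nat multiset \<Rightarrow> nat multiset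
    \<Rightarrow> ('k \<Rightarrow> (nat \<Rightarrow> 'a set) \<Rightarrow> (nat \<Rightarrow> 'a set)) \<Rightarrow> bool" where
  "one_parameter_family K L p \<alpha> \<beta> \<phi> \<longleftrightarrow>
     is_partition \<alpha> \<and> is_partition \<beta> \<and>
     (\<forall>\<mu>\<in>carrier K. \<phi> \<mu> \<in> module_homs L (N_module L p \<alpha>) (N_module L p \<beta>) \<and>
                     inj_on (\<phi> \<mu>) (carrier (N_module L p \<alpha>))) \<and>
     polynomial_map K
       (Hom_module K (restrict_scalars L (N_module L p \<alpha>)) (restrict_scalars L (N_module L p \<beta>))) \<phi>"

end

theory Submission
  imports Defs
begin

text \<open>
  The strips \<open>C(e,f)\<^sub>n\<close> of a union of columns are linked into chains, a strip with last entry \<open>x\<close>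
  being followed by one with first entry \<open>x + 1\<close> and with \<open>n - f\<close> at least as large; this is possible
  by the LR condition. A chain yields the generator \<open>\<Sum> p\<^sup>n\<^sup>-\<^sup>f b\<close> of a submodule, where \<open>b\<close>
  generates the summand of height \<open>n\<close>, and these generators realise the tableau. The same chains can be
  used for both tableaux of a box move. The family \<open>Q(\<mu>)\<close> starts from the embedding realising
  \<open>\<Gamma>'\<close>, in which \<open>C(e',f')\<close> lies in the higher column, and adds \<open>\<mu> p\<^sup>n\<^sup>'\<^sup>-\<^sup>f\<^sup>' b'\<close> to the
  generator of the chain of \<open>C(e',f')\<close>, where \<open>b'\<close> generates the summand of height \<open>n'\<close>. For
  \<open>\<mu> \<noteq> 0\<close> the change of basis \<open>b' \<mapsto> \<mu> b' + p\<^sup>n\<^sup>-\<^sup>n\<^sup>' b\<close> turns this into the embedding realising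
  \<open>\<Gamma>\<close>, up to one additional term that does not affect the tableau.
\<close>

section \<open>Columns and chains\<close>

text \<open>Why the generators realise the tableau: let \<open>b_l\<close> generate the summand of
  column \<open>l\<close> and let \<open>h l\<close> be its height minus its last entry. Modulo
  \<open>p^x\<close> times the submodule (without the additional term), every strip \<open>l\<close>
  with last entry above \<open>x\<close> yields \<open>b_l + \<Sum> p^(h l' - h l) b_l'\<close>,
  summed over the later strips \<open>l'\<close> of its chain. The exponents make sense because
  \<open>h\<close> grows along chains, and the power of \<open>p\<close> killing this element is the
  height of column \<open>l\<close> in the partition with index \<open>x\<close>. Why chains can be
  shared: a link must respect the heights before and after the move, but the move lowers
  \<open>h\<close> only for \<open>C(e,f)\<close> and raises it only for \<open>C(e',f')\<close>.
  For each \<open>x\<close>, the strictest condition between strips ending at \<open>x\<close> and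
  strips starting at \<open>x + 1\<close> is therefore the one given by \<open>\<Gamma>\<close>
  alone or by \<open>\<Gamma>'\<close> alone. Why the additional term is harmless: in the column of
  \<open>C(e',f')\<close> it has order at most \<open>f\<close>, just as the strip
  \<open>C(e,f)\<close> of the same generator has in its own column, so the coordinates of that
  chain can absorb it.\<close>

text \<open>Hall's theorem for nested neighbourhoods, by a greedy choice: an element with the
  largest value of \<open>a\<close> accepts every partner that any other element accepts. It is
  served last, and the count at its own threshold leaves a partner free.\<close>

lemma threshold_matching:
  fixes a :: "'a \<Rightarrow> nat" and b :: "'b \<Rightarrow> nat"
  assumes "finite A" "finite B"
    and "\<And>t. card {x\<in>A. a x \<le> t} \<le> card {y\<in>B. b y \<le> t}"
  shows "\<exists>g. inj_on g A \<and> g ` A \<subseteq> B \<and> (\<forall>x\<in>A. b (g x) \<le> a x)"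
  using assms
proof (induction "card A" arbitrary: A)
  case 0
  then show ?case by auto
next
  case (Suc k)
  have ne: "A \<noteq> {}" using Suc.hyps by auto
  obtain z where z: "z \<in> A" "\<And>x. x \<in> A \<Longrightarrow> a x \<le> a z"
  proof -
    have "Max (a ` A) \<in> a ` A" using Suc ne by auto
    then obtain z where "z \<in> A" "a z = Max (a ` A)" by auto
    then show thesis using that Suc.prems by auto
  qed
  have "card {x \<in> A - {z}. a x \<le> t} \<le> card {y \<in> B. b y \<le> t}" for t
  proof -
    have "card {x \<in> A - {z}. a x \<le> t} \<le> card {x \<in> A. a x \<le> t}"
      by (rule card_mono) (use Suc.prems in auto)
    then show ?thesis using Suc.prems(3)[of t] by linarith
  qed
  then obtain g where g: "inj_on g (A - {z})" "g ` (A - {z}) \<subseteq> B" "\<forall>x\<in>A - {z}. b (g x) \<le> a x"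
    using Suc.hyps(1)[of "A - {z}"] Suc.hyps(2)[symmetric] Suc.prems(1,2) z(1)
    by (auto simp: card_Diff_singleton)
  have sub: "g ` (A - {z}) \<subseteq> {y\<in>B. b y \<le> a z}"
  proof
    fix y assume "y \<in> g ` (A - {z})"
    then obtain x where "x \<in> A - {z}" "y = g x" by blast
    then show "y \<in> {y\<in>B. b y \<le> a z}" using g(2,3) z(2)[of x] le_trans[of "b y" "a x" "a z"] by auto
  qed
  have "card (g ` (A - {z})) < card {y\<in>B. b y \<le> a z}"
  proof -
    have "card (g ` (A - {z})) = k"
      using card_image[OF g(1)] Suc.hyps(2)[symmetric] Suc.prems(1) z(1) by (simp add: card_Diff_singleton)
    moreover have "{x\<in>A. a x \<le> a z} = A" using z by auto
    ultimately show ?thesis using Suc.prems(3)[of "a z"] Suc.hyps(2) by simp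
  qed
  then have "g ` (A - {z}) \<noteq> {y\<in>B. b y \<le> a z}" by auto
  then obtain y where y: "y \<in> B" "b y \<le> a z" "y \<notin> g ` (A - {z})"
    using sub by blast
  have "inj_on (g(z := y)) A"
    using g(1) y(3) z(1) by (auto simp: inj_on_def)
  moreover have "g(z := y) ` A \<subseteq> B" using g(2) y(1) by auto
  moreover have "\<forall>x\<in>A. b ((g(z := y)) x) \<le> a x" using g(3) y(2) by auto
  ultimately show ?case by blast
qed

text \<open>Strips whose entries run through \<open>{e l..f l}\<close> are linked into chains, each covering an
  initial segment of the positive integers: \<open>P l\<close> precedes \<open>l\<close> and \<open>\<rho>\<close> numbers the chains, longest
  chains first.  The labels are assigned from the largest entry downwards.\<close>

lemma chain_labelling:
  fixes e f lo hi :: "nat \<Rightarrow> nat" and S :: "nat set"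
  assumes fin: "finite S" and e1: "\<And>l. l \<in> S \<Longrightarrow> 1 \<le> e l" and ef: "\<And>l. l \<in> S \<Longrightarrow> e l \<le> f l"
    and hall: "\<And>x t. 1 \<le> x \<Longrightarrow>
      card {l\<in>S. e l = Suc x \<and> lo l \<le> t} \<le> card {l\<in>S. f l = x \<and> hi l \<le> t}"
  shows "\<exists>P \<rho>. (\<forall>x\<ge>1. bij_betw \<rho> {l\<in>S. e l \<le> x \<and> x \<le> f l} {..<card {l\<in>S. e l \<le> x \<and> x \<le> f l}}) \<and>
    (\<forall>l\<in>S. 1 < e l \<longrightarrow> P l \<in> S \<and> f (P l) = e l - 1 \<and> hi (P l) \<le> lo l \<and> \<rho> (P l) = \<rho> l)"
proof -
  define T where "T x = {l\<in>S. e l \<le> x \<and> x \<le> f l}" for x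
  \<comment> \<open>Invariant of the descent: the labels are right at all entries from
    \<open>y\<close> on, and predecessors are chosen for the strips starting after \<open>y\<close>.
    Labels of strips that end before \<open>y\<close> are still arbitrary.\<close>
  define Q where "Q y \<longleftrightarrow> (\<exists>P \<rho>. (\<forall>x\<ge>y. bij_betw \<rho> (T x) {..<card (T x)}) \<and>
    (\<forall>l\<in>S. y < e l \<longrightarrow> P l \<in> S \<and> f (P l) = e l - 1 \<and> hi (P l) \<le> lo l \<and> \<rho> (P l) = \<rho> (l::nat)))"
    for y :: nat
  obtain M where M: "\<And>l. l \<in> S \<Longrightarrow> f l \<le> M"
    using fin finite_nat_set_iff_bounded_le[of "f ` S"] by auto
  have start: "Q (Suc M)"
  proof -
    have "T x = {}" if "x \<ge> Suc M" for x using M that by (fastforce simp: T_def)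
    moreover have "\<not> Suc M < e l" if "l \<in> S" for l using M[OF that] ef[OF that] by simp
    ultimately show ?thesis by (auto simp: Q_def)
  qed
  have step: "Q z" if "Q (Suc z)" "1 \<le> z" for z
  proof -
    obtain P \<rho> where \<rho>: "\<And>x. x \<ge> Suc z \<Longrightarrow> bij_betw \<rho> (T x) {..<card (T x)}"
      and P: "\<And>l. l \<in> S \<Longrightarrow> Suc z < e l \<Longrightarrow>
        P l \<in> S \<and> f (P l) = e l - 1 \<and> hi (P l) \<le> lo l \<and> \<rho> (P l) = \<rho> l"
      using \<open>Q (Suc z)\<close> unfolding Q_def by blast
    define A where "A = {l\<in>S. e l = Suc z}"
    define B where "B = {l\<in>S. f l = z}"
    have finAB: "finite A" "finite B" and finT: "finite (T x)" for x
      using fin by (auto simp: A_def B_def T_def)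
    have "\<exists>g. inj_on g A \<and> g ` A \<subseteq> B \<and> (\<forall>x\<in>A. hi (g x) \<le> lo x)"
      by (rule threshold_matching[OF finAB])
        (use hall[OF \<open>1 \<le> z\<close>] in \<open>simp add: A_def B_def conj_assoc\<close>)
    then obtain g where g: "inj_on g A" "g ` A \<subseteq> B" "\<And>x. x \<in> A \<Longrightarrow> hi (g x) \<le> lo x" by blast
    \<comment> \<open>From entry \<open>z + 1\<close> down to \<open>z\<close>, the strips of
      \<open>C\<close> persist, those of \<open>A\<close> are replaced by their partners in
      \<open>B\<close>, and the rest of \<open>B\<close> are the last strips of new chains.\<close>
    define C where "C = T z \<inter> T (Suc z)"
    have TS: "T (Suc z) = C \<union> A" "C \<inter> A = {}"
      using ef by (auto simp: C_def T_def A_def) (metis le_Suc_eq)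
    have Tz: "T z = C \<union> B" "C \<inter> B = {}"
      using ef by (auto simp: C_def T_def B_def)
    have cA: "card (T (Suc z)) = card C + card A"
      unfolding TS by (rule card_Un_disjoint) (use TS finAB finT in \<open>auto simp: C_def\<close>)
    have cB: "card (T z) = card C + card B"
      unfolding Tz by (rule card_Un_disjoint) (use Tz finAB finT in \<open>auto simp: C_def\<close>)
    have cgA: "card (g ` A) = card A" using g(1) card_image by blast
    have le: "card A \<le> card B" using g(2) finAB cgA by (metis card_mono)
    have "card (B - g ` A) = card {card (T (Suc z))..<card (T z)}"
      using g(2) finAB cgA cA cB le by (simp add: card_Diff_subset)
    then obtain k where k: "bij_betw k (B - g ` A) {card (T (Suc z))..<card (T z)}"
      using finAB by (metis finite_Diff finite_atLeastLessThan finite_same_card_bij)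
    \<comment> \<open>A partner inherits the label of its successor. Strips of \<open>B\<close>
      without a successor take the labels from \<open>card (T (Suc z))\<close> on, so a chain that
      ends earlier gets a larger number.\<close>
    define \<rho>' where "\<rho>' l = (if l \<in> g ` A then \<rho> (the_inv_into A g l)
        else if l \<in> B then k l else \<rho> l)" for l
    have old: "\<rho>' l = \<rho> l" if "l \<notin> B" for l using that g(2) by (auto simp: \<rho>'_def)
    have onA: "\<rho>' (g l) = \<rho> l" if "l \<in> A" for l
      using that g(1) by (simp add: \<rho>'_def the_inv_into_f_f)
    have bT: "bij_betw \<rho> (C \<union> A) {..<card (T (Suc z))}" using \<rho>[of "Suc z"] TS by simp
    have bz: "bij_betw \<rho>' (T z) {..<card (T z)}"
    proof -
      have "bij_betw \<rho>' (C \<union> g ` A) {..<card (T (Suc z))}"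
      proof -
        define u where "u l = (if l \<in> A then g l else l)" for l
        have uC: "u l = l" if "l \<in> C" for l using that TS by (auto simp: u_def)
        have img: "u ` (C \<union> A) = C \<union> g ` A"
          unfolding image_Un using uC by (auto simp: u_def)
        have "inj_on u (C \<union> A)"
          unfolding inj_on_def u_def using g(1,2) Tz by (auto dest: inj_onD)
        then have "bij_betw u (C \<union> A) (C \<union> g ` A)" using img by (simp add: bij_betw_def)
        moreover have "bij_betw (\<rho>' \<circ> u) (C \<union> A) {..<card (T (Suc z))}"
        proof (rule iffD1[OF bij_betw_cong bT])
          fix l assume "l \<in> C \<union> A"
          then show "\<rho> l = (\<rho>' \<circ> u) l" using onA old[of l] Tz(2)
            by (auto simp: u_def disjoint_iff)
        qed
        ultimately show ?thesis by (metis bij_betw_comp_iff)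
      qed
      moreover have "bij_betw \<rho>' (B - g ` A) {card (T (Suc z))..<card (T z)}"
        by (rule iffD1[OF bij_betw_cong k]) (simp add: \<rho>'_def)
      ultimately have "bij_betw \<rho>' ((C \<union> g ` A) \<union> (B - g ` A))
          ({..<card (T (Suc z))} \<union> {card (T (Suc z))..<card (T z)})"
        by (rule bij_betw_combine) auto
      moreover have "(C \<union> g ` A) \<union> (B - g ` A) = T z" using Tz g(2) by auto
      moreover have "{..<card (T (Suc z))} \<union> {card (T (Suc z))..<card (T z)} = {..<card (T z)}"
        using cA cB le by auto
      ultimately show ?thesis by simp
    qed
    have bx: "bij_betw \<rho>' (T x) {..<card (T x)}" if "x \<ge> z" for x
    proof (cases "x = z")
      case False
      show ?thesis
        by (rule iffD1[OF bij_betw_cong \<rho>]) (use False that old in \<open>auto simp: T_def B_def\<close>)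
    qed (use bz in simp)
    have "(if e l = Suc z then g l else P l) \<in> S \<and> f (if e l = Suc z then g l else P l) = e l - 1 \<and>
        hi (if e l = Suc z then g l else P l) \<le> lo l \<and>
        \<rho>' (if e l = Suc z then g l else P l) = \<rho>' l" if l: "l \<in> S" "z < e l" for l
    proof -
      have o: "\<rho>' l = \<rho> l" using old[of l] l ef by (fastforce simp: B_def)
      show ?thesis
      proof (cases "e l = Suc z")
        case True
        then have "l \<in> A" using l by (simp add: A_def)
        then show ?thesis using True g onA o by (auto simp: B_def)
      next
        case False
        then have "P l \<notin> B" using P[of l] l by (auto simp: B_def)
        then show ?thesis using False P[of l] l o old by auto
      qed
    qed
    then show ?thesis unfolding Q_def
      using bx by (intro exI[of _ "\<lambda>l. if e l = Suc z then g l else P l"] exI[of _ \<rho>']) simp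
  qed
  have "Q 1"
    by (rule inc_induct[of 1 "Suc M" Q]) (use start step in auto)
  then show ?thesis unfolding Q_def T_def .
qed

section \<open>Partitions, transposes and row counts of diagrams\<close>

lemma mset_parts [simp]: "mset (parts \<beta>) = \<beta>"
  by (simp add: parts_def)

lemma length_parts [simp]: "length (parts \<beta>) = size \<beta>"
  by (metis mset_parts size_mset)

text \<open>Lists objects by decreasing key so that the i-th object carries the i-th part. Needed
  for the columns of a tableau and again for the coordinates of a quotient module.\<close>

lemma map_rev_sort_key: "map k (rev (sort_key k xs)) = parts (mset (map k xs))"
proof -
  have "sort (map k xs) = map k (sort_key k xs)"
    by (rule properties_for_sort) simp_all
  then show ?thesis by (simp only: parts_def rev_map sorted_list_of_multiset_mset)
qed

lemma parts_antimono:
  assumes "i \<le> j" "j < size \<beta>"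
  shows "parts \<beta> ! j \<le> parts \<beta> ! i"
proof -
  have "sorted_wrt (\<ge>) (parts \<beta>)"
    by (simp add: parts_def sorted_wrt_rev)
  then show ?thesis
    using assms sorted_wrt_nth_less[of "(\<ge>)" "parts \<beta>" i j] by (cases "i = j") auto
qed

text \<open>The indices whose part is at least \<open>x\<close> form an initial segment, so
  \<open>i\<close> lies in it exactly when its size exceeds \<open>i\<close>. This converts the
  number of strips containing \<open>x\<close> into the length of the chain with number
  \<open>i\<close>.\<close>

lemma conjugate_part_gt_iff:
  assumes "i < size \<alpha>"
  shows "i < conjugate_part \<alpha> x \<longleftrightarrow> x \<le> parts \<alpha> ! i"
proof -
  let ?J = "{j. j < size \<alpha> \<and> x \<le> parts \<alpha> ! j}"
  have "conjugate_part \<alpha> x = length (filter ((\<le>) x) (parts \<alpha>))"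
    using arg_cong[OF mset_filter[of "(\<le>) x" "parts \<alpha>"], of size]
    by (simp add: conjugate_part_def del: mset_filter)
  then have c: "conjugate_part \<alpha> x = card ?J" by (simp add: length_filter_conv_card)
  show ?thesis
  proof
    assume "x \<le> parts \<alpha> ! i"
    then have "j \<in> ?J" if "j \<le> i" for j
      using that assms parts_antimono[of j i \<alpha>] by simp
    then have "{..i} \<subseteq> ?J" by blast
    then have "card {..i} \<le> card ?J" by (intro card_mono) auto
    then show "i < conjugate_part \<alpha> x" using c by simp
  next
    assume "i < conjugate_part \<alpha> x"
    show "x \<le> parts \<alpha> ! i"
    proof (rule ccontr)
      assume "\<not> x \<le> parts \<alpha> ! i"
      then have "j < i" if "j \<in> ?J" for j
        using that parts_antimono[of i j \<alpha>] by (cases "j < i") auto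
      then have "?J \<subseteq> {..<i}" by blast
      then have "card ?J \<le> card {..<i}" by (intro card_mono) auto
      then show False using c \<open>i < conjugate_part \<alpha> x\<close> by simp
    qed
  qed
qed

lemma conjugate_part_le_size: "conjugate_part \<alpha> x \<le> size \<alpha>"
  by (simp add: conjugate_part_def size_filter_mset_lesseq)

lemma conjugate_part_antimono: "x \<le> y \<Longrightarrow> conjugate_part \<alpha> y \<le> conjugate_part \<alpha> x"
  unfolding conjugate_part_def by (intro size_mset_mono filter_mset_mono_strong) auto

lemma parts_pos: "is_partition \<alpha> \<Longrightarrow> i < size \<alpha> \<Longrightarrow> 1 \<le> parts \<alpha> ! i"
  unfolding is_partition_def by (metis length_parts less_one mset_parts not_le nth_mem_mset)

lemma finite_diagram [simp]: "finite (diagram \<beta>)"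
proof (rule finite_subset)
  show "diagram \<beta> \<subseteq> (\<Union>j\<in>{1..size \<beta>}. (\<lambda>i. (i, j)) ` {1..parts \<beta> ! (j - 1)})"
    by (auto simp: diagram_def)
qed auto

lemma diagram_closed:
  assumes "(i, j) \<in> diagram \<beta>" "1 \<le> i'" "i' \<le> i" "1 \<le> j'" "j' \<le> j"
  shows "(i', j') \<in> diagram \<beta>"
proof -
  have "parts \<beta> ! (j - 1) \<le> parts \<beta> ! (j' - 1)"
    using assms by (intro parts_antimono) (auto simp: diagram_def)
  then show ?thesis using assms by (auto simp: diagram_def)
qed

text \<open>Row counts depend on the multiset of column heights alone. They survive the resorting of
  columns from one partition of a tableau to the next, which destroys the position of a given
  column.\<close>

lemma card_diagram_rows: "card {(i, j) \<in> diagram \<beta>. i \<le> r} = (\<Sum>b\<in>#\<beta>. min b r)"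
proof -
  have "{(i, j) \<in> diagram \<beta>. i \<le> r} =
      (\<lambda>(j, i). (i, Suc j)) ` (SIGMA j:{..<size \<beta>}. {1..min (parts \<beta> ! j) r})"
    by (auto simp: diagram_def image_iff Bex_def) (metis Suc_le_eq Suc_pred less_eq_Suc_le)
  then have "card {(i, j) \<in> diagram \<beta>. i \<le> r} =
      card (SIGMA j:{..<size \<beta>}. {1..min (parts \<beta> ! j) r})"
    by (simp add: card_image inj_on_def)
  also have "\<dots> = (\<Sum>j<size \<beta>. min (parts \<beta> ! j) r)"
    by simp
  also have "\<dots> = (\<Sum>b\<leftarrow>parts \<beta>. min b r)"
    by (simp add: sum_list_sum_nth atLeast0LessThan)
  also have "\<dots> = (\<Sum>b\<in>#\<beta>. min b r)"
    by (metis mset_map mset_parts sum_mset_sum_list)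
  finally show ?thesis .
qed

text \<open>The condition on columns is used at the leftmost entry \<open>x + 1\<close> in the first \<open>r + 1\<close> rows: all
  entries \<open>x\<close> in its column or to the right of it lie in the first \<open>r\<close> rows.\<close>

lemma LR_row_counts:
  assumes LR: "LR_tableau \<alpha> \<beta> \<gamma> \<Gamma>" and x: "1 \<le> x"
  shows "card {(i, j) \<in> entry_boxes \<Gamma> (Suc x). i \<le> Suc r} \<le> card {(i, j) \<in> entry_boxes \<Gamma> x. i \<le> r}"
    (is "card ?U \<le> card ?V")
proof (cases "?U = {}")
  case False
  have fin: "finite (entry_boxes \<Gamma> y)" for y by (simp add: entry_boxes_def)
  define c where "c = (LEAST j. \<exists>i. (i, j) \<in> ?U)"
  have "\<exists>j i. (i, j) \<in> ?U" using False by auto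
  then have "\<exists>i. (i, c) \<in> ?U" unfolding c_def by (rule LeastI_ex)
  then obtain i0 where i0: "(i0, c) \<in> entry_boxes \<Gamma> (Suc x)" "i0 \<le> Suc r" by auto
  have cmin: "c \<le> j" if "(i, j) \<in> ?U" for i j
    unfolding c_def by (rule Least_le) (use that in blast)
  have c1: "1 \<le> c" "1 \<le> i0" using i0 by (auto simp: entry_boxes_def diagram_def)
  have notin: "(i0, c) \<notin> diagram (\<Gamma> x)" using i0 by (simp add: entry_boxes_def)
  let ?R = "\<lambda>y. {(i, j) \<in> entry_boxes \<Gamma> y. c - 1 < j}"
  have "card ?U \<le> card (?R (Suc x))"
  proof (rule card_mono)
    show "finite (?R (Suc x))" by (rule finite_subset[OF _ fin]) auto
    show "?U \<subseteq> ?R (Suc x)" using cmin c1 by fastforce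
  qed
  also have "\<dots> \<le> card (?R x)"
  \<comment> \<open>The column condition concerns what lies strictly to the right of a column, here
    of column \<open>c - 1\<close>. When \<open>c\<close> is the first column there is no such
    column, and the contents of the whole tableau are compared instead.\<close>
  proof (cases "c = 1")
    case True
    have "?R y = entry_boxes \<Gamma> y" for y using True by (auto simp: entry_boxes_def diagram_def)
    then show ?thesis
      using LR x conjugate_part_antimono[of x "Suc x" \<alpha>] by (simp add: LR_tableau_def)
  next
    case False
    then show ?thesis using LR x c1 by (simp add: LR_tableau_def)
  qed
  also have "\<dots> \<le> card ?V"
  proof (rule card_mono)
    show "finite ?V" by (rule finite_subset[OF _ fin]) auto
    \<comment> \<open>Otherwise the box lies weakly below and to the right of
      \<open>(i0, c)\<close>, so \<open>(i0, c)\<close> would already belong to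
      \<open>\<Gamma> x\<close>, although its entry is \<open>x + 1\<close>.\<close>
    have "i \<le> r" if "(i, j) \<in> ?R x" for i j
    proof (rule ccontr)
      assume "\<not> i \<le> r"
      then have "(i0, c) \<in> diagram (\<Gamma> x)"
        using that i0 c1 by (intro diagram_closed[of i j "\<Gamma> x" i0 c]) (simp_all add: entry_boxes_def, linarith+)
      then show False using notin by simp
    qed
    then show "?R x \<subseteq> ?V" by auto
  qed
  finally show ?thesis .
next
  case True
  show ?thesis unfolding True by simp
qed

section \<open>Row counts of unions of columns\<close>

definition column_height :: "nat \<Rightarrow> nat \<Rightarrow> nat \<Rightarrow> nat \<Rightarrow> nat" where
  "column_height e f n i = n - card {x \<in> {e..f}. i < x}"

text \<open>The clamp records that a column neither shrinks below its empty boxes nor grows beyond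
  its strip. An empty column, with \<open>e = 1\<close> and \<open>f = 0\<close>, is included: the
  clamp is then constantly 0.\<close>

lemma column_height_eq:
  assumes "f + 1 - e \<le> n" "1 \<le> e" "e \<le> Suc f"
  shows "column_height e f n i = n + min f (max i (e - 1)) - f"
proof -
  have "{x \<in> {e..f}. i < x} = {max e (Suc i)..f}" by auto
  then have h: "column_height e f n i = n - (Suc f - max e (Suc i))"
    by (simp add: column_height_def)
  consider "f \<le> i" | "i < f" "e \<le> Suc i" | "i < f" "Suc i < e" by linarith
  then have "n - (Suc f - max e (Suc i)) = n + min f (max i (e - 1)) - f"
  proof cases
    case 1
    then show ?thesis by simp
  next
    case 2
    then have "max e (Suc i) = Suc i" "max i (e - 1) = i" "min f i = i" by linarith+
    then show ?thesis using 2 by simp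
  next
    case 3
    then have "max e (Suc i) = e" "max i (e - 1) = e - 1" "min f (e - 1) = e - 1"
      using assms by linarith+
    then show ?thesis using assms by simp
  qed
  with h show ?thesis by (rule trans)
qed

text \<open>The columns are listed as triples \<open>(e, f, n)\<close>; columns of height 0 vanish.\<close>

definition columns_tableau :: "(nat \<times> nat \<times> nat) multiset \<Rightarrow> tableau" where
  "columns_tableau C i = {#h \<in># {#column_height e f n i. (e, f, n) \<in># C#}. h \<noteq> 0#}"

lemma columns_tableau_add:
  "columns_tableau (add_mset (e, f, n) C) = columns_tableau C \<union>\<^sub>T column_tableau e f n"
proof
  fix i
  show "columns_tableau (add_mset (e, f, n) C) i = (columns_tableau C \<union>\<^sub>T column_tableau e f n) i"
    unfolding columns_tableau_def tableau_union_def column_tableau_def one_part_def column_height_def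
    by simp
qed

lemma union_of_columns_mset:
  assumes "union_of_columns \<Delta>"
  shows "\<exists>C. (\<forall>(e, f, n) \<in># C. valid_column e f n) \<and> \<Delta> = columns_tableau C"
  using assms
proof induction
  case empty
  have "columns_tableau {#} = (\<lambda>_. {#})" by (rule ext) (simp add: columns_tableau_def)
  then show ?case by (intro exI[of _ "{#}"]) simp
next
  case (insert \<Delta> e f n)
  then obtain C where "\<forall>(e, f, n) \<in># C. valid_column e f n" "\<Delta> = columns_tableau C" by blast
  then show ?case using insert.hyps(2)
    by (intro exI[of _ "add_mset (e, f, n) C"]) (simp add: columns_tableau_add)
qed

lemma columns_tableau_mset:
  "columns_tableau (mset cs) x = {#b \<in># image_mset (\<lambda>l. column_height (fst (cs ! l)) (fst (snd (cs ! l)))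
      (snd (snd (cs ! l))) x) (mset_set {..<length cs}). b \<noteq> 0#}"
proof -
  have "mset (map ((!) cs) [0..<length cs]) = mset cs" by (simp only: map_nth)
  then have "mset cs = image_mset ((!) cs) (mset_set {..<length cs})"
    by (simp only: mset_map mset_upt atLeast0LessThan)
  then have "image_mset (\<lambda>(e, f, n). column_height e f n x) (mset cs) =
      image_mset (\<lambda>(e, f, n). column_height e f n x) (image_mset ((!) cs) (mset_set {..<length cs}))"
    by (rule arg_cong)
  then show ?thesis
    unfolding columns_tableau_def by (simp only: image_mset.compositionality comp_def case_prod_beta)
qed

text \<open>The diagrams are sorted at every stage, so a box does not remember its strip, but its
  row does. Between \<open>x\<close> and \<open>x + 1\<close> the number of boxes in the first
  \<open>r\<close> rows grows by one for each column whose strip has the entry \<open>x + 1\<close>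
  in one of these rows, and by nothing for the others.\<close>

lemma LR_entry_rows:
  fixes E F N :: "nat \<Rightarrow> nat"
  defines "H \<equiv> \<lambda>x l. N l + min (F l) (max x (E l - 1)) - F l"
  assumes T: "is_tableau \<Gamma>"
    and \<Gamma>: "\<And>x. \<Gamma> x = {#b \<in># image_mset (H x) (mset_set {..<m}). b \<noteq> 0#}"
    and valid: "\<And>l. l < m \<Longrightarrow> 1 \<le> E l \<and> E l \<le> Suc (F l) \<and> F l + 1 \<le> N l + E l"
  shows "card {(i, j) \<in> entry_boxes \<Gamma> (Suc x). i \<le> r} =
    card {l. l < m \<and> E l \<le> Suc x \<and> Suc x \<le> F l \<and> H (Suc x) l \<le> r}"
proof -
  let ?D = "\<lambda>x. {(i, j) \<in> diagram (\<Gamma> x). i \<le> r}"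
  have cardD: "card (?D x) = (\<Sum>l<m. min (H x l) r)" for x
  proof -
    have "sum_mset (image_mset (\<lambda>b. min b r) {#b \<in># M. b \<noteq> 0#}) = sum_mset (image_mset (\<lambda>b. min b r) M)"
      for M :: "nat multiset"
      by (induction M) auto
    then have "card (?D x) = (\<Sum>b\<in>#image_mset (H x) (mset_set {..<m}). min b r)"
      unfolding card_diagram_rows \<Gamma> by blast
    also have "\<dots> = (\<Sum>l<m. min (H x l) r)"
      by (simp add: sum_unfold_sum_mset image_mset.compositionality comp_def)
    finally show ?thesis .
  qed
  have "?D x \<subseteq> ?D (Suc x)" using T by (auto simp: is_tableau_def)
  moreover have finD: "finite (?D x)" for x by (rule finite_subset[OF _ finite_diagram[of "\<Gamma> x"]]) auto
  moreover have "{(i, j) \<in> entry_boxes \<Gamma> (Suc x). i \<le> r} = ?D (Suc x) - ?D x"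
    by (auto simp: entry_boxes_def)
  ultimately have "card {(i, j) \<in> entry_boxes \<Gamma> (Suc x). i \<le> r} = card (?D (Suc x)) - card (?D x)"
    by (simp add: card_Diff_subset)
  moreover have "card (?D (Suc x)) = card (?D x) +
      card {l. l < m \<and> E l \<le> Suc x \<and> Suc x \<le> F l \<and> H (Suc x) l \<le> r}"
  proof -
    have "min (H (Suc x) l) r = min (H x l) r +
        (if E l \<le> Suc x \<and> Suc x \<le> F l \<and> H (Suc x) l \<le> r then 1 else 0)" if "l < m" for l
    proof (cases "E l \<le> Suc x \<and> Suc x \<le> F l")
      case True
      then have "max (Suc x) (E l - 1) = Suc x" "max x (E l - 1) = x" by linarith+
      then have "min (F l) (max (Suc x) (E l - 1)) = Suc x" "min (F l) (max x (E l - 1)) = x"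
        using True by simp_all
      then have "H (Suc x) l = N l + Suc x - F l" "H x l = N l + x - F l"
        unfolding H_def by (simp_all only:)
      moreover have "F l \<le> N l + x" using True valid[OF that] by linarith
      ultimately have "H (Suc x) l = Suc (H x l)" by linarith
      then show ?thesis using True by (auto simp: min_def)
    next
      case False
      then have "min (F l) (max (Suc x) (E l - 1)) = min (F l) (max x (E l - 1))"
      proof (cases "F l \<le> x")
        case True
        then have "F l \<le> max (Suc x) (E l - 1)" "F l \<le> max x (E l - 1)" by linarith+
        then show ?thesis by (simp only: min_absorb1)
      next
        case False
        then have "max (Suc x) (E l - 1) = E l - 1" "max x (E l - 1) = E l - 1"
          using \<open>\<not> (E l \<le> Suc x \<and> Suc x \<le> F l)\<close> by linarith+
        then show ?thesis by simp
      qed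
      then have "H (Suc x) l = H x l" unfolding H_def by (simp only:)
      moreover have "\<not> (E l \<le> Suc x \<and> Suc x \<le> F l \<and> H (Suc x) l \<le> r)" using False by blast
      ultimately show ?thesis by (simp only: if_False add_0_right)
    qed
    then have "card (?D (Suc x)) = (\<Sum>l<m. min (H x l) r +
        (if E l \<le> Suc x \<and> Suc x \<le> F l \<and> H (Suc x) l \<le> r then 1 else 0))"
      unfolding cardD by (intro sum.cong) auto
    also have "\<dots> = card (?D x) +
        (\<Sum>l<m. if E l \<le> Suc x \<and> Suc x \<le> F l \<and> H (Suc x) l \<le> r then 1 else 0)"
      unfolding cardD sum.distrib ..
    also have "(\<Sum>l<m. if E l \<le> Suc x \<and> Suc x \<le> F l \<and> H (Suc x) l \<le> r then 1 else (0::nat)) =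
        card {l. l < m \<and> E l \<le> Suc x \<and> Suc x \<le> F l \<and> H (Suc x) l \<le> r}"
      by (simp add: sum.If_cases Int_def conj_ac)
    finally show ?thesis .
  qed
  ultimately show ?thesis by simp
qed

text \<open>What the LR condition says about the strips: their number at each entry; that
  \<open>N l - F l\<close> is a genuine difference; and the counting condition under which strips
  starting at \<open>x + 1\<close> can be matched with strips ending at \<open>x\<close>.\<close>

lemma LR_columns:
  fixes E F N :: "nat \<Rightarrow> nat"
  assumes LR: "LR_tableau \<alpha> \<beta> \<gamma> \<Gamma>"
    and \<Gamma>: "\<And>x. \<Gamma> x = {#b \<in># image_mset (\<lambda>l. N l + min (F l) (max x (E l - 1)) - F l)
        (mset_set {..<m}). b \<noteq> 0#}"
    and valid: "\<And>l. l < m \<Longrightarrow> 1 \<le> E l \<and> E l \<le> Suc (F l) \<and> F l + 1 \<le> N l + E l"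
  shows LR_columns_content: "1 \<le> x \<Longrightarrow> card {l. l < m \<and> E l \<le> x \<and> x \<le> F l} = conjugate_part \<alpha> x"
    and LR_columns_height: "l < m \<Longrightarrow> E l \<le> F l \<Longrightarrow> F l \<le> N l"
    and LR_columns_links: "1 \<le> x \<Longrightarrow> card {l. l < m \<and> E l \<le> F l \<and> E l = Suc x \<and> N l - F l \<le> t} \<le>
      card {l. l < m \<and> E l \<le> F l \<and> F l = x \<and> N l - F l \<le> t}"
proof -
  have T: "is_tableau \<Gamma>" using LR by (simp add: LR_tableau_def)
  let ?W = "\<lambda>x r. {l. l < m \<and> E l \<le> x \<and> x \<le> F l \<and> N l + min (F l) (max x (E l - 1)) - F l \<le> r}"
  have rows: "card {(i, j) \<in> entry_boxes \<Gamma> x. i \<le> r} = card (?W x r)" if x: "1 \<le> x" for x r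
  proof -
    obtain y where "x = Suc y" using x by (cases x) auto
    then show ?thesis using LR_entry_rows[OF T \<Gamma> valid, of y r] by (simp only:)
  qed
  have "min (F l) (max x (E l - 1)) = x" if "E l \<le> x" "x \<le> F l" for l x
  proof -
    have "max x (E l - 1) = x" using that by linarith
    then show ?thesis using that by simp
  qed
  then have W: "?W x r = {l. l < m \<and> E l \<le> x \<and> x \<le> F l \<and> N l + x - F l \<le> r}" for x r
    by (intro Collect_cong) auto
  \<comment> \<open>For a strip \<open>l\<close> containing \<open>x\<close>, the number
    \<open>N l + x - F l\<close> is the row of that entry.\<close>
  define Z where "Z x r = {l. l < m \<and> E l \<le> x \<and> x \<le> F l \<and> N l + x - F l \<le> r}" for x r
  have rowsZ: "card {(i, j) \<in> entry_boxes \<Gamma> x. i \<le> r} = card (Z x r)" if "1 \<le> x" for x r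
    using rows[OF that, of r] unfolding W Z_def .
  have finZ: "finite (Z x r)" for x r by (simp add: Z_def)
  show "card {l. l < m \<and> E l \<le> x \<and> x \<le> F l} = conjugate_part \<alpha> x" if x: "1 \<le> x"
  proof -
    \<comment> \<open>Contains every row that occurs on either side, so that restricting to the
      first \<open>Max S\<close> rows is no restriction.\<close>
    define S where "S = fst ` entry_boxes \<Gamma> x \<union> (\<lambda>l. N l + x - F l) ` {..<m}"
    have "finite S" by (simp add: S_def entry_boxes_def)
    then have r: "i \<le> Max S" if "i \<in> S" for i using that by simp
    have "i \<le> Max S" if "(i, j) \<in> entry_boxes \<Gamma> x" for i j
      by (rule r) (use imageI[OF that, of fst] in \<open>simp add: S_def\<close>)
    then have "{(i, j) \<in> entry_boxes \<Gamma> x. i \<le> Max S} = entry_boxes \<Gamma> x" by blast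
    moreover have "Z x (Max S) = {l. l < m \<and> E l \<le> x \<and> x \<le> F l}"
    proof -
      have "N l + x - F l \<le> Max S" if "l < m" for l
        by (rule r) (use that in \<open>simp add: S_def\<close>)
      then show ?thesis unfolding Z_def by blast
    qed
    moreover have "card (entry_boxes \<Gamma> x) = conjugate_part \<alpha> x"
      using LR x by (simp add: LR_tableau_def)
    ultimately show ?thesis using rowsZ[OF x, of "Max S"] by (simp only:)
  qed
  have step: "card (Z (Suc x) (Suc r)) \<le> card (Z x r)" if "1 \<le> x" for x r
    using LR_row_counts[OF LR that, of r] rowsZ[OF that, of r] rowsZ[of "Suc x" "Suc r"] by simp
  \<comment> \<open>Entry \<open>x\<close> never lies above row \<open>x\<close>. If no entry
    \<open>x\<close> lies in the first \<open>x - 1\<close> rows, the row inequality leaves no entry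
    \<open>x + 1\<close> in the first \<open>x\<close> rows. From here on the subtractions of
    \<open>F l\<close> are not truncated.\<close>
  have ge: "\<forall>l<m. E l \<le> x \<and> x \<le> F l \<longrightarrow> x \<le> N l + x - F l" if "1 \<le> x" for x
    using that
  proof (induction x rule: dec_induct)
    case base
    show ?case
    proof (intro allI impI)
      fix l assume "l < m" "E l \<le> 1 \<and> 1 \<le> F l"
      then show "1 \<le> N l + 1 - F l" using valid[of l] by linarith
    qed
  next
    case (step x)
    have x: "1 \<le> x" by (rule step.hyps)
    have "\<not> N l + x - F l \<le> x - 1" if "l < m" "E l \<le> x" "x \<le> F l" for l
    proof -
      have "x \<le> N l + x - F l" using step.IH that by blast
      then show ?thesis using x by linarith
    qed
    then have "Z x (x - 1) = {}" unfolding Z_def by blast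
    then have "card (Z (Suc x) (Suc (x - 1))) \<le> card ({} :: nat set)"
      using \<open>\<And>x r. 1 \<le> x \<Longrightarrow> card (Z (Suc x) (Suc r)) \<le> card (Z x r)\<close>[OF x, of "x - 1"] by (simp only:)
    then have "card (Z (Suc x) x) = 0" using x by simp
    then have empty: "Z (Suc x) x = {}" using finZ card_0_eq by blast
    show ?case
    proof (intro allI impI)
      fix l assume "l < m" "E l \<le> Suc x \<and> Suc x \<le> F l"
      then have "\<not> N l + Suc x - F l \<le> x" using empty unfolding Z_def by blast
      then show "Suc x \<le> N l + Suc x - F l" by linarith
    qed
  qed
  show "F l \<le> N l" if l: "l < m" "E l \<le> F l"
  proof -
    have "1 \<le> F l" using valid[OF l(1)] l(2) by linarith
    then have "F l \<le> N l + F l - F l" using ge l by blast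
    then show ?thesis by simp
  qed
  show "card {l. l < m \<and> E l \<le> F l \<and> E l = Suc x \<and> N l - F l \<le> t} \<le>
      card {l. l < m \<and> E l \<le> F l \<and> F l = x \<and> N l - F l \<le> t}" (is "card ?U \<le> card ?V") if x: "1 \<le> x"
  proof -
    \<comment> \<open>Row bounds \<open>t + x\<close> for \<open>x\<close> and
      \<open>t + x + 1\<close> for \<open>x + 1\<close> are both the bound
      \<open>N l - F l \<le> t\<close>, independent of the entry. Strips containing both entries are
      then counted on both sides and cancel, leaving the starting and the ending strips.\<close>
    let ?C = "{l. l < m \<and> E l \<le> x \<and> Suc x \<le> F l \<and> N l - F l \<le> t}"
    have h: "N l + y - F l \<le> t + y \<longleftrightarrow> N l - F l \<le> t" if "1 \<le> y" "l < m" "E l \<le> y" "y \<le> F l" for l y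
    proof -
      have "y \<le> N l + y - F l" using ge[OF that(1)] that by blast
      then show ?thesis using that(1) by linarith
    qed
    have Zt: "Z y (t + y) = {l. l < m \<and> E l \<le> y \<and> y \<le> F l \<and> N l - F l \<le> t}" if "1 \<le> y" for y
      unfolding Z_def using h[OF that] by blast
    have 1: "Z (Suc x) (Suc (t + x)) = ?U \<union> ?C"
    proof -
      have "Z (Suc x) (Suc (t + x)) = {l. l < m \<and> E l \<le> Suc x \<and> Suc x \<le> F l \<and> N l - F l \<le> t}"
        using Zt[of "Suc x"] by simp
      also have "\<dots> = ?U \<union> ?C"
      proof (rule Set.set_eqI)
        fix l
        show "l \<in> {l. l < m \<and> E l \<le> Suc x \<and> Suc x \<le> F l \<and> N l - F l \<le> t} \<longleftrightarrow> l \<in> ?U \<union> ?C"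
          by (cases "E l = Suc x") (simp_all add: le_Suc_eq)
      qed
      finally show ?thesis .
    qed
    have 2: "Z x (t + x) = ?V \<union> ?C"
    proof -
      have "l \<in> {l. l < m \<and> E l \<le> x \<and> x \<le> F l \<and> N l - F l \<le> t} \<longleftrightarrow> l \<in> ?V \<union> ?C" for l
      proof -
        have "x \<le> F l \<longleftrightarrow> F l = x \<or> Suc x \<le> F l" by linarith
        then show ?thesis by (cases "F l = x") simp_all
      qed
      then show ?thesis unfolding Zt[OF x] by (rule Set.set_eqI)
    qed
    have "card (?U \<union> ?C) \<le> card (?V \<union> ?C)" using step[OF x, of "t + x"] unfolding 1 2 .
    moreover have "card (?U \<union> ?C) = card ?U + card ?C" by (rule card_Un_disjoint) auto
    moreover have "card (?V \<union> ?C) = card ?V + card ?C" by (rule card_Un_disjoint) auto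
    ultimately show ?thesis by simp
  qed
qed

section \<open>Systems of chained strips and the exchange of two strips\<close>

text \<open>Columns without entries have \<open>e l = 1\<close> and \<open>f l = 0\<close>; the
  inequality excludes them.\<close>

definition is_strip :: "nat \<Rightarrow> (nat \<Rightarrow> nat) \<Rightarrow> (nat \<Rightarrow> nat) \<Rightarrow> nat \<Rightarrow> bool" where
  "is_strip m e f l \<longleftrightarrow> l < m \<and> e l \<le> f l"

text \<open>Column \<open>l\<close> has height \<open>h l + f l\<close> and its lowest boxes carry the strip \<open>e l, \<dots>, f l\<close>; the
  strips form chains as in \<open>chain_labelling\<close>. By the last two assumptions they still do so after
  exchanging the strips of the columns \<open>A\<close> and \<open>B\<close>.\<close>

locale strip_system =
  fixes \<alpha> :: "nat multiset" and m :: nat and e f h P \<rho> :: "nat \<Rightarrow> nat" and A B :: nat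
  assumes e_pos: "l < m \<Longrightarrow> 1 \<le> e l"
    and no_strip: "l < m \<Longrightarrow> \<not> is_strip m e f l \<Longrightarrow> f l = 0"
    and P: "is_strip m e f l \<Longrightarrow> 1 < e l \<Longrightarrow>
      is_strip m e f (P l) \<and> f (P l) = e l - 1 \<and> h (P l) \<le> h l \<and> \<rho> (P l) = \<rho> l"
    and chain_disjoint: "is_strip m e f l \<Longrightarrow> is_strip m e f l' \<Longrightarrow> \<rho> l = \<rho> l' \<Longrightarrow> l \<noteq> l' \<Longrightarrow>
      f l < e l' \<or> f l' < e l"
    and chain_le: "is_strip m e f l \<Longrightarrow> \<rho> l < size \<alpha> \<and> f l \<le> parts \<alpha> ! \<rho> l"
    and chain_end: "i < size \<alpha> \<Longrightarrow> \<exists>l. is_strip m e f l \<and> \<rho> l = i \<and> f l = parts \<alpha> ! i"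
    and strip_A: "is_strip m e f A" and strip_B: "is_strip m e f B"
    and eAB: "e A < e B" and fAB': "f B = f A + (e B - e A)"
    and hPA': "1 < e A \<Longrightarrow> h (P A) \<le> h B + (e B - e A)"
    and hA': "is_strip m e f j \<Longrightarrow> 1 < e j \<Longrightarrow> P j = B \<Longrightarrow> h A \<le> h j + (e B - e A)"
begin

abbreviation strip :: "nat \<Rightarrow> bool" where "strip \<equiv> is_strip m e f"

definition d :: nat where "d = e B - e A"

lemmas fAB = fAB'[folded d_def] and hPA = hPA'[folded d_def] and hA = hA'[folded d_def]

lemma stripD: "strip l \<Longrightarrow> l < m" "strip l \<Longrightarrow> e l \<le> f l" "strip l \<Longrightarrow> 1 \<le> e l"
  using e_pos by (auto simp: is_strip_def)

lemma not_AB: "A \<noteq> B" using eAB by auto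

lemma f_A_less: "f A < f B" using fAB eAB by (simp add: d_def)

lemma P_less: "strip l \<Longrightarrow> 1 < e l \<Longrightarrow> f (P l) < f l"
  using P[of l] stripD(2)[of l] by linarith

definition level :: "nat \<Rightarrow> nat \<Rightarrow> nat" where
  "level x l = h l + min (f l) (max x (e l - 1))"

lemma level_le: "level x l \<le> h l + f l"
  by (simp add: level_def)

text \<open>Column heights \<open>h l + f l\<close> stay fixed, so receiving the longer-indexed
  strip costs column \<open>A\<close> the amount \<open>d\<close> in \<open>h\<close>, and column
  \<open>B\<close> gains it. The links through \<open>A\<close> and \<open>B\<close> survive by
  \<open>hPA\<close> and \<open>hA\<close> together with \<open>hAB\<close>. Afterwards
  \<open>B\<close> holds the strip with the smaller entries, hence the exchanged roles in the
  conclusion.\<close>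

lemma swap_strips:
  assumes hAB: "h B + d \<le> h A"
  defines "\<tau> \<equiv> transpose A B"
  shows "strip_system \<alpha> m (e \<circ> \<tau>) (f \<circ> \<tau>) (h(A := h A - d, B := h B + d)) (\<tau> \<circ> P \<circ> \<tau>) (\<rho> \<circ> \<tau>) B A"
proof -
  let ?h = "h(A := h A - d, B := h B + d)"
  have \<tau>: "\<tau> A = B" "\<tau> B = A" "\<And>k. k \<noteq> A \<Longrightarrow> k \<noteq> B \<Longrightarrow> \<tau> k = k" "\<And>k. \<tau> (\<tau> k) = k"
    by (simp_all add: \<tau>_def)
  have strip\<tau>: "is_strip m (e \<circ> \<tau>) (f \<circ> \<tau>) l = strip (\<tau> l)" for l
    using strip_A strip_B \<tau> by (cases "l = A"; cases "l = B") (auto simp: is_strip_def)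
  have PA: "P A \<noteq> A" "P A \<noteq> B" if "1 < e A"
    using P_less[OF strip_A that] f_A_less by auto
  have PB: "P B \<noteq> B" "P B \<noteq> A" if "1 < e B"
  proof -
    show "P B \<noteq> B" using P_less[OF strip_B that] by auto
    \<comment> \<open>A link from \<open>A\<close> to \<open>B\<close> would give
      \<open>h A \<le> h B\<close>, against \<open>h B + d \<le> h A\<close> and
      \<open>d > 0\<close>.\<close>
    show "P B \<noteq> A" using P[OF strip_B that] hAB eAB by (auto simp: d_def)
  qed
  have hP: "?h (\<tau> (P k)) \<le> ?h (\<tau> k)" if k: "strip k" "1 < e k" for k
  proof -
    consider "k = A" | "k = B" | "k \<noteq> A" "k \<noteq> B" "P k = A" | "k \<noteq> A" "k \<noteq> B" "P k = B"
      | "k \<noteq> A" "k \<noteq> B" "P k \<noteq> A" "P k \<noteq> B" by blast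
    then show ?thesis
    proof cases
      case 1
      then show ?thesis using PA hPA k \<tau> not_AB by simp
    next
      case 2
      then have "h (P B) \<le> h B" using P[OF k] by simp
      then have "h (P B) \<le> h A - d" using hAB by linarith
      then show ?thesis using PB 2 k \<tau> not_AB by simp
    next
      case 3
      then show ?thesis using P[OF k] \<tau> not_AB hAB by simp
    next
      case 4
      then show ?thesis using hA[OF k] \<tau> not_AB hAB by simp
    next
      case 5
      then show ?thesis using P[OF k] \<tau> not_AB by simp
    qed
  qed
  show ?thesis
  proof (unfold_locales, unfold strip\<tau>)
    fix l assume l: "l < m"
    have \<tau>m: "\<tau> l < m" using l stripD(1)[OF strip_A] stripD(1)[OF strip_B] \<tau>
      by (cases "l = A"; cases "l = B") auto
    show "1 \<le> (e \<circ> \<tau>) l" using e_pos[OF \<tau>m] by simp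
    show "(f \<circ> \<tau>) l = 0" if "\<not> strip (\<tau> l)" using no_strip[OF \<tau>m that] by simp
  next
    fix l assume l: "strip (\<tau> l)" "1 < (e \<circ> \<tau>) l"
    then show "strip (\<tau> ((\<tau> \<circ> P \<circ> \<tau>) l)) \<and> (f \<circ> \<tau>) ((\<tau> \<circ> P \<circ> \<tau>) l) = (e \<circ> \<tau>) l - 1 \<and>
        ?h ((\<tau> \<circ> P \<circ> \<tau>) l) \<le> ?h l \<and> (\<rho> \<circ> \<tau>) ((\<tau> \<circ> P \<circ> \<tau>) l) = (\<rho> \<circ> \<tau>) l"
      using P[of "\<tau> l"] hP[of "\<tau> l"] \<tau>(4) by (simp only: comp_apply)
  next
    fix l l' assume "strip (\<tau> l)" "strip (\<tau> l')" "(\<rho> \<circ> \<tau>) l = (\<rho> \<circ> \<tau>) l'" "l \<noteq> l'"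
    then show "(f \<circ> \<tau>) l < (e \<circ> \<tau>) l' \<or> (f \<circ> \<tau>) l' < (e \<circ> \<tau>) l"
      using chain_disjoint[of "\<tau> l" "\<tau> l'"] \<tau>(4) by (metis comp_apply)
  next
    fix l assume "strip (\<tau> l)"
    then show "(\<rho> \<circ> \<tau>) l < size \<alpha> \<and> (f \<circ> \<tau>) l \<le> parts \<alpha> ! (\<rho> \<circ> \<tau>) l"
      using chain_le by simp
  next
    fix i assume "i < size \<alpha>"
    then obtain l where "strip l" "\<rho> l = i" "f l = parts \<alpha> ! i" using chain_end by blast
    then show "\<exists>l. strip (\<tau> l) \<and> (\<rho> \<circ> \<tau>) l = i \<and> (f \<circ> \<tau>) l = parts \<alpha> ! i"
      using \<tau>(4) by (intro exI[of _ "\<tau> l"]) simp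
  next
    fix j assume j: "strip (\<tau> j)" "1 < (e \<circ> \<tau>) j" "(\<tau> \<circ> P \<circ> \<tau>) j = A"
    then have "P (\<tau> j) = B" using \<tau> by (metis comp_apply)
    then have "?h A \<le> ?h j" using hP[of "\<tau> j"] j \<tau> by simp
    then show "?h B \<le> ?h j + ((e \<circ> \<tau>) A - (e \<circ> \<tau>) B)" using hAB \<tau> not_AB by (simp add: d_def)
  qed (use strip_A strip_B eAB fAB PA hPA hAB \<tau> not_AB in \<open>simp_all add: d_def\<close>)
qed

end

text \<open>Links are chosen once, with the larger of the two values of \<open>h\<close> at the
  predecessor and the smaller one at the successor. They are then valid for both tableaux, and the
  two strictest cases are the assumptions \<open>hPA'\<close> and \<open>hA'\<close> of
  \<open>strip_system\<close>.\<close>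

lemma box_move_strip_system:
  assumes "increasing_box_move \<alpha> \<beta> \<gamma> \<Gamma> \<Gamma>'"
  shows "\<exists>e f h P \<rho> A B. strip_system \<alpha> (size \<beta>) e f h P \<rho> A B \<and> h B + (e B - e A) < h A \<and>
    (\<forall>l<size \<beta>. parts \<beta> ! l = h l + f l) \<and>
    (\<forall>x. \<Gamma> x = {#b \<in># image_mset (\<lambda>l. h l + min (f l) (max x (e l - 1))) (mset_set {..<size \<beta>}). b \<noteq> 0#}) \<and>
    (let h' = h(A := h A - (e B - e A), B := h B + (e B - e A)); e' = e \<circ> transpose A B; f' = f \<circ> transpose A B in
     \<forall>x. \<Gamma>' x = {#b \<in># image_mset (\<lambda>l. h' l + min (f' l) (max x (e' l - 1))) (mset_set {..<size \<beta>}). b \<noteq> 0#})"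
proof -
  obtain \<Delta> e0 f0 n0 e1 f1 n1 where
    LR: "LR_tableau \<alpha> \<beta> \<gamma> \<Gamma>" and LR': "LR_tableau \<alpha> \<beta> \<gamma> \<Gamma>'" and \<Delta>: "union_of_columns \<Delta>"
    and v: "valid_column e0 f0 n0" "valid_column e1 f1 n1" "valid_column e1 f1 n0" "valid_column e0 f0 n1"
    and \<Gamma>: "\<Gamma> = \<Delta> \<union>\<^sub>T column_tableau e0 f0 n0 \<union>\<^sub>T column_tableau e1 f1 n1"
    and \<Gamma>': "\<Gamma>' = \<Delta> \<union>\<^sub>T column_tableau e1 f1 n0 \<union>\<^sub>T column_tableau e0 f0 n1"
    and n: "n1 < n0" and ef: "1 \<le> e0" "e0 \<le> f0" "e0 < e1" "f0 < f1" "f0 - e0 = f1 - e1"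
    using assms unfolding increasing_box_move_def by blast
  obtain C where C: "\<forall>(e, f, n) \<in># C. valid_column e f n" "\<Delta> = columns_tableau C"
    using union_of_columns_mset[OF \<Delta>] by blast
  obtain xs where xs: "mset xs = add_mset (e1, f1, n1) (add_mset (e0, f0, n0) C)"
    using ex_mset by blast
  \<comment> \<open>Sorted by decreasing height, so that column \<open>l\<close> is the
    \<open>l\<close>-th summand of \<open>N_module\<close>.\<close>
  define cs where "cs = rev (sort_key (\<lambda>c. snd (snd c)) xs)"
  define m where "m = length cs"
  define E where "E l = fst (cs ! l)" for l
  define F where "F l = fst (snd (cs ! l))" for l
  define N where "N l = snd (snd (cs ! l))" for l
  have mcs: "mset cs = add_mset (e1, f1, n1) (add_mset (e0, f0, n0) C)" by (simp add: cs_def xs)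
  have "\<forall>(e, f, n) \<in># mset cs. valid_column e f n" using C(1) v unfolding mcs by auto
  then have vcs: "valid_column (E l) (F l) (N l)" if "l < m" for l
    using that nth_mem[of l cs] unfolding E_def F_def N_def m_def
    by (auto simp del: nth_mem simp: case_prod_beta)
  have "(e0, f0, n0) \<in> set cs" "(e1, f1, n1) \<in> set cs"
    unfolding set_mset_mset[symmetric] mcs by auto
  then obtain A B where AB: "A < m" "cs ! A = (e0, f0, n0)" "B < m" "cs ! B = (e1, f1, n1)"
    unfolding m_def in_set_conv_nth by blast
  have ABv: "E A = e0" "F A = f0" "N A = n0" "E B = e1" "F B = f1" "N B = n1"
    using AB by (simp_all add: E_def F_def N_def)
  have AneB: "A \<noteq> B" using ABv ef by auto
  have \<Gamma>cs: "\<Gamma> = columns_tableau (mset cs)"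
    unfolding mcs \<Gamma> columns_tableau_add C(2) ..
  define \<tau> where "\<tau> = transpose A B"
  \<comment> \<open>The move in terms of positions: the heights stay in place and the strips at
    \<open>A\<close> and \<open>B\<close> are exchanged.\<close>
  define cs' where "cs' = cs[A := (e1, f1, n0), B := (e0, f0, n1)]"
  have mcs': "mset cs' = add_mset (e0, f0, n1) (add_mset (e1, f1, n0) C)"
  proof -
    have "mset (cs[A := (e1, f1, n0)]) = add_mset (e1, f1, n0) (add_mset (e1, f1, n1) C)"
      using AB mcs by (simp add: mset_update m_def)
    moreover have "cs[A := (e1, f1, n0)] ! B = (e1, f1, n1)" using AB AneB by simp
    ultimately show ?thesis using AB unfolding cs'_def by (simp add: mset_update m_def add_mset_commute)
  qed
  have \<Gamma>'cs: "\<Gamma>' = columns_tableau (mset cs')"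
    unfolding mcs' \<Gamma>' columns_tableau_add C(2) ..
  have cs'v: "fst (cs' ! l) = E (\<tau> l)" "fst (snd (cs' ! l)) = F (\<tau> l)" "snd (snd (cs' ! l)) = N l"
    if "l < m" for l
    using that AB AneB ABv unfolding cs'_def \<tau>_def
    by (cases "l = A"; cases "l = B"; simp add: m_def E_def F_def N_def)+
  have \<tau>: "\<tau> A = B" "\<tau> B = A" "\<And>k. k \<noteq> A \<Longrightarrow> k \<noteq> B \<Longrightarrow> \<tau> k = k" "\<And>k. \<tau> (\<tau> k) = k"
    by (simp_all add: \<tau>_def)
  have \<tau>m: "\<tau> l < m" if "l < m" for l using that AB \<tau> by (cases "l = A"; cases "l = B") auto
  have vcs': "valid_column (E (\<tau> l)) (F (\<tau> l)) (N l)" if "l < m" for l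
  proof (cases "l = A \<or> l = B")
    case False
    then show ?thesis using vcs[OF that] \<tau>(3) by simp
  qed (use v ABv \<tau> in auto)
  have valid: "1 \<le> e \<and> e \<le> Suc f \<and> f + 1 \<le> n + e" if "valid_column e f n" for e f n
    using that by (auto simp: valid_column_def)
  have height: "column_height e f n x = n + min f (max x (e - 1)) - f" if "valid_column e f n" for e f n x
    using that by (intro column_height_eq) (auto simp: valid_column_def)
  have \<Gamma>x: "\<Gamma> x = {#b \<in># image_mset (\<lambda>l. N l + min (F l) (max x (E l - 1)) - F l) (mset_set {..<m}). b \<noteq> 0#}" for x
    unfolding \<Gamma>cs columns_tableau_mset m_def[symmetric] E_def[symmetric] F_def[symmetric] N_def[symmetric]
    by (intro arg_cong[where f = "filter_mset _"] image_mset_cong) (use height[OF vcs] in simp)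
  have m': "length cs' = m" by (simp add: cs'_def m_def)
  have \<Gamma>'x: "\<Gamma>' x = {#b \<in># image_mset (\<lambda>l. N l + min (F (\<tau> l)) (max x (E (\<tau> l) - 1)) - F (\<tau> l)) (mset_set {..<m}). b \<noteq> 0#}" for x
    unfolding \<Gamma>'cs columns_tableau_mset m'
    by (intro arg_cong[where f = "filter_mset _"] image_mset_cong) (use height[OF vcs'] cs'v in simp)
  have "image_mset N (mset_set {..<m}) = \<beta>"
  proof -
    obtain s where s: "\<And>x. x \<ge> s \<Longrightarrow> \<Gamma> x = \<beta>" using LR by (auto simp: LR_tableau_def)
    \<comment> \<open>Large enough for \<open>\<Gamma>\<close> to be constant and for every column
      to be complete.\<close>
    define x where "x = max s (Max (F ` {..<m}))"
    have "F l \<le> x" if "l < m" for l using that by (simp add: x_def le_max_iff_disj)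
    then have "N l + min (F l) (max x (E l - 1)) - F l = N l" if "l < m" for l using that
      by (simp add: min_absorb1 le_max_iff_disj)
    then have "image_mset (\<lambda>l. N l + min (F l) (max x (E l - 1)) - F l) (mset_set {..<m}) =
        image_mset N (mset_set {..<m})" by (intro image_mset_cong) simp
    then have "\<beta> = {#b \<in># image_mset N (mset_set {..<m}). b \<noteq> 0#}"
      using \<Gamma>x[of x] s[of x] by (simp add: x_def)
    also have "\<dots> = image_mset N (mset_set {..<m})"
    proof -
      have "N l \<noteq> 0" if "l < m" for l using vcs[OF that] by (simp add: valid_column_def)
      then show ?thesis unfolding filter_mset_eq_conv by auto
    qed
    finally show ?thesis by simp
  qed
  moreover have "mset (map (\<lambda>c. snd (snd c)) cs) = image_mset N (mset_set {..<m})"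
  proof -
    have "map (\<lambda>c. snd (snd c)) cs = map N [0..<m]"
      by (rule nth_equalityI) (simp_all add: m_def N_def)
    then show ?thesis by (simp add: atLeast0LessThan)
  qed
  ultimately have "parts \<beta> = map (\<lambda>c. snd (snd c)) cs"
    using map_rev_sort_key[of "\<lambda>c. snd (snd c)" xs] by (simp add: cs_def)
  then have parts: "parts \<beta> ! l = N l" if "l < m" for l
    using that by (simp add: m_def N_def)
  have size: "size \<beta> = m" using \<open>parts \<beta> = _\<close> length_parts[of \<beta>] by (simp add: m_def)
  have \<tau>N: "N (\<tau> A) = n1" "N (\<tau> B) = n0" using \<tau> ABv by simp_all
  have S: "is_strip m E F l \<longleftrightarrow> l < m \<and> E l \<le> F l" for l by (simp add: is_strip_def)
  have val: "1 \<le> E l \<and> E l \<le> Suc (F l) \<and> F l + 1 \<le> N l + E l" if "l < m" for l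
    by (rule valid[OF vcs[OF that]])
  have val': "1 \<le> E (\<tau> l) \<and> E (\<tau> l) \<le> Suc (F (\<tau> l)) \<and> F (\<tau> l) + 1 \<le> N l + E (\<tau> l)" if "l < m" for l
    by (rule valid[OF vcs'[OF that]])
  have height1: "F l \<le> N l" if "l < m" "E l \<le> F l" for l
    using LR_columns_height[OF LR \<Gamma>x val] that by blast
  have height2: "F (\<tau> l) \<le> N l" if "l < m" "E (\<tau> l) \<le> F (\<tau> l)" for l
    using LR_columns_height[OF LR' \<Gamma>'x val'] that by blast
  have links: "card {l. l < m \<and> E l \<le> F l \<and> E l = Suc x \<and> N l - F l \<le> t} \<le>
      card {l. l < m \<and> E l \<le> F l \<and> F l = x \<and> N l - F l \<le> t}" if "1 \<le> x" for x t
    by (rule LR_columns_links[OF LR \<Gamma>x _ that]) (rule val)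
  have links0: "card {l. l < m \<and> E (\<tau> l) \<le> F (\<tau> l) \<and> E (\<tau> l) = Suc x \<and> N l - F (\<tau> l) \<le> t} \<le>
      card {l. l < m \<and> E (\<tau> l) \<le> F (\<tau> l) \<and> F (\<tau> l) = x \<and> N l - F (\<tau> l) \<le> t}" if "1 \<le> x" for x t
    by (rule LR_columns_links[OF LR' \<Gamma>'x _ that]) (rule val')
  have content: "card {l. l < m \<and> E l \<le> x \<and> x \<le> F l} = conjugate_part \<alpha> x" if "1 \<le> x" for x
    by (rule LR_columns_content[OF LR \<Gamma>x _ that]) (rule val)
  have "e1 \<le> f1" using v(2) ef by (auto simp: valid_column_def)
  then have eqAB: "E A \<le> F A" "E B \<le> F B" "E A < E B" "F A < F B" "F B = F A + (E B - E A)"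
    unfolding ABv using ef \<open>e1 \<le> f1\<close> by linarith+
  have Fn: "F A \<le> n1" "F B \<le> n1" "F B \<le> n0" "F A \<le> n0"
    using height1[of A] height1[of B] height2[of A] height2[of B] AB eqAB ABv \<tau> by simp_all
  \<comment> \<open>Reindexes counts for \<open>\<Gamma>'\<close> by strips instead of columns: in
    \<open>\<Gamma>'\<close> the strip \<open>k\<close> sits in column
    \<open>\<tau> k\<close>.\<close>
  have card\<tau>: "card {l. l < m \<and> Q (\<tau> l) \<and> N l - F (\<tau> l) \<le> t} = card {k. k < m \<and> Q k \<and> N (\<tau> k) - F k \<le> t}"
    for Q t
  proof -
    have "inj \<tau>" by (simp add: \<tau>_def)
    moreover have "{k. k < m \<and> Q k \<and> N (\<tau> k) - F k \<le> t} = \<tau> ` {l. l < m \<and> Q (\<tau> l) \<and> N l - F (\<tau> l) \<le> t}"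
    proof (intro equalityI subsetI)
      fix k assume k: "k \<in> {k. k < m \<and> Q k \<and> N (\<tau> k) - F k \<le> t}"
      show "k \<in> \<tau> ` {l. l < m \<and> Q (\<tau> l) \<and> N l - F (\<tau> l) \<le> t}"
        by (rule image_eqI[of _ _ "\<tau> k"]) (use k \<tau>m \<tau>(4) in simp_all)
    next
      fix k assume "k \<in> \<tau> ` {l. l < m \<and> Q (\<tau> l) \<and> N l - F (\<tau> l) \<le> t}"
      then obtain l where l: "k = \<tau> l" "l < m" "Q (\<tau> l)" "N l - F (\<tau> l) \<le> t" by blast
      then show "k \<in> {k. k < m \<and> Q k \<and> N (\<tau> k) - F k \<le> t}" using \<tau>m[OF l(2)] \<tau>(4) by simp
    qed
    moreover have "card (\<tau> ` {l. l < m \<and> Q (\<tau> l) \<and> N l - F (\<tau> l) \<le> t}) =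
        card {l. l < m \<and> Q (\<tau> l) \<and> N l - F (\<tau> l) \<le> t}"
      by (rule card_image, rule inj_on_subset[OF \<open>inj \<tau>\<close> subset_UNIV])
    ultimately show ?thesis by (simp only:)
  qed
  have links': "card {k. k < m \<and> E k \<le> F k \<and> E k = Suc x \<and> N (\<tau> k) - F k \<le> t} \<le>
      card {k. k < m \<and> E k \<le> F k \<and> F k = x \<and> N (\<tau> k) - F k \<le> t}" if "1 \<le> x" for x t
    using links0[OF that, of t] card\<tau>[of "\<lambda>k. E k \<le> F k \<and> E k = Suc x" t]
      card\<tau>[of "\<lambda>k. E k \<le> F k \<and> F k = x" t] by (simp add: conj_assoc)
  \<comment> \<open>The two terms are the values of \<open>h\<close> for strip \<open>k\<close>
    before and after the move. They differ only for \<open>A\<close>, where the move lowers the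
    value, and for \<open>B\<close>, where it raises it.\<close>
  define lo where "lo k = min (N k - F k) (N (\<tau> k) - F k)" for k
  define hi where "hi k = max (N k - F k) (N (\<tau> k) - F k)" for k
  have other: "lo k = N k - F k" "hi k = N k - F k" "N (\<tau> k) = N k" if "k \<noteq> A" "k \<noteq> B" for k
    using \<tau>(3)[OF that] by (simp_all add: lo_def hi_def)
  have loA: "lo A = N (\<tau> A) - F A" "hi A = N A - F A" and loB: "lo B = N B - F B" "hi B = N (\<tau> B) - F B"
    using \<tau>N ABv n by (simp_all add: lo_def hi_def)
  have "\<exists>P \<rho>. (\<forall>x\<ge>1. bij_betw \<rho> {l\<in>{l. l < m \<and> E l \<le> F l}. E l \<le> x \<and> x \<le> F l}
      {..<card {l\<in>{l. l < m \<and> E l \<le> F l}. E l \<le> x \<and> x \<le> F l}}) \<and>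
    (\<forall>l\<in>{l. l < m \<and> E l \<le> F l}. 1 < E l \<longrightarrow> P l \<in> {l. l < m \<and> E l \<le> F l} \<and> F (P l) = E l - 1 \<and>
      hi (P l) \<le> lo l \<and> \<rho> (P l) = \<rho> l)"
  proof (rule chain_labelling)
    fix x t :: nat assume x: "1 \<le> x"
    let ?s = "{l\<in>{l. l < m \<and> E l \<le> F l}. E l = Suc x \<and> lo l \<le> t}"
    let ?e = "{l\<in>{l. l < m \<and> E l \<le> F l}. F l = x \<and> hi l \<le> t}"
    show "card ?s \<le> card ?e"
    \<comment> \<open>For starting strips only \<open>lo A\<close> departs from the value in
      \<open>\<Gamma>\<close>, for ending strips only \<open>hi B\<close>. If one of them occurs at
      this \<open>x\<close>, then \<open>B\<close> does not start at \<open>x + 1\<close> and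
      \<open>A\<close> does not end at \<open>x\<close>, so all values are those of
      \<open>\<Gamma>'\<close>. Otherwise all values are those of \<open>\<Gamma>\<close>.\<close>
    proof (cases "E A = Suc x \<or> F B = x")
      case True
      have 1: "lo k = N (\<tau> k) - F k" if "E k = Suc x" "E k \<le> F k" for k
        by (cases "k = A"; cases "k = B") (use loA other[of k] True that eqAB in auto)
      have 2: "hi k = N (\<tau> k) - F k" if "F k = x" "E k \<le> F k" for k
        by (cases "k = A"; cases "k = B") (use loB other[of k] True that eqAB in auto)
      have "?s = {k. k < m \<and> E k \<le> F k \<and> E k = Suc x \<and> N (\<tau> k) - F k \<le> t}"
        using 1 by auto
      moreover have "?e = {k. k < m \<and> E k \<le> F k \<and> F k = x \<and> N (\<tau> k) - F k \<le> t}"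
        using 2 by auto
      ultimately show ?thesis using links'[OF x, of t] by (simp only:)
    next
      case False
      have 1: "lo k = N k - F k" if "E k = Suc x" for k
        by (cases "k = A"; cases "k = B") (use loB other[of k] False that in auto)
      have 2: "hi k = N k - F k" if "F k = x" for k
        by (cases "k = A"; cases "k = B") (use loA other[of k] False that in auto)
      have "?s = {k. k < m \<and> E k \<le> F k \<and> E k = Suc x \<and> N k - F k \<le> t}"
        using 1 by auto
      moreover have "?e = {k. k < m \<and> E k \<le> F k \<and> F k = x \<and> N k - F k \<le> t}"
        using 2 by auto
      ultimately show ?thesis using links[OF x, of t] by (simp only:)
    qed
  qed (use valid[OF vcs] in auto)
  then obtain P \<rho> where
    \<rho>0: "\<And>x. 1 \<le> x \<Longrightarrow> bij_betw \<rho> {l\<in>{l. l < m \<and> E l \<le> F l}. E l \<le> x \<and> x \<le> F l}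
      {..<card {l\<in>{l. l < m \<and> E l \<le> F l}. E l \<le> x \<and> x \<le> F l}}" and
    P: "\<And>l. is_strip m E F l \<Longrightarrow> 1 < E l \<Longrightarrow>
      is_strip m E F (P l) \<and> F (P l) = E l - 1 \<and> hi (P l) \<le> lo l \<and> \<rho> (P l) = \<rho> l"
    unfolding S by blast
  have \<rho>: "bij_betw \<rho> {l. l < m \<and> E l \<le> x \<and> x \<le> F l} {..<conjugate_part \<alpha> x}" if x: "1 \<le> x" for x
  proof -
    have "{l\<in>{l. l < m \<and> E l \<le> F l}. E l \<le> x \<and> x \<le> F l} = {l. l < m \<and> E l \<le> x \<and> x \<le> F l}"
      by auto
    then show ?thesis
      using \<rho>0[OF x] content[OF x] by (simp only:)
  qed
  define h where "h l = N l - F l" for l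
  have hN: "N l = h l + F l" if "l < m" for l
  proof (cases "E l \<le> F l")
    case True
    then show ?thesis using height1[OF that True] by (simp add: h_def)
  next
    case False
    then show ?thesis using vcs[OF that] by (auto simp: valid_column_def h_def)
  qed
  have hlohi: "lo l \<le> h l" "h l \<le> hi l" for l by (simp_all add: lo_def hi_def h_def)
  \<comment> \<open>Strip \<open>A\<close> in column \<open>B\<close> has \<open>N B - F A\<close>,
    and \<open>N B = h B + F B\<close>; likewise for strip \<open>B\<close> in column
    \<open>A\<close>. The last inequality is \<open>N B < N A\<close> rewritten.\<close>
  have hlo: "lo A = h B + (E B - E A)" "hi B = h A - (E B - E A)" and hAB: "h B + (E B - E A) < h A"
    using loA loB \<tau>N ABv Fn n eqAB by (simp_all add: h_def)
  have sys: "strip_system \<alpha> m E F h P \<rho> A B"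
  proof
    show "1 \<le> E l" if "l < m" for l using valid[OF vcs[OF that]] by simp
    show "F l = 0" if "l < m" "\<not> is_strip m E F l" for l
      using vcs[OF that(1)] that by (auto simp: S valid_column_def)
    show "is_strip m E F (P l) \<and> F (P l) = E l - 1 \<and> h (P l) \<le> h l \<and> \<rho> (P l) = \<rho> l"
      if "is_strip m E F l" "1 < E l" for l
      using P[OF that] hlohi(1)[of l] hlohi(2)[of "P l"] by linarith
    show "F l < E l' \<or> F l' < E l"
      if l: "is_strip m E F l" "is_strip m E F l'" "\<rho> l = \<rho> l'" "l \<noteq> l'" for l l'
    proof (rule ccontr)
      assume n: "\<not> ?thesis"
      \<comment> \<open>Two strips that overlap both contain the larger of their first entries,
        where the labelling is injective.\<close>
      define x where "x = max (E l) (E l')"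
      have x: "1 \<le> x" using l(1) valid[OF vcs, of l] by (simp add: S x_def le_max_iff_disj)
      have "l \<in> {l. l < m \<and> E l \<le> x \<and> x \<le> F l}" "l' \<in> {l. l < m \<and> E l \<le> x \<and> x \<le> F l}"
        using n l by (simp_all add: S x_def)
      then show False using bij_betw_imp_inj_on[OF \<rho>[OF x]] l(3,4) by (meson inj_onD)
    qed
    show "\<rho> l < size \<alpha> \<and> F l \<le> parts \<alpha> ! \<rho> l" if l: "is_strip m E F l" for l
    proof -
      have x: "1 \<le> F l" using l valid[OF vcs, of l] by (simp add: S)
      have "l \<in> {k. k < m \<and> E k \<le> F l \<and> F l \<le> F k}" using l by (simp add: S)
      then have "\<rho> l < conjugate_part \<alpha> (F l)" using bij_betwE[OF \<rho>[OF x]] by blast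
      then show ?thesis
        using conjugate_part_le_size[of \<alpha> "F l"] conjugate_part_gt_iff[of "\<rho> l" \<alpha> "F l"] by simp
    qed
    then have le: "F l \<le> parts \<alpha> ! \<rho> l" if "is_strip m E F l" for l using that by blast
    show "\<exists>l. is_strip m E F l \<and> \<rho> l = i \<and> F l = parts \<alpha> ! i" if i: "i < size \<alpha>" for i
    proof -
      let ?x = "parts \<alpha> ! i"
      have x: "1 \<le> ?x" using parts_pos[OF _ i] LR by (simp add: LR_tableau_def)
      \<comment> \<open>Some strip with label \<open>i\<close> contains the entry
        \<open>parts \<alpha> ! i\<close>. It must end there, since no strip with this label goes
        further.\<close>
      have "i < conjugate_part \<alpha> ?x" using conjugate_part_gt_iff[OF i] by simp
      then have "i \<in> \<rho> ` {l. l < m \<and> E l \<le> ?x \<and> ?x \<le> F l}"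
        using bij_betw_imp_surj_on[OF \<rho>[OF x]] by simp
      then obtain l where l: "l < m" "E l \<le> ?x" "?x \<le> F l" "\<rho> l = i" by blast
      then have "is_strip m E F l" by (simp add: S)
      then show ?thesis using le l by (intro exI[of _ l]) (auto intro: antisym)
    qed
    show strips: "is_strip m E F A" "is_strip m E F B" using AB eqAB by (simp_all add: S)
    show "E A < E B" "F B = F A + (E B - E A)" by (fact eqAB)+
    show "h (P A) \<le> h B + (E B - E A)" if "1 < E A"
      using P[OF strips(1) that] hlohi(2)[of "P A"] hlo(1) by linarith
    show "h A \<le> h j + (E B - E A)" if "is_strip m E F j" "1 < E j" "P j = B" for j
    proof -
      have "hi B \<le> lo j" using P[OF that(1,2)] that(3) by simp
      then show ?thesis using hlohi(1)[of j] hlo(2) by linarith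
    qed
  qed
  have G: "\<Gamma> x = {#b \<in># image_mset (\<lambda>l. h l + min (F l) (max x (E l - 1))) (mset_set {..<m}). b \<noteq> 0#}" for x
    unfolding \<Gamma>x by (intro arg_cong[where f = "filter_mset _"] image_mset_cong) (use hN in simp)
  define h' where "h' = h(A := h A - (E B - E A), B := h B + (E B - E A))"
  have h': "N l = h' l + F (\<tau> l)" if "l < m" for l
  proof -
    consider "l = A" | "l = B" | "l \<noteq> A" "l \<noteq> B" by blast
    then show ?thesis
    proof cases
      case 1
      then show ?thesis using hN[OF AB(1)] hAB eqAB \<tau> AneB by (simp add: h'_def)
    next
      case 2
      then show ?thesis using hN[OF AB(3)] eqAB \<tau> by (simp add: h'_def)
    next
      case 3
      then show ?thesis using hN[OF that] \<tau>(3) by (simp add: h'_def)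
    qed
  qed
  have G': "\<Gamma>' x = {#b \<in># image_mset (\<lambda>l. h' l + min ((F \<circ> \<tau>) l) (max x ((E \<circ> \<tau>) l - 1))) (mset_set {..<m}). b \<noteq> 0#}" for x
    unfolding \<Gamma>'x by (intro arg_cong[where f = "filter_mset _"] image_mset_cong) (simp add: h')
  show ?thesis
    unfolding size Let_def
  proof (intro exI conjI allI impI)
    show "strip_system \<alpha> m E F h P \<rho> A B" by (rule sys)
    show "h B + (E B - E A) < h A" by (rule hAB)
    show "parts \<beta> ! l = h l + F l" if "l < m" for l using parts[OF that] hN[OF that] by (rule trans)
    show "\<Gamma> x = {#b \<in># image_mset (\<lambda>l. h l + min (F l) (max x (E l - 1))) (mset_set {..<m}). b \<noteq> 0#}" for x
      by (rule G)
  qed (rule G'[unfolded h'_def \<tau>_def])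
qed

section \<open>Coordinates on the modules \<open>N\<^sub>\<beta>\<close>\<close>

lemma (in module) quotient_module_carrier:
  "carrier (quotient_module M U) = (\<lambda>x. U +>\<^bsub>M\<^esub> x) ` carrier M"
  by (auto simp: quotient_module_def A_RCOSETS_def')

lemma (in module) submodule_abelian_subgroup:
  assumes "submodule U R M"
  shows "abelian_subgroup U M"
proof (rule abelian_subgroupI3)
  show "additive_subgroup U M"
    using assms by (intro additive_subgroupI) (simp add: submodule_def)
qed (rule abelian_group_axioms)

lemma (in module) quotient_module_eq_iff:
  assumes "submodule U R M" "x \<in> carrier M" "y \<in> carrier M"
  shows "U +>\<^bsub>M\<^esub> x = U +>\<^bsub>M\<^esub> y \<longleftrightarrow> x \<ominus>\<^bsub>M\<^esub> y \<in> U"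
proof -
  interpret U: abelian_subgroup U M by (rule submodule_abelian_subgroup) fact
  have sub: "subgroup U (add_monoid M)" by (rule U.a_subgroup)
  have "x \<ominus>\<^bsub>M\<^esub> y \<in> carrier M" using assms by simp
  then have "U +>\<^bsub>M\<^esub> (x \<ominus>\<^bsub>M\<^esub> y) = U \<longleftrightarrow> x \<ominus>\<^bsub>M\<^esub> y \<in> U"
    using a_coset_join1[OF _ _ sub] a_coset_join2[OF _ sub] by blast
  then show ?thesis
    using a_coset_add_inv1[of U x y] a_coset_add_inv2[of U x y] assms U.a_subset
    by (auto simp: a_minus_def)
qed

lemma (in module) quotient_module_add:
  assumes "submodule U R M" "x \<in> carrier M" "y \<in> carrier M"
  shows "(U +>\<^bsub>M\<^esub> x) \<oplus>\<^bsub>quotient_module M U\<^esub> (U +>\<^bsub>M\<^esub> y) = U +>\<^bsub>M\<^esub> (x \<oplus>\<^bsub>M\<^esub> y)"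
proof -
  interpret U: abelian_subgroup U M by (rule submodule_abelian_subgroup) fact
  show ?thesis using U.a_rcos_sum assms by (simp add: quotient_module_def)
qed

lemma (in module) quotient_module_smult:
  assumes U: "submodule U R M" and r: "r \<in> carrier R" and x: "x \<in> carrier M"
  shows "r \<odot>\<^bsub>quotient_module M U\<^esub> (U +>\<^bsub>M\<^esub> x) = U +>\<^bsub>M\<^esub> (r \<odot>\<^bsub>M\<^esub> x)"
proof -
  interpret U: abelian_subgroup U M by (rule submodule_abelian_subgroup) fact
  have const: "U +>\<^bsub>M\<^esub> (r \<odot>\<^bsub>M\<^esub> y) = U +>\<^bsub>M\<^esub> (r \<odot>\<^bsub>M\<^esub> x)" if y: "y \<in> U +>\<^bsub>M\<^esub> x" for y
  proof -
    obtain u where u: "u \<in> U" "y = u \<oplus>\<^bsub>M\<^esub> x" using y by (auto simp: a_r_coset_def')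
    have uM: "u \<in> carrier M" using u U.a_subset by blast
    have "r \<odot>\<^bsub>M\<^esub> y \<ominus>\<^bsub>M\<^esub> r \<odot>\<^bsub>M\<^esub> x = r \<odot>\<^bsub>M\<^esub> u"
      using u uM x r by (simp add: smult_r_distr a_minus_def M.a_assoc M.r_neg)
    then show ?thesis
      using quotient_module_eq_iff[OF U] u uM x r submodule.smult_closed[OF U] by simp
  qed
  have "x \<in> U +>\<^bsub>M\<^esub> x" using a_rcosI[of "\<zero>\<^bsub>M\<^esub>" U x] U.a_subset x by simp
  then have ne: "U +>\<^bsub>M\<^esub> x \<noteq> {}" by blast
  have "(\<Union>y\<in>U +>\<^bsub>M\<^esub> x. U +>\<^bsub>M\<^esub> (r \<odot>\<^bsub>M\<^esub> y)) = U +>\<^bsub>M\<^esub> (r \<odot>\<^bsub>M\<^esub> x)"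
    by (rule SUP_eq_const[OF ne const])
  then show ?thesis by (simp add: quotient_module_def)
qed

text \<open>The isomorphism theorem: the map on cosets is \<open>g\<close> at a chosen
  representative; \<open>ker\<close> makes the choice irrelevant and gives injectivity.\<close>

lemma (in module) quotient_module_isomorphic:
  assumes U: "submodule U R M" and g: "g \<in> module_homs R M N"
    and surj: "g ` carrier M = carrier N"
    and ker: "\<And>x y. x \<in> carrier M \<Longrightarrow> y \<in> carrier M \<Longrightarrow> g x = g y \<longleftrightarrow> x \<ominus>\<^bsub>M\<^esub> y \<in> U"
  shows "module_isomorphic R (quotient_module M U) N"
proof -
  define h where "h = (\<lambda>C\<in>carrier (quotient_module M U). g (SOME x. x \<in> carrier M \<and> C = U +>\<^bsub>M\<^esub> x))"
  have h: "h (U +>\<^bsub>M\<^esub> x) = g x" if x: "x \<in> carrier M" for x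
  proof -
    let ?y = "SOME y. y \<in> carrier M \<and> U +>\<^bsub>M\<^esub> x = U +>\<^bsub>M\<^esub> y"
    have y: "?y \<in> carrier M \<and> U +>\<^bsub>M\<^esub> x = U +>\<^bsub>M\<^esub> ?y" by (rule someI[of _ x]) (use x in simp)
    with y have "x \<ominus>\<^bsub>M\<^esub> ?y \<in> U" using quotient_module_eq_iff[OF U x, of ?y] by blast
    then have "g x = g ?y" using ker[OF x, of ?y] y by blast
    then show ?thesis using x by (simp add: h_def quotient_module_carrier)
  qed
  have gM: "g x \<in> carrier N" if "x \<in> carrier M" for x using g that by (auto simp: module_homs_def)
  have gadd: "g (x \<oplus>\<^bsub>M\<^esub> y) = g x \<oplus>\<^bsub>N\<^esub> g y" if "x \<in> carrier M" "y \<in> carrier M" for x y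
    using g that by (auto simp: module_homs_def)
  have gsm: "g (r \<odot>\<^bsub>M\<^esub> x) = r \<odot>\<^bsub>N\<^esub> g x" if "r \<in> carrier R" "x \<in> carrier M" for r x
    using g that by (auto simp: module_homs_def)
  have "h \<in> module_homs R (quotient_module M U) N"
    unfolding module_homs_def
  proof (intro CollectI conjI ballI)
    show "h \<in> carrier (quotient_module M U) \<rightarrow>\<^sub>E carrier N"
    proof (rule PiE_I)
      fix C assume "C \<in> carrier (quotient_module M U)"
      then show "h C \<in> carrier N" using h gM by (auto simp: quotient_module_carrier)
    qed (simp add: h_def)
  next
    fix C D assume "C \<in> carrier (quotient_module M U)" "D \<in> carrier (quotient_module M U)"
    then show "h (C \<oplus>\<^bsub>quotient_module M U\<^esub> D) = h C \<oplus>\<^bsub>N\<^esub> h D"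
      using h gadd quotient_module_add[OF U] by (auto simp: quotient_module_carrier)
  next
    fix r C assume "r \<in> carrier R" "C \<in> carrier (quotient_module M U)"
    then show "h (r \<odot>\<^bsub>quotient_module M U\<^esub> C) = r \<odot>\<^bsub>N\<^esub> h C"
      using h gsm quotient_module_smult[OF U] by (auto simp: quotient_module_carrier)
  qed
  moreover have "bij_betw h (carrier (quotient_module M U)) (carrier N)"
  proof (rule bij_betw_imageI)
    show "inj_on h (carrier (quotient_module M U))"
      using h ker quotient_module_eq_iff[OF U] by (auto simp: inj_on_def quotient_module_carrier)
    have "h ` carrier (quotient_module M U) = g ` carrier M"
      unfolding quotient_module_carrier image_image by (rule image_cong) (use h in auto)
    then show "h ` carrier (quotient_module M U) = carrier N" using surj by simp
  qed
  ultimately show ?thesis unfolding module_isomorphic_def by blast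
qed

lemma regular_module_simps [simp]:
  "carrier (regular_module R) = carrier R"
  "\<zero>\<^bsub>regular_module R\<^esub> = \<zero>\<^bsub>R\<^esub>"
  "x \<oplus>\<^bsub>regular_module R\<^esub> y = x \<oplus>\<^bsub>R\<^esub> y"
  "r \<odot>\<^bsub>regular_module R\<^esub> x = r \<otimes>\<^bsub>R\<^esub> x"
  by (simp_all add: regular_module_def)

lemma (in ring) regular_module_a_minus [simp]: "x \<ominus>\<^bsub>regular_module R\<^esub> y = x \<ominus> y"
  by (simp add: a_minus_def a_inv_def m_inv_def regular_module_def)

lemma (in cring) module_regular_module: "module R (regular_module R)"
proof (rule moduleI)
  show "abelian_group (regular_module R)"
    by (rule abelian_groupI) (auto simp: a_ac intro: l_neg)
qed (auto simp: l_distr r_distr m_assoc is_cring)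

section \<open>Divisibility by powers of \<open>p\<close>, and vectors representing elements of
  \<open>N\<^sub>\<beta>\<close>\<close>

locale uniformizer = domain R for R (structure) +
  fixes p :: 'a
  assumes p_closed [simp]: "p \<in> carrier R" and p_nonzero: "p \<noteq> \<zero>"
begin

definition pdvd :: "nat \<Rightarrow> 'a \<Rightarrow> bool" where
  "pdvd a x \<longleftrightarrow> (\<exists>q\<in>carrier R. x = p [^] a \<otimes> q)"

lemma pdvd_mult_left [intro]: "x \<in> carrier R \<Longrightarrow> pdvd a (p [^] a \<otimes> x)"
  by (auto simp: pdvd_def)

lemma pdvdE:
  assumes "pdvd a x"
  obtains q where "q \<in> carrier R" "x = p [^] a \<otimes> q"
  using assms by (auto simp: pdvd_def)

lemma pdvd_0 [simp]: "x \<in> carrier R \<Longrightarrow> pdvd 0 x"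
  unfolding pdvd_def by (rule bexI[of _ x]) auto

lemma pdvd_zero [simp]: "pdvd a \<zero>"
  unfolding pdvd_def by (rule bexI[of _ \<zero>]) auto

lemma pdvd_add: "pdvd a x \<Longrightarrow> pdvd a y \<Longrightarrow> pdvd a (x \<oplus> y)"
  unfolding pdvd_def by (metis add.m_closed nat_pow_closed p_closed r_distr)

lemma pdvd_uminus: "pdvd a x \<Longrightarrow> pdvd a (\<ominus> x)"
  unfolding pdvd_def by (metis a_inv_closed nat_pow_closed p_closed r_minus)

lemma pdvd_minus: "pdvd a x \<Longrightarrow> pdvd a y \<Longrightarrow> pdvd a (x \<ominus> y)"
  by (simp add: a_minus_def pdvd_add pdvd_uminus)

lemma pdvd_mult: "pdvd a x \<Longrightarrow> c \<in> carrier R \<Longrightarrow> pdvd a (c \<otimes> x)"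
  unfolding pdvd_def by (metis m_closed m_lcomm nat_pow_closed p_closed)

lemma pdvd_power_mult:
  assumes "pdvd b x" "a \<le> k + b"
  shows "pdvd a (p [^] k \<otimes> x)"
proof -
  obtain q where q: "q \<in> carrier R" "x = p [^] b \<otimes> q" using assms by (elim pdvdE)
  have "p [^] k \<otimes> x = p [^] (k + b) \<otimes> q" using q by (simp add: m_assoc flip: nat_pow_mult)
  also have "\<dots> = p [^] a \<otimes> (p [^] (k + b - a) \<otimes> q)"
    using q assms(2) by (simp add: nat_pow_mult flip: m_assoc)
  finally show ?thesis using q by (auto simp: pdvd_def)
qed

lemma pdvd_antimono: "pdvd b x \<Longrightarrow> a \<le> b \<Longrightarrow> pdvd a x"
  using pdvd_power_mult[of b x a 0] by (elim pdvdE) auto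

lemma pdvd_power_mult_iff:
  assumes "x \<in> carrier R"
  shows "pdvd (k + a) (p [^] k \<otimes> x) \<longleftrightarrow> pdvd a x"
proof
  assume "pdvd (k + a) (p [^] k \<otimes> x)"
  then obtain q where q: "q \<in> carrier R" "p [^] k \<otimes> x = p [^] (k + a) \<otimes> q" by (elim pdvdE)
  then have "p [^] k \<otimes> x = p [^] k \<otimes> (p [^] a \<otimes> q)" by (simp add: m_assoc flip: nat_pow_mult)
  moreover have "p [^] k \<noteq> \<zero>" by (induction k) (use p_nonzero in \<open>auto simp: integral_iff\<close>)
  ultimately have "x = p [^] a \<otimes> q" using m_lcancel[of "p [^] k" x "p [^] a \<otimes> q"] q assms by simp
  then show "pdvd a x" using q by auto
qed (rule pdvd_power_mult, assumption, simp)

lemma pdvd_iff_PIdl: "x \<in> PIdl (p [^] a) \<longleftrightarrow> pdvd a x"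
  unfolding cgenideal_def pdvd_def using m_comm by auto

text \<open>Vectors are indexed by all natural numbers; \<open>proj \<beta>\<close> sees only the
  first \<open>size \<beta>\<close> coordinates. One type of representatives thus serves all the
  modules \<open>N\<^sub>\<beta>\<close>.\<close>

definition vecs :: "(nat \<Rightarrow> 'a) set" where
  "vecs = {v. \<forall>i. v i \<in> carrier R}"

lemma vecsD [simp]: "v \<in> vecs \<Longrightarrow> v i \<in> carrier R"
  by (simp add: vecs_def)

lemma vecsI: "(\<And>i. v i \<in> carrier R) \<Longrightarrow> v \<in> vecs"
  unfolding vecs_def by blast

definition proj :: "nat multiset \<Rightarrow> (nat \<Rightarrow> 'a) \<Rightarrow> nat \<Rightarrow> 'a set" where
  "proj \<beta> v = (\<lambda>i\<in>{..<size \<beta>}. PIdl (p [^] (parts \<beta> ! i)) +>\<^bsub>regular_module R\<^esub> v i)"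

interpretation regular: module R "regular_module R"
  by (rule module_regular_module)

lemma submodule_PIdl:
  assumes "x \<in> carrier R"
  shows "submodule (PIdl x) R (regular_module R)"
proof (rule regular.submoduleI)
  interpret ideal "PIdl x" R by (rule cgenideal_ideal) fact
  show "PIdl x \<subseteq> carrier (regular_module R)" using a_subset by simp
  fix a assume "a \<in> PIdl x"
  moreover have "\<ominus>\<^bsub>regular_module R\<^esub> a = \<ominus> a" by (simp add: a_inv_def m_inv_def regular_module_def)
  ultimately show "\<ominus>\<^bsub>regular_module R\<^esub> a \<in> PIdl x" by simp
qed (auto intro: ideal.I_l_closed[OF cgenideal_ideal[OF assms]]
    additive_subgroup.a_closed[OF ideal.axioms(1)[OF cgenideal_ideal[OF assms]]]
    additive_subgroup.zero_closed[OF ideal.axioms(1)[OF cgenideal_ideal[OF assms]]])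

lemma carrier_N_module: "carrier (N_module R p \<beta>) = proj \<beta> ` vecs"
proof (intro equalityI subsetI)
  fix x assume x: "x \<in> carrier (N_module R p \<beta>)"
  let ?I = "\<lambda>i. PIdl (p [^] (parts \<beta> ! i))"
  have xi: "\<exists>a\<in>carrier R. x i = ?I i +>\<^bsub>regular_module R\<^esub> a" if "i < size \<beta>" for i
    using x that
    by (auto simp: N_module_def direct_sum_module_def regular.quotient_module_carrier PiE_def Pi_def)
  define v where "v i = (if i < size \<beta> then SOME a. a \<in> carrier R \<and> x i = ?I i +>\<^bsub>regular_module R\<^esub> a
      else \<zero>)" for i
  have v: "v i \<in> carrier R \<and> x i = ?I i +>\<^bsub>regular_module R\<^esub> v i" if "i < size \<beta>" for i
    using someI_ex[of "\<lambda>a. a \<in> carrier R \<and> x i = ?I i +>\<^bsub>regular_module R\<^esub> a"] xi[OF that] that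
    by (auto simp: v_def)
  have "x = proj \<beta> v"
  proof
    fix i
    show "x i = proj \<beta> v i"
    proof (cases "i < size \<beta>")
      case False
      then show ?thesis using x
        by (simp add: N_module_def direct_sum_module_def PiE_def extensional_def proj_def)
    qed (use v in \<open>simp add: proj_def\<close>)
  qed
  moreover have "v \<in> vecs"
  proof (rule vecsI)
    show "v i \<in> carrier R" for i using v[of i] by (cases "i < size \<beta>") (auto simp: v_def)
  qed
  ultimately show "x \<in> proj \<beta> ` vecs" by blast
next
  fix x assume "x \<in> proj \<beta> ` vecs"
  then show "x \<in> carrier (N_module R p \<beta>)"
    by (auto simp: N_module_def direct_sum_module_def regular.quotient_module_carrier proj_def)
qed

lemma proj_closed [simp]: "v \<in> vecs \<Longrightarrow> proj \<beta> v \<in> carrier (N_module R p \<beta>)"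
  by (simp add: carrier_N_module)

lemma proj_add:
  assumes "v \<in> vecs" "w \<in> vecs"
  shows "proj \<beta> v \<oplus>\<^bsub>N_module R p \<beta>\<^esub> proj \<beta> w = proj \<beta> (\<lambda>i. v i \<oplus> w i)"
  unfolding proj_def N_module_def direct_sum_module_def
  using assms regular.quotient_module_add[OF submodule_PIdl]
  by (auto simp: fun_eq_iff restrict_def)

lemma proj_smult:
  assumes "r \<in> carrier R" "v \<in> vecs"
  shows "r \<odot>\<^bsub>N_module R p \<beta>\<^esub> proj \<beta> v = proj \<beta> (\<lambda>i. r \<otimes> v i)"
  unfolding proj_def N_module_def direct_sum_module_def
  using assms regular.quotient_module_smult[OF submodule_PIdl]
  by (auto simp: fun_eq_iff restrict_def)

lemma proj_eq_iff:
  assumes "v \<in> vecs" "w \<in> vecs"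
  shows "proj \<beta> v = proj \<beta> w \<longleftrightarrow> (\<forall>i<size \<beta>. pdvd (parts \<beta> ! i) (v i \<ominus> w i))"
proof -
  have "proj \<beta> v = proj \<beta> w \<longleftrightarrow> (\<forall>i<size \<beta>. PIdl (p [^] (parts \<beta> ! i)) +>\<^bsub>regular_module R\<^esub> v i =
      PIdl (p [^] (parts \<beta> ! i)) +>\<^bsub>regular_module R\<^esub> w i)"
    unfolding proj_def by (auto simp: fun_eq_iff restrict_def)
  then show ?thesis
    using assms regular.quotient_module_eq_iff[OF submodule_PIdl] by (simp add: pdvd_iff_PIdl)
qed

lemma N_module_zero: "\<zero>\<^bsub>N_module R p \<beta>\<^esub> = proj \<beta> (\<lambda>_. \<zero>)"
proof -
  have "PIdl (p [^] a) +>\<^bsub>regular_module R\<^esub> \<zero> = PIdl (p [^] a)" for a :: nat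
  proof -
    interpret abelian_subgroup "PIdl (p [^] a)" "regular_module R"
      by (rule regular.submodule_abelian_subgroup, rule submodule_PIdl) simp
    show ?thesis using regular.a_coset_add_zero[OF a_subset] by simp
  qed
  then show ?thesis
    by (simp add: N_module_def direct_sum_module_def quotient_module_def proj_def)
qed

lemma module_N_module: "module R (N_module R p \<beta>)"
proof (rule moduleI)
  let ?N = "N_module R p \<beta>"
  show "abelian_group ?N"
  proof (rule abelian_groupI)
    show "\<exists>y\<in>carrier ?N. y \<oplus>\<^bsub>?N\<^esub> x = \<zero>\<^bsub>?N\<^esub>" if x: "x \<in> carrier ?N" for x
    proof -
      obtain v where v: "v \<in> vecs" "x = proj \<beta> v" using x by (auto simp: carrier_N_module)
      have w: "(\<lambda>i. \<ominus> v i) \<in> vecs" using v by (intro vecsI) simp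
      have "proj \<beta> (\<lambda>i. \<ominus> v i) \<oplus>\<^bsub>?N\<^esub> x = \<zero>\<^bsub>?N\<^esub>"
        using v w by (simp add: proj_add N_module_zero l_neg)
      then show ?thesis using w proj_closed by blast
    qed
  qed (auto simp: carrier_N_module N_module_zero proj_add vecsI a_ac)
qed (auto simp: carrier_N_module proj_add proj_smult vecsI l_distr r_distr m_assoc is_cring)

section \<open>Matrices and the homomorphisms they induce\<close>

text \<open>A row of a matrix is treated as a map instead of a list of coefficients, which makes
  formulas with case distinctions usable directly as rows.\<close>

definition linear_functional :: "((nat \<Rightarrow> 'a) \<Rightarrow> 'a) \<Rightarrow> bool" where
  "linear_functional g \<longleftrightarrow> (\<forall>v\<in>vecs. g v \<in> carrier R) \<and>
     (\<forall>v\<in>vecs. \<forall>w\<in>vecs. g (\<lambda>i. v i \<oplus> w i) = g v \<oplus> g w) \<and>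
     (\<forall>r\<in>carrier R. \<forall>v\<in>vecs. g (\<lambda>i. r \<otimes> v i) = r \<otimes> g v)"

lemma linear_functionalD:
  assumes "linear_functional g"
  shows linear_functional_closed: "v \<in> vecs \<Longrightarrow> g v \<in> carrier R"
    and linear_functional_add: "v \<in> vecs \<Longrightarrow> w \<in> vecs \<Longrightarrow> g (\<lambda>i. v i \<oplus> w i) = g v \<oplus> g w"
    and linear_functional_smult: "r \<in> carrier R \<Longrightarrow> v \<in> vecs \<Longrightarrow> g (\<lambda>i. r \<otimes> v i) = r \<otimes> g v"
  using assms by (auto simp: linear_functional_def)

lemma linear_functional_minus:
  assumes "linear_functional g" "v \<in> vecs" "w \<in> vecs"
  shows "g (\<lambda>i. v i \<ominus> w i) = g v \<ominus> g w"
proof -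
  have "g (\<lambda>i. (v i \<ominus> w i) \<oplus> w i) = g (\<lambda>i. v i \<ominus> w i) \<oplus> g w"
    using assms by (intro linear_functional_add) (auto intro: vecsI)
  moreover have "(\<lambda>i. (v i \<ominus> w i) \<oplus> w i) = v"
    using assms by (auto simp: fun_eq_iff a_minus_def a_assoc l_neg)
  moreover have "g (\<lambda>i. v i \<ominus> w i) \<in> carrier R"
    using assms by (intro linear_functional_closed) (auto intro: vecsI)
  ultimately show ?thesis
    using linear_functional_closed[OF assms(1)] assms(2,3) by (simp add: a_minus_def a_assoc r_neg)
qed

lemma linear_functional_coord: "linear_functional (\<lambda>v. v i)"
  by (simp add: linear_functional_def)

lemma linear_functional_scale:
  "linear_functional g \<Longrightarrow> c \<in> carrier R \<Longrightarrow> linear_functional (\<lambda>v. c \<otimes> g v)"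
  by (auto simp: linear_functional_def r_distr m_lcomm)

lemma linear_functional_sum:
  "linear_functional g \<Longrightarrow> linear_functional h \<Longrightarrow> linear_functional (\<lambda>v. g v \<oplus> h v)"
  by (auto simp: linear_functional_def r_distr a_ac)

lemma linear_functional_diff:
  "linear_functional g \<Longrightarrow> linear_functional h \<Longrightarrow> linear_functional (\<lambda>v. g v \<ominus> h v)"
  by (auto simp: linear_functional_def a_minus_def r_distr r_minus minus_add a_ac)

lemma linear_functional_zero: "linear_functional (\<lambda>v. \<zero>)"
  by (simp add: linear_functional_def)

lemma linear_functional_if:
  "(c \<Longrightarrow> linear_functional g) \<Longrightarrow> (\<not> c \<Longrightarrow> linear_functional h) \<Longrightarrow>
    linear_functional (\<lambda>v. if c then g v else h v)"
  by (cases c) auto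

lemmas linear_functional_intros = linear_functional_coord linear_functional_scale
  linear_functional_sum linear_functional_diff linear_functional_zero linear_functional_if

text \<open>A matrix is given by its rows, as a family of linear functionals; it descends to
  \<open>N\<^sub>\<alpha> \<rightarrow> N\<^sub>\<beta>\<close> if it maps vectors representing \<open>0\<close> to such vectors.\<close>

definition compatible :: "nat multiset \<Rightarrow> nat multiset \<Rightarrow> ((nat \<Rightarrow> 'a) \<Rightarrow> nat \<Rightarrow> 'a) \<Rightarrow> bool" where
  "compatible \<alpha> \<beta> F \<longleftrightarrow> (\<forall>j. linear_functional (\<lambda>v. F v j)) \<and>
     (\<forall>v\<in>vecs. (\<forall>i<size \<alpha>. pdvd (parts \<alpha> ! i) (v i)) \<longrightarrow>
       (\<forall>j<size \<beta>. pdvd (parts \<beta> ! j) (F v j)))"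

text \<open>The value is computed at an arbitrary representative; compatibility makes it independent
  of the choice, as in \<open>induced_proj\<close>.\<close>

definition induced :: "nat multiset \<Rightarrow> nat multiset \<Rightarrow> ((nat \<Rightarrow> 'a) \<Rightarrow> nat \<Rightarrow> 'a) \<Rightarrow>
    (nat \<Rightarrow> 'a set) \<Rightarrow> nat \<Rightarrow> 'a set" where
  "induced \<alpha> \<beta> F = (\<lambda>x\<in>carrier (N_module R p \<alpha>). proj \<beta> (F (SOME v. v \<in> vecs \<and> proj \<alpha> v = x)))"

lemma compatible_vecs: "compatible \<alpha> \<beta> F \<Longrightarrow> v \<in> vecs \<Longrightarrow> F v \<in> vecs"
  by (intro vecsI) (auto simp: compatible_def dest: linear_functional_closed)

lemma compatible_add:
  "compatible \<alpha> \<beta> F \<Longrightarrow> v \<in> vecs \<Longrightarrow> w \<in> vecs \<Longrightarrow> F (\<lambda>i. v i \<oplus> w i) = (\<lambda>j. F v j \<oplus> F w j)"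
  by (auto simp: compatible_def fun_eq_iff dest: linear_functional_add)

lemma compatible_smult:
  "compatible \<alpha> \<beta> F \<Longrightarrow> r \<in> carrier R \<Longrightarrow> v \<in> vecs \<Longrightarrow> F (\<lambda>i. r \<otimes> v i) = (\<lambda>j. r \<otimes> F v j)"
  by (auto simp: compatible_def fun_eq_iff dest: linear_functional_smult)

lemma compatible_minus:
  "compatible \<alpha> \<beta> F \<Longrightarrow> v \<in> vecs \<Longrightarrow> w \<in> vecs \<Longrightarrow> F (\<lambda>i. v i \<ominus> w i) = (\<lambda>j. F v j \<ominus> F w j)"
  by (auto simp: compatible_def fun_eq_iff dest: linear_functional_minus)

lemma induced_proj:
  assumes F: "compatible \<alpha> \<beta> F" and v: "v \<in> vecs"
  shows "induced \<alpha> \<beta> F (proj \<alpha> v) = proj \<beta> (F v)"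
proof -
  let ?w = "SOME w. w \<in> vecs \<and> proj \<alpha> w = proj \<alpha> v"
  have w: "?w \<in> vecs" "proj \<alpha> ?w = proj \<alpha> v"
    using someI[of "\<lambda>w. w \<in> vecs \<and> proj \<alpha> w = proj \<alpha> v" v] v by auto
  have d: "(\<lambda>i. ?w i \<ominus> v i) \<in> vecs" using w(1) v by (intro vecsI) simp
  have "\<forall>i<size \<alpha>. pdvd (parts \<alpha> ! i) (?w i \<ominus> v i)" using w v proj_eq_iff by blast
  then have "\<forall>j<size \<beta>. pdvd (parts \<beta> ! j) (F ?w j \<ominus> F v j)"
    using F d compatible_minus[OF F w(1) v] by (auto simp: compatible_def)
  then have "proj \<beta> (F ?w) = proj \<beta> (F v)"
    using compatible_vecs[OF F] w(1) v by (simp add: proj_eq_iff)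
  then show ?thesis using v by (simp add: induced_def)
qed

lemma induced_hom:
  assumes F: "compatible \<alpha> \<beta> F"
  shows "induced \<alpha> \<beta> F \<in> module_homs R (N_module R p \<alpha>) (N_module R p \<beta>)"
  unfolding module_homs_def
proof (intro CollectI conjI ballI)
  show "induced \<alpha> \<beta> F \<in> carrier (N_module R p \<alpha>) \<rightarrow>\<^sub>E carrier (N_module R p \<beta>)"
  proof (rule PiE_I)
    fix x assume "x \<in> carrier (N_module R p \<alpha>)"
    then show "induced \<alpha> \<beta> F x \<in> carrier (N_module R p \<beta>)"
      using compatible_vecs[OF F] by (auto simp: carrier_N_module induced_proj[OF F])
  qed (simp add: induced_def)
next
  fix x y assume "x \<in> carrier (N_module R p \<alpha>)" "y \<in> carrier (N_module R p \<alpha>)"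
  then show "induced \<alpha> \<beta> F (x \<oplus>\<^bsub>N_module R p \<alpha>\<^esub> y) =
      induced \<alpha> \<beta> F x \<oplus>\<^bsub>N_module R p \<beta>\<^esub> induced \<alpha> \<beta> F y"
    using compatible_vecs[OF F]
    by (auto simp: carrier_N_module induced_proj[OF F] proj_add vecsI compatible_add[OF F])
next
  fix r x assume "r \<in> carrier R" "x \<in> carrier (N_module R p \<alpha>)"
  then show "induced \<alpha> \<beta> F (r \<odot>\<^bsub>N_module R p \<alpha>\<^esub> x) = r \<odot>\<^bsub>N_module R p \<beta>\<^esub> induced \<alpha> \<beta> F x"
    using compatible_vecs[OF F]
    by (auto simp: carrier_N_module induced_proj[OF F] proj_smult vecsI compatible_smult[OF F])
qed

lemma induced_inj:
  assumes F: "compatible \<alpha> \<beta> F"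
    and reflect: "\<And>v i. v \<in> vecs \<Longrightarrow> (\<And>j. j < size \<beta> \<Longrightarrow> pdvd (parts \<beta> ! j) (F v j)) \<Longrightarrow>
      i < size \<alpha> \<Longrightarrow> pdvd (parts \<alpha> ! i) (v i)"
  shows "inj_on (induced \<alpha> \<beta> F) (carrier (N_module R p \<alpha>))"
proof (rule inj_onI)
  fix x y assume "x \<in> carrier (N_module R p \<alpha>)" "y \<in> carrier (N_module R p \<alpha>)"
  then obtain v w where v: "v \<in> vecs" "x = proj \<alpha> v" and w: "w \<in> vecs" "y = proj \<alpha> w"
    by (auto simp: carrier_N_module)
  assume "induced \<alpha> \<beta> F x = induced \<alpha> \<beta> F y"
  then have "\<forall>j<size \<beta>. pdvd (parts \<beta> ! j) (F v j \<ominus> F w j)"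
    using v w compatible_vecs[OF F] by (simp add: induced_proj[OF F] proj_eq_iff)
  then have "\<forall>j<size \<beta>. pdvd (parts \<beta> ! j) (F (\<lambda>i. v i \<ominus> w i) j)"
    using compatible_minus[OF F] v w by simp
  moreover have "(\<lambda>i. v i \<ominus> w i) \<in> vecs" using v w by (intro vecsI) simp
  ultimately have "\<forall>i<size \<alpha>. pdvd (parts \<alpha> ! i) (v i \<ominus> w i)"
    using reflect[of "\<lambda>i. v i \<ominus> w i"] by blast
  then show "x = y" using v w by (simp add: proj_eq_iff)
qed

lemma compatible_scale:
  assumes F: "compatible \<alpha> \<beta> F" and c: "c \<in> carrier R"
  shows "compatible \<alpha> \<beta> (\<lambda>v j. c \<otimes> F v j)"
  using assms unfolding compatible_def by (auto intro: linear_functional_scale pdvd_mult)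

lemma compatible_sum:
  assumes "compatible \<alpha> \<beta> F" "compatible \<alpha> \<beta> G"
  shows "compatible \<alpha> \<beta> (\<lambda>v j. F v j \<oplus> G v j)"
  using assms unfolding compatible_def by (auto intro: linear_functional_sum pdvd_add)

lemma linear_functional_comp:
  assumes g: "linear_functional g" and F: "\<And>j. linear_functional (\<lambda>v. F v j)"
  shows "linear_functional (\<lambda>v. g (F v))"
proof -
  have Fv: "F v \<in> vecs" if "v \<in> vecs" for v
    by (rule vecsI, rule linear_functional_closed[OF F that])
  have "F (\<lambda>i. v i \<oplus> w i) = (\<lambda>j. F v j \<oplus> F w j)" if "v \<in> vecs" "w \<in> vecs" for v w
    using linear_functional_add[OF F that] by (rule ext)
  moreover have "F (\<lambda>i. r \<otimes> v i) = (\<lambda>j. r \<otimes> F v j)" if "r \<in> carrier R" "v \<in> vecs" for r v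
    using linear_functional_smult[OF F that] by (rule ext)
  ultimately show ?thesis
    using g Fv by (simp add: linear_functional_def)
qed

lemma compatible_comp:
  assumes F: "compatible \<alpha> \<beta> F" and G: "compatible \<beta> \<gamma> G"
  shows "compatible \<alpha> \<gamma> (\<lambda>v. G (F v))"
  unfolding compatible_def
proof (intro conjI allI ballI impI)
  show "linear_functional (\<lambda>v. G (F v) j)" for j
    by (rule linear_functional_comp[where g = "\<lambda>v. G v j"])
      (use F G in \<open>simp_all add: compatible_def\<close>)
  fix v j assume v: "v \<in> vecs" "\<forall>i<size \<alpha>. pdvd (parts \<alpha> ! i) (v i)" and j: "j < size \<gamma>"
  have "\<forall>i<size \<beta>. pdvd (parts \<beta> ! i) (F v i)" using F v by (simp add: compatible_def)
  then show "pdvd (parts \<gamma> ! j) (G (F v) j)"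
    using G compatible_vecs[OF F v(1)] j by (simp add: compatible_def)
qed

lemma compatible_id: "compatible \<beta> \<beta> (\<lambda>v. v)"
  by (simp add: compatible_def linear_functional_coord)

lemma induced_cong:
  assumes "\<And>v. v \<in> vecs \<Longrightarrow> F v = G v"
  shows "induced \<alpha> \<beta> F = induced \<alpha> \<beta> G"
  unfolding induced_def
proof (rule restrict_ext)
  fix x assume "x \<in> carrier (N_module R p \<alpha>)"
  then have "(SOME v. v \<in> vecs \<and> proj \<alpha> v = x) \<in> vecs"
    using someI_ex[of "\<lambda>v. v \<in> vecs \<and> proj \<alpha> v = x"] by (auto simp: carrier_N_module)
  then show "proj \<beta> (F (SOME v. v \<in> vecs \<and> proj \<alpha> v = x)) =
      proj \<beta> (G (SOME v. v \<in> vecs \<and> proj \<alpha> v = x))"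
    by (simp only: assms)
qed

lemma vecs_minus: "v \<in> vecs \<Longrightarrow> w \<in> vecs \<Longrightarrow> (\<lambda>i. v i \<ominus> w i) \<in> vecs"
  by (rule vecsI) simp

lemma proj_minus:
  assumes v: "v \<in> vecs" and w: "w \<in> vecs"
  shows "proj \<beta> v \<ominus>\<^bsub>N_module R p \<beta>\<^esub> proj \<beta> w = proj \<beta> (\<lambda>i. v i \<ominus> w i)"
proof -
  interpret N: module R "N_module R p \<beta>" by (rule module_N_module)
  have "proj \<beta> (\<lambda>i. v i \<ominus> w i) \<oplus>\<^bsub>N_module R p \<beta>\<^esub> proj \<beta> w = proj \<beta> (\<lambda>i. (v i \<ominus> w i) \<oplus> w i)"
    by (rule proj_add[OF vecs_minus[OF v w] w])
  also have "(\<lambda>i. (v i \<ominus> w i) \<oplus> w i) = v"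
    using v w by (auto simp: fun_eq_iff a_minus_def a_assoc l_neg)
  finally have "proj \<beta> v = proj \<beta> (\<lambda>i. v i \<ominus> w i) \<oplus>\<^bsub>N_module R p \<beta>\<^esub> proj \<beta> w" by simp
  then show ?thesis
    using proj_closed[OF v] proj_closed[OF w] proj_closed[OF vecs_minus[OF v w]]
    by (simp add: a_minus_def N.a_assoc N.r_neg)
qed

lemma proj_eq_zero_iff:
  assumes "v \<in> vecs"
  shows "proj \<beta> v = \<zero>\<^bsub>N_module R p \<beta>\<^esub> \<longleftrightarrow> (\<forall>i<size \<beta>. pdvd (parts \<beta> ! i) (v i))"
proof -
  have "(\<lambda>_. \<zero>) \<in> vecs" by (rule vecsI) simp
  then show ?thesis using assms unfolding N_module_zero by (simp add: proj_eq_iff a_minus_def)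
qed

lemma induced_image:
  assumes F: "compatible \<alpha> \<beta> F"
  shows "induced \<alpha> \<beta> F ` carrier (N_module R p \<alpha>) = (\<lambda>v. proj \<beta> (F v)) ` vecs"
  unfolding carrier_N_module image_image by (rule image_cong) (simp_all add: induced_proj[OF F])

lemma induced_image_submodule:
  assumes F: "compatible \<alpha> \<beta> F"
  shows "submodule (induced \<alpha> \<beta> F ` carrier (N_module R p \<alpha>)) R (N_module R p \<beta>)"
proof -
  interpret N: module R "N_module R p \<beta>" by (rule module_N_module)
  let ?A = "(\<lambda>v. proj \<beta> (F v)) ` vecs"
  have Fv: "F v \<in> vecs" if "v \<in> vecs" for v using compatible_vecs[OF F that] .
  have sm: "r \<odot>\<^bsub>N_module R p \<beta>\<^esub> x \<in> ?A" if r: "r \<in> carrier R" and x: "x \<in> ?A" for r x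
  proof -
    obtain v where v: "v \<in> vecs" "x = proj \<beta> (F v)" using x by blast
    then have "r \<odot>\<^bsub>N_module R p \<beta>\<^esub> x = proj \<beta> (F (\<lambda>i. r \<otimes> v i))"
      using r Fv compatible_smult[OF F] by (simp add: proj_smult)
    moreover have "(\<lambda>i. r \<otimes> v i) \<in> vecs" using v r by (intro vecsI) simp
    ultimately show ?thesis by blast
  qed
  have "submodule ?A R (N_module R p \<beta>)"
  proof (rule N.submoduleI)
    show sub: "?A \<subseteq> carrier (N_module R p \<beta>)" using Fv by auto
    show "\<ominus>\<^bsub>N_module R p \<beta>\<^esub> x \<in> ?A" if x: "x \<in> ?A" for x
    proof -
      have "x \<in> carrier (N_module R p \<beta>)" using sub x by blast
      then have "\<ominus>\<^bsub>N_module R p \<beta>\<^esub> x = (\<ominus> \<one>) \<odot>\<^bsub>N_module R p \<beta>\<^esub> x"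
        by (simp add: N.smult_l_minus)
      then show ?thesis using sm[of "\<ominus> \<one>" x] x by simp
    qed
    have "(\<lambda>_. \<zero>) \<in> vecs" by (rule vecsI) simp
    then have "\<zero> \<odot>\<^bsub>N_module R p \<beta>\<^esub> proj \<beta> (F (\<lambda>_. \<zero>)) \<in> ?A" by (intro sm) auto
    moreover have "\<zero> \<odot>\<^bsub>N_module R p \<beta>\<^esub> proj \<beta> (F (\<lambda>_. \<zero>)) = \<zero>\<^bsub>N_module R p \<beta>\<^esub>"
      using Fv \<open>(\<lambda>_. \<zero>) \<in> vecs\<close> by (intro N.smult_l_null) simp
    ultimately show "\<zero>\<^bsub>N_module R p \<beta>\<^esub> \<in> ?A" by simp
  next
    fix x y assume "x \<in> ?A" "y \<in> ?A"
    then obtain v w where v: "v \<in> vecs" "x = proj \<beta> (F v)" and w: "w \<in> vecs" "y = proj \<beta> (F w)"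
      by blast
    then have "x \<oplus>\<^bsub>N_module R p \<beta>\<^esub> y = proj \<beta> (F (\<lambda>i. v i \<oplus> w i))"
      using Fv compatible_add[OF F] by (simp add: proj_add)
    moreover have "(\<lambda>i. v i \<oplus> w i) \<in> vecs" using v w by (intro vecsI) simp
    ultimately show "x \<oplus>\<^bsub>N_module R p \<beta>\<^esub> y \<in> ?A" by blast
  qed (rule sm)
  then show ?thesis by (simp add: induced_image[OF F])
qed

section \<open>Types of quotients and tableaux of images\<close>

text \<open>The functionals \<open>\<theta>\<close> are coordinates adapted to \<open>U\<close>:
  their first \<open>m\<close> values can be prescribed freely, and \<open>U\<close> is cut out by
  divisibility of the \<open>l\<close>-th one by \<open>p^(\<delta> l)\<close>. The quotient is then
  a direct sum of cyclic modules with exponents \<open>\<delta> l\<close>, the exponents 0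
  contributing nothing.\<close>

lemma has_type_quotient:
  assumes U: "submodule U R (N_module R p \<beta>)"
    and lin: "\<And>j. linear_functional (\<lambda>v. \<theta> v j)"
    and surj: "\<And>w. w \<in> vecs \<Longrightarrow> \<exists>v\<in>vecs. \<forall>l<m. \<theta> v l = w l"
    and ker: "\<And>v. v \<in> vecs \<Longrightarrow> proj \<beta> v \<in> U \<longleftrightarrow> (\<forall>l<m. pdvd (\<delta> l) (\<theta> v l))"
  shows "has_type R p (quotient_module (N_module R p \<beta>) U)
    {#h \<in># image_mset \<delta> (mset_set {..<m}). h \<noteq> 0#}"
proof -
  interpret N: module R "N_module R p \<beta>" by (rule module_N_module)
  define \<gamma> where "\<gamma> = {#h \<in># image_mset \<delta> (mset_set {..<m}). h \<noteq> 0#}"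
  \<comment> \<open>Positions with non-zero exponent in decreasing order of exponent, so that the
    j-th of them matches the j-th part of \<open>\<gamma>\<close>.\<close>
  define xs where "xs = rev (sort_key \<delta> (filter (\<lambda>l. \<delta> l \<noteq> 0) [0..<m]))"
  have setxs: "set xs = {l. l < m \<and> \<delta> l \<noteq> 0}" and dist: "distinct xs"
    by (auto simp: xs_def)
  have "mset (filter (\<lambda>l. \<delta> l \<noteq> 0) [0..<m]) = {#l \<in># mset_set {..<m}. \<delta> l \<noteq> 0#}"
    by (simp only: mset_filter mset_upt atLeast0LessThan)
  then have "mset (map \<delta> (filter (\<lambda>l. \<delta> l \<noteq> 0) [0..<m])) = \<gamma>"
    by (simp only: mset_map filter_mset_image_mset \<gamma>_def)
  then have map: "map \<delta> xs = parts \<gamma>"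
    using map_rev_sort_key[of \<delta> "filter (\<lambda>l. \<delta> l \<noteq> 0) [0..<m]"] by (simp only: xs_def)
  then have len: "length xs = size \<gamma>" by (metis length_map length_parts)
  have nth: "parts \<gamma> ! j = \<delta> (xs ! j)" if "j < size \<gamma>" for j
    unfolding map[symmetric] using that len by (intro nth_map) simp
  have all: "(\<forall>l<m. pdvd (\<delta> l) (\<theta> v l)) \<longleftrightarrow> (\<forall>j<size \<gamma>. pdvd (parts \<gamma> ! j) (\<theta> v (xs ! j)))"
    if v: "v \<in> vecs" for v
  proof
    assume "\<forall>l<m. pdvd (\<delta> l) (\<theta> v l)"
    moreover have "xs ! j < m" if "j < size \<gamma>" for j
      using setxs nth_mem[of j xs] that len by simp
    ultimately show "\<forall>j<size \<gamma>. pdvd (parts \<gamma> ! j) (\<theta> v (xs ! j))" using nth by simp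
  next
    assume r: "\<forall>j<size \<gamma>. pdvd (parts \<gamma> ! j) (\<theta> v (xs ! j))"
    show "\<forall>l<m. pdvd (\<delta> l) (\<theta> v l)"
    proof (intro allI impI)
      fix l assume l: "l < m"
      show "pdvd (\<delta> l) (\<theta> v l)"
      proof (cases "\<delta> l = 0")
        case True
        then show ?thesis using linear_functional_closed[OF lin v] by simp
      next
        case False
        then obtain j where "j < length xs" "xs ! j = l" using setxs l by (metis (mono_tags, lifting) in_set_conv_nth mem_Collect_eq)
        then show ?thesis using r nth[of j] len by auto
      qed
    qed
  qed
  define F where "F v j = (if j < size \<gamma> then \<theta> v (xs ! j) else \<zero>)" for v j
  have Flin: "linear_functional (\<lambda>v. F v j)" for j
    unfolding F_def by (intro linear_functional_if lin linear_functional_zero)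
  have F: "compatible \<beta> \<gamma> F"
    unfolding compatible_def
  proof (intro conjI allI ballI impI Flin)
    fix v j assume v: "v \<in> vecs" "\<forall>i<size \<beta>. pdvd (parts \<beta> ! i) (v i)" and j: "j < size \<gamma>"
    have "proj \<beta> v = \<zero>\<^bsub>N_module R p \<beta>\<^esub>" using v by (simp add: proj_eq_zero_iff)
    then have "proj \<beta> v \<in> U" using U by (simp add: submodule_def subgroup_def)
    then show "pdvd (parts \<gamma> ! j) (F v j)" using ker all v j by (simp add: F_def)
  qed
  have "module_isomorphic R (quotient_module (N_module R p \<beta>) U) (N_module R p \<gamma>)"
  proof (rule N.quotient_module_isomorphic[OF U induced_hom[OF F]])
    have onto: "proj \<gamma> w \<in> (\<lambda>v. proj \<gamma> (F v)) ` vecs" if w: "w \<in> vecs" for w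
    proof -
      \<comment> \<open>Places the prescribed value \<open>w j\<close> at position
        \<open>xs ! j\<close>, and zero at the positions whose summand is trivial.\<close>
      define w' where "w' l = (if l \<in> set xs then w (the_inv_into {..<length xs} ((!) xs) l) else \<zero>)" for l
      have "w' \<in> vecs" using w by (auto intro!: vecsI simp: w'_def)
      then obtain v where v: "v \<in> vecs" "\<forall>l<m. \<theta> v l = w' l" using surj by blast
      have "F v j = w j" if "j < size \<gamma>" for j
      proof -
        have j: "j < length xs" using that len by simp
        have inj: "inj_on ((!) xs) {..<length xs}" using dist by (simp add: inj_on_nth)
        have "xs ! j \<in> set xs" using j by simp
        then have "F v j = w' (xs ! j)" using that v setxs by (simp add: F_def)
        also have "\<dots> = w j" using j the_inv_into_f_f[OF inj, of j] by (simp add: w'_def)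
        finally show ?thesis .
      qed
      then have "proj \<gamma> w = proj \<gamma> (F v)" unfolding proj_def by (intro restrict_ext) simp
      then show ?thesis using v(1) by blast
    qed
    show "induced \<beta> \<gamma> F ` carrier (N_module R p \<beta>) = carrier (N_module R p \<gamma>)"
      unfolding induced_image[OF F] unfolding carrier_N_module
    proof
      show "(\<lambda>v. proj \<gamma> (F v)) ` vecs \<subseteq> proj \<gamma> ` vecs"
        by (rule image_subsetI, rule imageI, rule compatible_vecs[OF F])
      show "proj \<gamma> ` vecs \<subseteq> (\<lambda>v. proj \<gamma> (F v)) ` vecs"
        by (rule image_subsetI, rule onto)
    qed
  next
    fix x y assume "x \<in> carrier (N_module R p \<beta>)" "y \<in> carrier (N_module R p \<beta>)"
    then obtain v w where v: "v \<in> vecs" "x = proj \<beta> v" and w: "w \<in> vecs" "y = proj \<beta> w"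
      by (auto simp: carrier_N_module)
    have d: "(\<lambda>i. v i \<ominus> w i) \<in> vecs" using v w vecs_minus by blast
    have "induced \<beta> \<gamma> F x = induced \<beta> \<gamma> F y \<longleftrightarrow>
        (\<forall>j<size \<gamma>. pdvd (parts \<gamma> ! j) (F v j \<ominus> F w j))"
      using v w compatible_vecs[OF F] by (simp add: induced_proj[OF F] proj_eq_iff)
    also have "\<dots> \<longleftrightarrow> (\<forall>j<size \<gamma>. pdvd (parts \<gamma> ! j) (\<theta> (\<lambda>i. v i \<ominus> w i) (xs ! j)))"
      using linear_functional_minus[OF lin v(1) w(1)] by (simp add: F_def)
    also have "\<dots> \<longleftrightarrow> proj \<beta> (\<lambda>i. v i \<ominus> w i) \<in> U"
      using ker[OF d] all[OF d] by simp
    finally show "induced \<beta> \<gamma> F x = induced \<beta> \<gamma> F y \<longleftrightarrow> x \<ominus>\<^bsub>N_module R p \<beta>\<^esub> y \<in> U"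
      using v w by (simp add: proj_minus)
  qed
  moreover have "is_partition \<gamma>" by (simp add: is_partition_def \<gamma>_def)
  ultimately show ?thesis unfolding has_type_def \<gamma>_def by blast
qed

text \<open>The quotient criterion for each \<open>x\<close>, applied to \<open>p^x\<close> times
  the image of \<open>F\<close>, which is itself the image of the matrix \<open>p^x F\<close>. The
  task left for chains is thus to find coordinates \<open>\<theta> x\<close> for every
  \<open>x\<close>.\<close>

lemma has_tableau_induced:
  assumes F: "compatible \<alpha> \<beta> F"
    and lin: "\<And>x j. linear_functional (\<lambda>v. \<theta> x v j)"
    and surj: "\<And>x w. w \<in> vecs \<Longrightarrow> \<exists>v\<in>vecs. \<forall>l<size \<beta>. \<theta> x v l = w l"
    and ker: "\<And>x v. v \<in> vecs \<Longrightarrow>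
      (\<exists>r\<in>vecs. \<forall>l<size \<beta>. pdvd (parts \<beta> ! l) (v l \<ominus> p [^] x \<otimes> F r l)) \<longleftrightarrow>
      (\<forall>l<size \<beta>. pdvd (\<delta> x l) (\<theta> x v l))"
    and \<Gamma>: "\<And>x. \<Gamma> x = {#h \<in># image_mset (\<delta> x) (mset_set {..<size \<beta>}). h \<noteq> 0#}"
  shows "has_tableau R p (N_module R p \<beta>) (induced \<alpha> \<beta> F ` carrier (N_module R p \<alpha>)) \<Gamma>"
  unfolding has_tableau_def
proof (intro conjI exI allI)
  let ?N = "N_module R p \<beta>" and ?A = "induced \<alpha> \<beta> F ` carrier (N_module R p \<alpha>)"
  show "submodule ?A R ?N" by (rule induced_image_submodule[OF F])
  have powA: "(\<lambda>a. p [^] x \<odot>\<^bsub>?N\<^esub> a) ` ?A = (\<lambda>v. proj \<beta> (\<lambda>l. p [^] x \<otimes> F v l)) ` vecs" for x :: nat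
    unfolding induced_image[OF F] image_image
    by (rule image_cong) (simp_all add: proj_smult compatible_vecs[OF F])
  \<comment> \<open>Every part of \<open>\<beta>\<close> is at most their sum, so this power of
    \<open>p\<close> kills the whole of \<open>N\<^sub>\<beta>\<close>.\<close>
  show "(\<lambda>a. p [^] (sum_mset \<beta>) \<odot>\<^bsub>?N\<^esub> a) ` ?A = {\<zero>\<^bsub>?N\<^esub>}"
  proof -
    have "proj \<beta> (\<lambda>l. p [^] (sum_mset \<beta>) \<otimes> F v l) = \<zero>\<^bsub>?N\<^esub>" if v: "v \<in> vecs" for v
    proof -
      have Fv: "F v l \<in> carrier R" for l using compatible_vecs[OF F v] by simp
      have "parts \<beta> ! i \<le> sum_mset \<beta>" if "i < size \<beta>" for i
        using that member_le_sum_list[of "parts \<beta> ! i" "parts \<beta>"]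
        by (simp flip: sum_mset_sum_list)
      then have "pdvd (parts \<beta> ! i) (p [^] (sum_mset \<beta>) \<otimes> F v i)" if "i < size \<beta>" for i
        using pdvd_power_mult[of 0 "F v i"] Fv that by simp
      then show ?thesis using Fv by (subst proj_eq_zero_iff) (auto intro: vecsI)
    qed
    moreover have "vecs \<noteq> {}" using vecsI[of "\<lambda>_. \<zero>"] by auto
    ultimately show ?thesis unfolding powA by auto
  qed
  fix x :: nat
  have G: "compatible \<alpha> \<beta> (\<lambda>v l. p [^] x \<otimes> F v l)" by (rule compatible_scale[OF F]) simp
  have A: "(\<lambda>a. p [^] x \<odot>\<^bsub>?N\<^esub> a) ` ?A = induced \<alpha> \<beta> (\<lambda>v l. p [^] x \<otimes> F v l) ` carrier (N_module R p \<alpha>)"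
    unfolding powA induced_image[OF G] ..
  show "has_type R p (quotient_module ?N ((\<lambda>a. p [^] x \<odot>\<^bsub>?N\<^esub> a) ` ?A)) (\<Gamma> x)"
    unfolding \<Gamma>
  proof (rule has_type_quotient[OF _ lin surj])
    show "submodule ((\<lambda>a. p [^] x \<odot>\<^bsub>?N\<^esub> a) ` ?A) R ?N"
      unfolding A by (rule induced_image_submodule[OF G])
    fix v assume v: "v \<in> vecs"
    have "proj \<beta> v \<in> (\<lambda>a. p [^] x \<odot>\<^bsub>?N\<^esub> a) ` ?A \<longleftrightarrow>
        (\<exists>r\<in>vecs. proj \<beta> v = proj \<beta> (\<lambda>l. p [^] x \<otimes> F r l))"
      unfolding powA by blast
    also have "\<dots> \<longleftrightarrow> (\<exists>r\<in>vecs. \<forall>l<size \<beta>. pdvd (parts \<beta> ! l) (v l \<ominus> p [^] x \<otimes> F r l))"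
      by (rule bex_cong) (use v compatible_vecs[OF G] in \<open>simp_all add: proj_eq_iff\<close>)
    finally show "proj \<beta> v \<in> (\<lambda>a. p [^] x \<odot>\<^bsub>?N\<^esub> a) ` ?A \<longleftrightarrow> (\<forall>l<size \<beta>. pdvd (\<delta> x l) (\<theta> x v l))"
      using ker[OF v] by simp
  qed
qed

end

section \<open>Affine families of homomorphisms\<close>

text \<open>A family affine in \<open>\<mu>\<close> is polynomial with two coefficients, the maps
  induced by \<open>F0\<close> and \<open>F1\<close>. The field acts on homomorphisms through
  \<open>c \<mapsto> c 1\<close> in \<open>\<Lambda>\<close>, so its action becomes scaling of
  matrices.\<close>

lemma polynomial_map_induced:
  fixes K :: "('k, 'r) ring_scheme" and \<Lambda> :: "('k, 'a, 'm) module_scheme"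
  assumes "algebra K \<Lambda>" "uniformizer \<Lambda> p"
    and F0: "uniformizer.compatible \<Lambda> p \<alpha> \<beta> F0" and F1: "uniformizer.compatible \<Lambda> p \<alpha> \<beta> F1"
  shows "polynomial_map K
    (Hom_module K (restrict_scalars \<Lambda> (N_module \<Lambda> p \<alpha>)) (restrict_scalars \<Lambda> (N_module \<Lambda> p \<beta>)))
    (\<lambda>\<mu>. uniformizer.induced \<Lambda> p \<alpha> \<beta> (\<lambda>v j. F0 v j \<oplus>\<^bsub>\<Lambda>\<^esub> (\<mu> \<odot>\<^bsub>\<Lambda>\<^esub> \<one>\<^bsub>\<Lambda>\<^esub>) \<otimes>\<^bsub>\<Lambda>\<^esub> F1 v j))"
proof -
  interpret algebra K \<Lambda> by fact
  interpret uniformizer \<Lambda> p by fact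
  interpret N: module \<Lambda> "N_module \<Lambda> p \<beta>" by (rule module_N_module)
  let ?A = "restrict_scalars \<Lambda> (N_module \<Lambda> p \<alpha>)" and ?B = "restrict_scalars \<Lambda> (N_module \<Lambda> p \<beta>)"
  let ?V = "Hom_module K ?A ?B" and ?NA = "N_module \<Lambda> p \<alpha>" and ?NB = "N_module \<Lambda> p \<beta>"
  let ?\<iota> = "\<lambda>\<mu>. \<mu> \<odot>\<^bsub>\<Lambda>\<^esub> \<one>\<^bsub>\<Lambda>\<^esub>"
  have simps: "carrier ?V = module_homs K ?A ?B" "\<zero>\<^bsub>?V\<^esub> = (\<lambda>x\<in>carrier ?NA. \<zero>\<^bsub>?NB\<^esub>)"
    "g \<oplus>\<^bsub>?V\<^esub> h = (\<lambda>x\<in>carrier ?NA. g x \<oplus>\<^bsub>?NB\<^esub> h x)"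
    "\<mu> \<odot>\<^bsub>?V\<^esub> h = (\<lambda>x\<in>carrier ?NA. ?\<iota> \<mu> \<odot>\<^bsub>?NB\<^esub> h x)" for g h \<mu>
    by (simp_all add: Hom_module_def restrict_scalars_def)
  have \<iota>: "?\<iota> \<mu> \<in> carrier \<Lambda>" if "\<mu> \<in> carrier K" for \<mu> using that by simp
  have homs: "h \<in> module_homs K ?A ?B \<longleftrightarrow> h \<in> carrier ?NA \<rightarrow>\<^sub>E carrier ?NB \<and>
        (\<forall>x\<in>carrier ?NA. \<forall>y\<in>carrier ?NA. h (x \<oplus>\<^bsub>?NA\<^esub> y) = h x \<oplus>\<^bsub>?NB\<^esub> h y) \<and>
        (\<forall>c\<in>carrier K. \<forall>x\<in>carrier ?NA. h (?\<iota> c \<odot>\<^bsub>?NA\<^esub> x) = ?\<iota> c \<odot>\<^bsub>?NB\<^esub> h x)" for h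
    by (simp add: module_homs_def restrict_scalars_def)
  interpret NA: module \<Lambda> ?NA by (rule module_N_module)
  \<comment> \<open>Makes the rules for the finite sum in \<open>polynomial_map\<close>
    available.\<close>
  interpret V: abelian_monoid ?V
  proof (rule abelian_monoidI)
    fix g h assume "g \<in> carrier ?V" "h \<in> carrier ?V"
    then have g: "g \<in> module_homs K ?A ?B" and h: "h \<in> module_homs K ?A ?B" by (simp_all add: simps)
    have gh: "g x \<in> carrier ?NB" "h x \<in> carrier ?NB" if "x \<in> carrier ?NA" for x
      using g h that by (auto simp: homs)
    show "g \<oplus>\<^bsub>?V\<^esub> h \<in> carrier ?V"
      unfolding simps homs
      using g h gh by (auto simp: homs N.a_ac N.smult_r_distr \<iota>)
    show "g \<oplus>\<^bsub>?V\<^esub> h = h \<oplus>\<^bsub>?V\<^esub> g"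
      unfolding simps by (rule restrict_ext) (use gh in \<open>simp add: N.a_comm\<close>)
    show "\<zero>\<^bsub>?V\<^esub> \<oplus>\<^bsub>?V\<^esub> g = g"
      unfolding simps using g gh by (auto simp: fun_eq_iff homs PiE_def extensional_def)
    fix k assume "k \<in> carrier ?V"
    then have "k x \<in> carrier ?NB" if "x \<in> carrier ?NA" for x
      using that by (auto simp: simps homs)
    then show "(g \<oplus>\<^bsub>?V\<^esub> h) \<oplus>\<^bsub>?V\<^esub> k = g \<oplus>\<^bsub>?V\<^esub> (h \<oplus>\<^bsub>?V\<^esub> k)"
      unfolding simps using gh by (auto simp: fun_eq_iff N.a_assoc)
  next
    show "\<zero>\<^bsub>?V\<^esub> \<in> carrier ?V" unfolding simps homs by (auto simp: \<iota>)
  qed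
  have ind: "induced \<alpha> \<beta> F \<in> carrier ?V" if "compatible \<alpha> \<beta> F" for F
    using induced_hom[OF that] \<iota> unfolding simps homs by (auto simp: module_homs_def)
  define \<psi> where "\<psi> i = (if i = 0 then induced \<alpha> \<beta> F0 else induced \<alpha> \<beta> F1)" for i :: nat
  have "\<psi> \<in> {..1} \<rightarrow> carrier ?V" using ind[OF F0] ind[OF F1] by (auto simp: \<psi>_def)
  moreover have "induced \<alpha> \<beta> (\<lambda>v j. F0 v j \<oplus>\<^bsub>\<Lambda>\<^esub> ?\<iota> \<mu> \<otimes>\<^bsub>\<Lambda>\<^esub> F1 v j) =
      (\<Oplus>\<^bsub>?V\<^esub> i\<in>{..1}. (\<mu> [^]\<^bsub>K\<^esub> i) \<odot>\<^bsub>?V\<^esub> \<psi> i)" if \<mu>: "\<mu> \<in> carrier K" for \<mu>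
  proof -
    have sm: "c \<odot>\<^bsub>?V\<^esub> induced \<alpha> \<beta> F = induced \<alpha> \<beta> (\<lambda>v j. ?\<iota> c \<otimes>\<^bsub>\<Lambda>\<^esub> F v j)"
      if c: "c \<in> carrier K" and F: "compatible \<alpha> \<beta> F" for c F
    proof
      fix x
      have "compatible \<alpha> \<beta> (\<lambda>v j. ?\<iota> c \<otimes>\<^bsub>\<Lambda>\<^esub> F v j)" using compatible_scale[OF F \<iota>[OF c]] .
      then show "(c \<odot>\<^bsub>?V\<^esub> induced \<alpha> \<beta> F) x = induced \<alpha> \<beta> (\<lambda>v j. ?\<iota> c \<otimes>\<^bsub>\<Lambda>\<^esub> F v j) x"
        unfolding simps using c \<iota> compatible_vecs[OF F]
        by (cases "x \<in> carrier ?NA")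
          (auto simp: carrier_N_module induced_proj proj_smult F, auto simp: induced_def carrier_N_module)
    qed
    have ad: "induced \<alpha> \<beta> F \<oplus>\<^bsub>?V\<^esub> induced \<alpha> \<beta> G = induced \<alpha> \<beta> (\<lambda>v j. F v j \<oplus>\<^bsub>\<Lambda>\<^esub> G v j)"
      if F: "compatible \<alpha> \<beta> F" and G: "compatible \<alpha> \<beta> G" for F G
    proof
      fix x
      have "compatible \<alpha> \<beta> (\<lambda>v j. F v j \<oplus>\<^bsub>\<Lambda>\<^esub> G v j)" using compatible_sum[OF F G] .
      then show "(induced \<alpha> \<beta> F \<oplus>\<^bsub>?V\<^esub> induced \<alpha> \<beta> G) x = induced \<alpha> \<beta> (\<lambda>v j. F v j \<oplus>\<^bsub>\<Lambda>\<^esub> G v j) x"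
        unfolding simps using compatible_vecs[OF F] compatible_vecs[OF G]
        by (cases "x \<in> carrier ?NA")
          (auto simp: carrier_N_module induced_proj proj_add F G, auto simp: induced_def carrier_N_module)
    qed
    have c0: "compatible \<alpha> \<beta> (\<lambda>v j. ?\<iota> \<one>\<^bsub>K\<^esub> \<otimes>\<^bsub>\<Lambda>\<^esub> F0 v j)" and c1: "compatible \<alpha> \<beta> (\<lambda>v j. ?\<iota> \<mu> \<otimes>\<^bsub>\<Lambda>\<^esub> F1 v j)"
      using compatible_scale[OF F0] compatible_scale[OF F1] \<iota> \<mu> by auto
    have "(\<Oplus>\<^bsub>?V\<^esub> i\<in>{..1}. (\<mu> [^]\<^bsub>K\<^esub> i) \<odot>\<^bsub>?V\<^esub> \<psi> i) =
        (\<Oplus>\<^bsub>?V\<^esub> i\<in>{0,1}. (\<mu> [^]\<^bsub>K\<^esub> i) \<odot>\<^bsub>?V\<^esub> \<psi> i)"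
      by (simp add: atMost_Suc insert_commute)
    also have "\<dots> = induced \<alpha> \<beta> (\<lambda>v j. ?\<iota> \<one>\<^bsub>K\<^esub> \<otimes>\<^bsub>\<Lambda>\<^esub> F0 v j) \<oplus>\<^bsub>?V\<^esub>
        induced \<alpha> \<beta> (\<lambda>v j. ?\<iota> \<mu> \<otimes>\<^bsub>\<Lambda>\<^esub> F1 v j)"
      using \<mu> ind[OF c0] ind[OF c1] by (subst V.finsum_insert) (auto simp: \<psi>_def sm F0 F1)
    also have "\<dots> = induced \<alpha> \<beta> (\<lambda>v j. ?\<iota> \<one>\<^bsub>K\<^esub> \<otimes>\<^bsub>\<Lambda>\<^esub> F0 v j \<oplus>\<^bsub>\<Lambda>\<^esub> ?\<iota> \<mu> \<otimes>\<^bsub>\<Lambda>\<^esub> F1 v j)"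
      by (rule ad[OF c0 c1])
    also have "\<dots> = induced \<alpha> \<beta> (\<lambda>v j. F0 v j \<oplus>\<^bsub>\<Lambda>\<^esub> ?\<iota> \<mu> \<otimes>\<^bsub>\<Lambda>\<^esub> F1 v j)"
      by (rule induced_cong) (simp add: compatible_vecs[OF F0])
    finally show ?thesis by simp
  qed
  ultimately show ?thesis unfolding polynomial_map_def by blast
qed

section \<open>Embeddings given by chains\<close>

text \<open>The generator with number \<open>i\<close> of the submodule has entry \<open>p\<^sup>h\<^sup>(\<^sup>l\<^sup>)\<close> in every column \<open>l\<close> of the
  chain \<open>\<rho> l = i\<close>. One additional entry \<open>\<nu> p\<^sup>h\<^sup>(\<^sup>B\<^sup>)\<^sup>+\<^sup>d\<close> in column \<open>B\<close> is allowed for the generator of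
  the chain of \<open>A\<close>.\<close>

locale chain_system = uniformizer R p + strip_system \<alpha> m e f h P \<rho> A B
  for R (structure) and p \<alpha> m e f h P \<rho> A B +
  fixes \<nu> :: 'a
  assumes \<nu>_closed: "\<nu> \<in> carrier R"
begin

definition embed :: "(nat \<Rightarrow> 'a) \<Rightarrow> nat \<Rightarrow> 'a" where
  "embed r l = (if strip l then p [^] h l \<otimes> r (\<rho> l) else \<zero>) \<oplus>
    (if l = B then \<nu> \<otimes> (p [^] (h B + d) \<otimes> r (\<rho> A)) else \<zero>)"

text \<open>Modulo the powers of \<open>p\<close> given by \<open>level x\<close>, the coordinates \<open>reduce x\<close> have as kernel \<open>p\<^sup>x\<close>
  times the submodule: the correction removes what the preceding columns determine.\<close>

definition correction :: "nat \<Rightarrow> (nat \<Rightarrow> 'a) \<Rightarrow> nat \<Rightarrow> 'a" where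
  "correction x v j =
    (if 1 < e j \<and> x < e j - 1 then p [^] (h j - h (P j)) \<otimes> v (P j) else \<zero>) \<oplus>
    (if j = B \<and> 1 < e A \<and> x < e A - 1 then \<nu> \<otimes> (p [^] (h B + d - h (P A)) \<otimes> v (P A)) else \<zero>) \<ominus>
    (if 1 < e j \<and> P j = B \<and> x < f A then \<nu> \<otimes> (p [^] (h j + d - h A) \<otimes> v A) else \<zero>)"

definition reduce :: "nat \<Rightarrow> (nat \<Rightarrow> 'a) \<Rightarrow> nat \<Rightarrow> 'a" where
  "reduce x v j = v j \<ominus> (if strip j then correction x v j else \<zero>)"

lemma closed_simps [simp]: "\<nu> \<in> carrier R" "p [^] (k::nat) \<in> carrier R"
  using \<nu>_closed by auto

lemma embed_lin: "linear_functional (\<lambda>v. embed v j)"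
  unfolding embed_def by (intro linear_functional_intros) auto

lemma correction_lin: "linear_functional (\<lambda>v. correction x v j)"
  unfolding correction_def by (intro linear_functional_intros) auto

lemma reduce_lin: "linear_functional (\<lambda>v. reduce x v j)"
  unfolding reduce_def by (intro linear_functional_intros correction_lin)

lemma embed_vecs: "r \<in> vecs \<Longrightarrow> embed r \<in> vecs"
  by (rule vecsI, rule linear_functional_closed[OF embed_lin])

lemma correction_closed: "v \<in> vecs \<Longrightarrow> correction x v j \<in> carrier R"
  by (rule linear_functional_closed[OF correction_lin])

text \<open>The correction in column \<open>j\<close> consults only columns whose last entry is
  smaller than \<open>f j\<close>. Hence \<open>reduce x\<close> is unitriangular with respect to
  \<open>f\<close>, which is behind every recursion along \<open>f\<close> below.\<close>

lemma correction_cong: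
  assumes j: "strip j" and eq: "\<And>l. l < m \<Longrightarrow> f l < f j \<Longrightarrow> v l = w l"
  shows "correction x v j = correction x w j"
proof -
  have 1: "v (P j) = w (P j)" if "1 < e j"
    using P[OF j that] P_less[OF j that] stripD(1) by (intro eq) auto
  have 2: "v (P A) = w (P A)" if "1 < e A" "j = B"
    using P[OF strip_A that(1)] P_less[OF strip_A that(1)] f_A_less that(2) stripD(1)
    by (intro eq) auto
  have 3: "v A = w A" if "1 < e j" "P j = B"
    using P_less[OF j that(1)] f_A_less that(2) stripD(1)[OF strip_A] by (intro eq) auto
  show ?thesis unfolding correction_def by (simp add: 1 2 3 cong: if_cong)
qed

text \<open>A unitriangular system is solved in order of increasing \<open>f\<close>; columns with
  equal \<open>f\<close> do not influence each other.\<close>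

lemma reduce_onto:
  assumes w: "w \<in> vecs"
  shows "\<exists>v\<in>vecs. \<forall>l<m. reduce x v l = w l"
proof -
  have "\<exists>v\<in>vecs. \<forall>l<m. f l < y \<longrightarrow> reduce x v l = w l" for y
  proof (induction y)
    case (Suc y)
    then obtain v where v: "v \<in> vecs" "\<And>l. l < m \<Longrightarrow> f l < y \<Longrightarrow> reduce x v l = w l" by blast
    define v' where "v' l = (if f l = y then w l \<oplus> (if strip l then correction x v l else \<zero>)
        else v l)" for l
    have v': "v' \<in> vecs" using v w correction_closed[OF v(1)] by (intro vecsI) (simp add: v'_def)
    have "reduce x v' l = w l" if l: "l < m" "f l < Suc y" for l
    proof -
      have "correction x v' l = correction x v l" if "strip l"
        using that l by (intro correction_cong) (auto simp: v'_def)
      then have eq: "reduce x v' l = v' l \<ominus> (if strip l then correction x v l else \<zero>)"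
        by (simp add: reduce_def)
      show ?thesis
      proof (cases "f l = y")
        case True
        then show ?thesis unfolding eq using w correction_closed[OF v(1), of x l]
          by (simp add: v'_def a_minus_def a_assoc r_neg)
      next
        case False
        then show ?thesis unfolding eq using v(2)[of l] l by (simp add: v'_def reduce_def)
      qed
    qed
    then show ?case using v' by blast
  qed (use w in blast)
  from this[of "Suc (Max (f ` {..<m}))"] obtain v where
    v: "v \<in> vecs" "\<forall>l<m. f l < Suc (Max (f ` {..<m})) \<longrightarrow> reduce x v l = w l" by blast
  have "f l < Suc (Max (f ` {..<m}))" if "l < m" for l
    using that by (simp add: less_Suc_eq_le)
  then show ?thesis using v by blast
qed

text \<open>Under their conditions on \<open>x\<close> the three terms have exactly the exponent
  \<open>level x j\<close>. Column \<open>P j\<close> gives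
  \<open>h j + f (P j) = h j + e j - 1\<close>; column \<open>P A\<close> gives
  \<open>h B + d + e A - 1 = h B + e B - 1\<close>; column \<open>A\<close> gives
  \<open>h j + d + f A = h j + f B = h j + e j - 1\<close>. The subtractions are genuine by the link
  condition, by \<open>hPA\<close> and by \<open>hA\<close>, respectively.\<close>

lemma correction_pdvd:
  assumes j: "strip j" and v: "v \<in> vecs"
    and small: "\<And>l. strip l \<Longrightarrow> f l < f j \<Longrightarrow> pdvd (h l + f l) (v l)"
  shows "pdvd (level x j) (correction x v j)"
proof -
  have fj: "e j - 1 \<le> f j" using stripD[OF j] by simp
  have 1: "pdvd (level x j) (p [^] (h j - h (P j)) \<otimes> v (P j))" if "1 < e j" "x < e j - 1"
  proof (rule pdvd_power_mult)
    show "pdvd (h (P j) + f (P j)) (v (P j))"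
      using P[OF j that(1)] P_less[OF j that(1)] by (intro small) auto
    show "level x j \<le> h j - h (P j) + (h (P j) + f (P j))"
      using P[OF j that(1)] that fj by (simp add: level_def)
  qed
  have 2: "pdvd (level x j) (\<nu> \<otimes> (p [^] (h B + d - h (P A)) \<otimes> v (P A)))"
    if "j = B" "1 < e A" "x < e A - 1"
  proof (rule pdvd_mult[OF pdvd_power_mult])
    show "pdvd (h (P A) + f (P A)) (v (P A))"
      using P[OF strip_A that(2)] P_less[OF strip_A that(2)] f_A_less that by (intro small) auto
    show "level x j \<le> h B + d - h (P A) + (h (P A) + f (P A))"
      using P[OF strip_A that(2)] hPA[OF that(2)] that eAB by (simp add: level_def d_def)
  qed simp
  have 3: "pdvd (level x j) (\<nu> \<otimes> (p [^] (h j + d - h A) \<otimes> v A))"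
    if "1 < e j" "P j = B" "x < f A"
  proof (rule pdvd_mult[OF pdvd_power_mult])
    show "pdvd (h A + f A) (v A)"
      using P_less[OF j that(1)] f_A_less that strip_A by (intro small) auto
    show "level x j \<le> h j + d - h A + (h A + f A)"
      using P[OF j that(1)] hA[OF j that(1,2)] that fAB f_A_less
      by (auto simp: level_def max_def)
  qed simp
  show ?thesis unfolding correction_def
    by (intro pdvd_add pdvd_minus) (use 1 2 3 in auto)
qed

lemma reduce_pdvd:
  assumes v: "v \<in> vecs" and small: "\<And>l. l < m \<Longrightarrow> pdvd (h l + f l) (v l)" and j: "j < m"
  shows "pdvd (level x j) (reduce x v j)"
proof -
  have "pdvd (level x j) (v j)" using small[OF j] level_le by (rule pdvd_antimono)
  then show ?thesis unfolding reduce_def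
    using correction_pdvd[OF _ v] small stripD(1) by (intro pdvd_minus) auto
qed

text \<open>The first term of the correction cancels the regular entry of column \<open>j\<close>
  against that of its predecessor. The second cancels the additional entry of column
  \<open>B\<close> against column \<open>P A\<close>, which belongs to the same generator. If
  \<open>B\<close> precedes \<open>j\<close>, the first term also carries the additional entry over
  to \<open>j\<close>; the third removes this copy with the help of column \<open>A\<close>. Where a
  condition on \<open>x\<close> fails, what remains is already divisible by
  \<open>p^(level x j)\<close>.\<close>

lemma reduce_embed:
  assumes r: "r \<in> vecs" and j: "j < m"
  shows "pdvd (level x j) (reduce x (\<lambda>l. p [^] x \<otimes> embed r l) j)"
proof (cases "strip j")
  case False
  then have "embed r j = \<zero>" using strip_B by (auto simp: embed_def)
  then show ?thesis using False by (simp add: reduce_def a_minus_def)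
next
  case True
  note stripD[OF True, simp]
  \<comment> \<open>In \<open>p^x\<close> times the image of \<open>r\<close>, \<open>s l\<close> is
    the regular entry of column \<open>l\<close> and \<open>T (h B)\<close> the additional entry of
    column \<open>B\<close>; \<open>T (h j)\<close> is the latter carried over to a successor
    \<open>j\<close> of \<open>B\<close>.\<close>
  define s where "s l = p [^] (h l + x) \<otimes> r (\<rho> l)" for l
  define T where "T k = \<nu> \<otimes> (p [^] (k + d + x) \<otimes> r (\<rho> A))" for k
  have [simp]: "s l \<in> carrier R" "T k \<in> carrier R" for l k using r by (auto simp: s_def T_def)
  let ?u = "\<lambda>l. p [^] x \<otimes> embed r l"
  have u: "?u l = s l \<oplus> (if l = B then T (h B) else \<zero>)" if "strip l" for l
  proof -
    have "p [^] x \<otimes> (\<nu> \<otimes> (p [^] (h B + d) \<otimes> r (\<rho> A))) = \<nu> \<otimes> (p [^] (x + (h B + d)) \<otimes> r (\<rho> A))"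
      using r by (simp add: m_lcomm m_assoc flip: nat_pow_mult)
    moreover have "p [^] x \<otimes> (p [^] h l \<otimes> r (\<rho> l)) = p [^] (x + h l) \<otimes> r (\<rho> l)"
      using r by (simp add: m_assoc flip: nat_pow_mult)
    ultimately show ?thesis using that r
      by (simp add: embed_def s_def T_def r_distr add.commute add.left_commute)
  qed
  have pow: "p [^] a \<otimes> (p [^] b \<otimes> c) = p [^] (a + b) \<otimes> c" if "c \<in> carrier R" for a b :: nat and c
    using that by (simp add: m_assoc flip: nat_pow_mult)
  let ?c = "1 < e j \<and> x < e j - 1"
  have a: "(if ?c then p [^] (h j - h (P j)) \<otimes> ?u (P j) else \<zero>) =
      (if ?c then s j else \<zero>) \<oplus> (if ?c \<and> P j = B then T (h j) else \<zero>)"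
  proof (cases ?c)
    case True
    note Pj = P[OF \<open>strip j\<close> conjunct1[OF True]]
    have "p [^] (h j - h (P j)) \<otimes> s (P j) = s j"
      using Pj r by (simp add: s_def pow)
    moreover have "p [^] (h j - h B) \<otimes> T (h B) = T (h j)" if "P j = B"
    proof -
      have "p [^] (h j - h B) \<otimes> T (h B) = \<nu> \<otimes> (p [^] (h j - h B) \<otimes> (p [^] (h B + d + x) \<otimes> r (\<rho> A)))"
        unfolding T_def using r by (intro m_lcomm) auto
      also have "\<dots> = T (h j)" using Pj that r by (simp add: T_def pow add.assoc)
      finally show ?thesis .
    qed
    ultimately show ?thesis using True Pj u[of "P j"] by (auto simp: r_distr)
  qed auto
  have b: "\<nu> \<otimes> (p [^] (h B + d - h (P A)) \<otimes> ?u (P A)) = T (h B)" if "1 < e A"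
  proof -
    note PA = P[OF strip_A that]
    have "P A \<noteq> B" using P_less[OF strip_A that] f_A_less by auto
    then have "?u (P A) = s (P A)" using u[of "P A"] PA by simp
    then show ?thesis using PA hPA[OF that] r by (simp add: s_def T_def pow add.assoc)
  qed
  have c: "\<nu> \<otimes> (p [^] (h j + d - h A) \<otimes> ?u A) = T (h j)" if "1 < e j" "P j = B"
  proof -
    have "?u A = s A" using u[OF strip_A] not_AB by simp
    then show ?thesis using hA[OF \<open>strip j\<close> that] r by (simp add: s_def T_def pow add.assoc)
  qed
  let ?b = "j = B \<and> 1 < e A \<and> x < e A - 1" and ?d = "1 < e j \<and> P j = B \<and> x < f A"
  have corr: "correction x ?u j = (if ?c then s j else \<zero>) \<oplus> (if ?c \<and> P j = B then T (h j) else \<zero>) \<oplus>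
      (if ?b then T (h B) else \<zero>) \<ominus> (if ?d then T (h j) else \<zero>)"
    unfolding correction_def a using b c by simp
  have pT: "pdvd k (T l)" if "k \<le> l + d + x" for k l
    unfolding T_def by (rule pdvd_mult[OF pdvd_power_mult[of 0]]) (use that r in auto)
  have 1: "pdvd (level x j) (s j \<ominus> (if ?c then s j else \<zero>))"
  proof (cases ?c)
    case False
    have "pdvd (level x j) (s j)" unfolding s_def
    proof (rule pdvd_power_mult[of 0])
      show "level x j \<le> h j + x + 0" using False \<open>1 \<le> e j\<close> by (auto simp: level_def)
    qed (use r in simp)
    then show ?thesis using False by (auto simp: a_minus_def)
  qed (auto simp: a_minus_def r_neg)
  \<comment> \<open>If the additional entry is not corrected then \<open>e A - 1 \<le> x\<close>, so
    \<open>d + x\<close> is at least both \<open>e B - 1\<close> and \<open>x\<close>, and the entry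
    vanishes modulo \<open>p^(level x B)\<close>.\<close>
  have 2: "pdvd (level x j) ((if j = B then T (h B) else \<zero>) \<ominus> (if ?b then T (h B) else \<zero>))"
  proof (cases "j = B \<and> \<not> ?b")
    case True
    have "pdvd (level x j) (T (h B))"
    proof (rule pT)
      show "level x j \<le> h B + d + x"
        using True eAB stripD(3)[OF strip_A] by (auto simp: level_def d_def)
    qed
    then show ?thesis using True by (auto simp: a_minus_def)
  qed (auto simp: a_minus_def r_neg)
  have 3: "pdvd (level x j) ((if ?c \<and> P j = B then T (h j) else \<zero>) \<ominus> (if ?d then T (h j) else \<zero>))"
  proof (cases "1 < e j \<and> P j = B")
    case True
    then have fY: "f B = e j - 1" using P[OF \<open>strip j\<close>] by auto
    show ?thesis
    \<comment> \<open>For \<open>x < f A\<close> also \<open>x < f B = e j - 1\<close>, so both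
      copies occur and cancel. For \<open>x \<ge> f A\<close> a remaining copy has exponent
      \<open>h j + d + x\<close>, which is at least
      \<open>h j + f B = h j + e j - 1\<close>.\<close>
    proof (cases "x < f A")
      case True
      then show ?thesis using f_A_less fY \<open>1 < e j \<and> P j = B\<close> by (simp add: a_minus_def r_neg)
    next
      case False
      show ?thesis
      proof (cases ?c)
        case True
        have "pdvd (level x j) (T (h j))"
        proof (rule pT)
          show "level x j \<le> h j + d + x" using True False fY fAB by (auto simp: level_def)
        qed
        then show ?thesis using False by (auto simp: a_minus_def)
      qed (use False in \<open>auto simp: a_minus_def\<close>)
    qed
  qed (auto simp: a_minus_def)
  have rearrange: "(s' \<oplus> t) \<ominus> (a \<oplus> b \<oplus> c \<ominus> d') = (s' \<ominus> a) \<oplus> (t \<ominus> c) \<ominus> (b \<ominus> d')"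
    if "s' \<in> carrier R" "t \<in> carrier R" "a \<in> carrier R" "b \<in> carrier R" "c \<in> carrier R" "d' \<in> carrier R"
    for s' t a b c d'
    using that by (simp add: a_minus_def minus_add a_ac)
  have "reduce x ?u j = (s j \<ominus> (if ?c then s j else \<zero>)) \<oplus>
      ((if j = B then T (h B) else \<zero>) \<ominus> (if ?b then T (h B) else \<zero>)) \<ominus>
      ((if ?c \<and> P j = B then T (h j) else \<zero>) \<ominus> (if ?d then T (h j) else \<zero>))"
    unfolding reduce_def corr if_P[OF True] u[OF True] by (rule rearrange) auto
  then show ?thesis using pdvd_minus[OF pdvd_add[OF 1 2] 3] by simp
qed

text \<open>One step of an elimination: each chain has at most one strip ending at \<open>y\<close>,
  and its column determines the coefficient of the corresponding generator. The assumption
  \<open>top\<close> provides enough divisibility for this coefficient to do no harm in the columns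
  treated before.\<close>

lemma embed_correct:
  assumes v: "v \<in> vecs"
    and small: "\<And>l. strip l \<Longrightarrow> f l < y \<Longrightarrow> pdvd (h l + f l) (v l)"
    and top: "\<And>l. strip l \<Longrightarrow> f l = y \<Longrightarrow> pdvd (level x l) (v l)"
  shows "\<exists>s\<in>vecs. \<forall>l. strip l \<and> f l \<le> y \<longrightarrow> pdvd (h l + f l) (v l \<ominus> p [^] x \<otimes> embed s l)"
proof -
  let ?J = "\<lambda>i j. strip j \<and> f j = y \<and> x < y \<and> \<rho> j = i"
  have "\<exists>q. q \<in> carrier R \<and> (\<forall>j. ?J i j \<longrightarrow> v j = p [^] (h j + x) \<otimes> q \<and> pdvd (e j - 1 - x) q) \<and>
      ((\<nexists>j. ?J i j) \<longrightarrow> q = \<zero>)" for i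
  proof (cases "\<exists>j. ?J i j")
    case True
    then obtain j where j: "?J i j" by blast
    have uniq: "j' = j" if "?J i j'" for j'
      using chain_disjoint[of j j'] j that stripD(2)[of j] stripD(2)[of j'] by fastforce
    \<comment> \<open>Truncated subtraction covers both cases: the last summand is 0 once
      \<open>x\<close> has reached \<open>e j - 1\<close>.\<close>
    have "level x j = h j + x + (e j - 1 - x)"
      using j stripD[of j] by (auto simp: level_def)
    with top j obtain q where q: "q \<in> carrier R" "v j = p [^] (h j + x + (e j - 1 - x)) \<otimes> q"
      by (metis pdvdE)
    have "v j = p [^] (h j + x) \<otimes> (p [^] (e j - 1 - x) \<otimes> q)"
      using q by (simp add: m_assoc flip: nat_pow_mult)
    then show ?thesis using q(1) uniq j
      by (intro exI[of _ "p [^] (e j - 1 - x) \<otimes> q"]) auto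
  next
    case False
    then show ?thesis by (intro exI[of _ \<zero>]) auto
  qed
  then obtain s where s: "\<And>i. s i \<in> carrier R"
    "\<And>i j. ?J i j \<Longrightarrow> v j = p [^] (h j + x) \<otimes> s i \<and> pdvd (e j - 1 - x) (s i)"
    "\<And>i. (\<nexists>j. ?J i j) \<Longrightarrow> s i = \<zero>"
    by metis
  have sv: "s \<in> vecs" using s(1) by (rule vecsI)
  \<comment> \<open>Earlier strips of the chain end at \<open>e j - 1\<close> or before, so the
    factor \<open>p^(e j - 1 - x)\<close> of the coefficient raises the exponent
    \<open>k + x\<close> to at least \<open>k + f l\<close>.\<close>
  have lower: "pdvd (k + f l) (p [^] (k + x) \<otimes> s (\<rho> l))" if l: "strip l" "f l < y" for k l
  proof (cases "\<exists>j. ?J (\<rho> l) j")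
    case True
    then obtain j where j: "?J (\<rho> l) j" by blast
    have "f l < e j" using chain_disjoint[of l j] j l stripD(2)[of l] by fastforce
    then show ?thesis using s(2)[OF j] by (intro pdvd_power_mult[of "e j - 1 - x"]) auto
  qed (simp add: s(3))
  \<comment> \<open>Column \<open>B\<close> has height \<open>h B + d + f A\<close>, so the
    additional entry vanishes by \<open>lower\<close> for the strip \<open>A\<close>, which ends
    before \<open>f B\<close>.\<close>
  have extra: "pdvd (h B + f B) (p [^] x \<otimes> (\<nu> \<otimes> (p [^] (h B + d) \<otimes> s (\<rho> A))))" if "f B \<le> y"
  proof -
    have "p [^] x \<otimes> (\<nu> \<otimes> (p [^] (h B + d) \<otimes> s (\<rho> A))) = \<nu> \<otimes> (p [^] (h B + d + x) \<otimes> s (\<rho> A))"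
      using s(1) by (simp add: m_ac flip: nat_pow_mult)
    moreover have "h B + f B = h B + d + f A" using fAB by simp
    moreover have "pdvd (h B + d + f A) (p [^] (h B + d + x) \<otimes> s (\<rho> A))"
      using f_A_less that by (intro lower[OF strip_A]) simp
    ultimately show ?thesis by (simp only: pdvd_mult closed_simps)
  qed
  have "pdvd (h l + f l) (v l \<ominus> p [^] x \<otimes> embed s l)" if l: "strip l" "f l \<le> y" for l
  proof -
    have "p [^] x \<otimes> embed s l = p [^] (h l + x) \<otimes> s (\<rho> l) \<oplus>
        (if l = B then p [^] x \<otimes> (\<nu> \<otimes> (p [^] (h B + d) \<otimes> s (\<rho> A))) else \<zero>)"
      using l s(1) by (simp add: embed_def r_distr m_ac flip: nat_pow_mult)
    moreover have "v l \<ominus> (p [^] (h l + x) \<otimes> s (\<rho> l) \<oplus> t) = (v l \<ominus> p [^] (h l + x) \<otimes> s (\<rho> l)) \<ominus> t"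
      if "t \<in> carrier R" for t
      using that v s(1) by (simp add: a_minus_def minus_add a_ac)
    moreover have "pdvd (h l + f l) (v l \<ominus> p [^] (h l + x) \<otimes> s (\<rho> l))"
    proof (cases "f l < y")
      case True
      then show ?thesis using small lower l by (intro pdvd_minus) auto
    next
      case False
      then have fl: "f l = y" using l by simp
      show ?thesis
      proof (cases "x < y")
        case True
        then have "v l = p [^] (h l + x) \<otimes> s (\<rho> l)" using s(2)[of l "\<rho> l"] l fl by auto
        then show ?thesis using s(1) by (simp add: a_minus_def r_neg)
      next
        case False
        then have "level x l = h l + f l" using fl by (simp add: level_def)
        moreover have "s (\<rho> l) = \<zero>" using False by (intro s(3)) auto
        ultimately show ?thesis using top[OF l(1) fl] v by (simp add: a_minus_def)
      qed
    qed
    moreover have "pdvd (h l + f l) (if l = B then p [^] x \<otimes> (\<nu> \<otimes> (p [^] (h B + d) \<otimes> s (\<rho> A))) else \<zero>)"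
      using extra l by auto
    ultimately show ?thesis using s(1) by (simp add: pdvd_minus)
  qed
  then show ?thesis using sv by blast
qed

text \<open>From left to right by linearity, since \<open>reduce x\<close> respects vectors
  representing 0 and sends \<open>p^x\<close> times the submodule to 0 modulo the levels. From right
  to left by elimination along \<open>f\<close>: once the columns with smaller last entry represent
  0, the correction is negligible, and the condition on \<open>reduce x\<close> becomes a condition
  on the coordinate itself.\<close>

lemma reduce_kernel:
  assumes v: "v \<in> vecs"
  shows "(\<exists>r\<in>vecs. \<forall>l<m. pdvd (h l + f l) (v l \<ominus> p [^] x \<otimes> embed r l)) \<longleftrightarrow>
    (\<forall>l<m. pdvd (level x l) (reduce x v l))"
proof
  assume "\<exists>r\<in>vecs. \<forall>l<m. pdvd (h l + f l) (v l \<ominus> p [^] x \<otimes> embed r l)"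
  then obtain r where r: "r \<in> vecs" "\<And>l. l < m \<Longrightarrow> pdvd (h l + f l) (v l \<ominus> p [^] x \<otimes> embed r l)"
    by blast
  let ?u = "\<lambda>l. p [^] x \<otimes> embed r l"
  have u: "?u \<in> vecs" using embed_vecs[OF r(1)] by (intro vecsI) simp
  have w: "(\<lambda>l. v l \<ominus> ?u l) \<in> vecs" using v u by (rule vecs_minus)
  show "\<forall>l<m. pdvd (level x l) (reduce x v l)"
  proof (intro allI impI)
    fix l assume l: "l < m"
    have "reduce x (\<lambda>l. v l \<ominus> ?u l) l = reduce x v l \<ominus> reduce x ?u l"
      by (rule linear_functional_minus[OF reduce_lin v u])
    then have "reduce x v l = reduce x (\<lambda>l. v l \<ominus> ?u l) l \<oplus> reduce x ?u l"
      using linear_functional_closed[OF reduce_lin v] linear_functional_closed[OF reduce_lin u]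
      by (simp add: a_minus_def a_assoc l_neg)
    moreover have "pdvd (level x l) (reduce x (\<lambda>l. v l \<ominus> ?u l) l)"
      by (rule reduce_pdvd[OF w r(2) l])
    ultimately show "pdvd (level x l) (reduce x v l)"
      using pdvd_add reduce_embed[OF r(1) l] by simp
  qed
next
  assume red: "\<forall>l<m. pdvd (level x l) (reduce x v l)"
  have "\<exists>r\<in>vecs. \<forall>l. strip l \<and> f l < y \<longrightarrow> pdvd (h l + f l) (v l \<ominus> p [^] x \<otimes> embed r l)" for y
  proof (induction y)
    case 0
    have "(\<lambda>_. \<zero>) \<in> vecs" by (rule vecsI) simp
    then show ?case by auto
  next
    case (Suc y)
    then obtain r where r: "r \<in> vecs"
      "\<And>l. strip l \<Longrightarrow> f l < y \<Longrightarrow> pdvd (h l + f l) (v l \<ominus> p [^] x \<otimes> embed r l)" by blast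
    let ?u = "\<lambda>l. p [^] x \<otimes> embed r l"
    let ?w = "\<lambda>l. v l \<ominus> ?u l"
    have u: "?u \<in> vecs" using embed_vecs[OF r(1)] by (intro vecsI) simp
    have w: "?w \<in> vecs" using v u by (rule vecs_minus)
    have "pdvd (level x l) (?w l)" if l: "strip l" "f l = y" for l
    proof -
      have "pdvd (level x l) (reduce x v l \<ominus> reduce x ?u l)"
        using red reduce_embed[OF r(1)] stripD(1)[OF l(1)] by (intro pdvd_minus) auto
      then have "pdvd (level x l) (reduce x ?w l)"
        unfolding linear_functional_minus[OF reduce_lin v u] .
      moreover have "pdvd (level x l) (correction x ?w l)"
        by (rule correction_pdvd[OF l(1) w]) (use r(2) l in auto)
      ultimately have "pdvd (level x l) (reduce x ?w l \<oplus> correction x ?w l)" by (rule pdvd_add)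
      moreover have "reduce x ?w l = ?w l \<ominus> correction x ?w l" using l(1) by (simp add: reduce_def)
      moreover have "(a \<ominus> b) \<oplus> b = a" if "a \<in> carrier R" "b \<in> carrier R" for a b
        using that by (simp add: a_minus_def a_assoc l_neg)
      ultimately show ?thesis using correction_closed[OF w] vecsD[OF w, of l] by simp
    qed
    then obtain s where s: "s \<in> vecs"
      "\<And>l. strip l \<Longrightarrow> f l \<le> y \<Longrightarrow> pdvd (h l + f l) (?w l \<ominus> p [^] x \<otimes> embed s l)"
      using embed_correct[OF w, of y x] r(2) by blast
    have rs: "(\<lambda>i. r i \<oplus> s i) \<in> vecs" using r s by (intro vecsI) simp
    have "v l \<ominus> p [^] x \<otimes> embed (\<lambda>i. r i \<oplus> s i) l = ?w l \<ominus> p [^] x \<otimes> embed s l" for l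
      using linear_functional_add[OF embed_lin r(1) s(1), of l] v
        vecsD[OF embed_vecs[OF r(1)], of l] vecsD[OF embed_vecs[OF s(1)], of l]
      by (simp add: r_distr a_minus_def minus_add a_ac)
    then show ?case using s(2) by (intro bexI[OF _ rs]) (simp add: less_Suc_eq_le)
  qed
  from this[of "Suc (Max (f ` {..<m}))"] obtain r where r: "r \<in> vecs"
    "\<And>l. strip l \<Longrightarrow> f l < Suc (Max (f ` {..<m})) \<Longrightarrow> pdvd (h l + f l) (v l \<ominus> p [^] x \<otimes> embed r l)"
    by blast
  have "pdvd (h l + f l) (v l \<ominus> p [^] x \<otimes> embed r l)" if l: "l < m" for l
  proof (cases "strip l")
    case True
    have "f l < Suc (Max (f ` {..<m}))" using l by (simp add: less_Suc_eq_le)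
    then show ?thesis using r(2)[OF True] by simp
  next
    case False
    then have "embed r l = \<zero>" "reduce x v l = v l" "level x l = h l + f l"
      using strip_B no_strip[OF l] v by (auto simp: embed_def reduce_def level_def a_minus_def)
    then show ?thesis using red l v by (auto simp: a_minus_def)
  qed
  then show "\<exists>r\<in>vecs. \<forall>l<m. pdvd (h l + f l) (v l \<ominus> p [^] x \<otimes> embed r l)" using r(1) by blast
qed

text \<open>In column \<open>l\<close> the regular entry of its generator has order
  \<open>f l\<close>, at most the corresponding part of \<open>\<alpha>\<close>. The additional
  entry fits because \<open>h B + f B = h B + d + f A\<close>.\<close>

lemma embed_pdvd:
  assumes v: "v \<in> vecs" and small: "\<And>i. i < size \<alpha> \<Longrightarrow> pdvd (parts \<alpha> ! i) (v i)" and l: "l < m"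
  shows "pdvd (h l + f l) (embed v l)"
proof -
  have \<rho>: "pdvd (k + f l) (p [^] k \<otimes> v (\<rho> l))" if "strip l" for k l
    using chain_le[OF that] small by (intro pdvd_power_mult[of "parts \<alpha> ! \<rho> l"]) auto
  have "pdvd (h B + f B) (p [^] (h B + d) \<otimes> v (\<rho> A))"
    using \<rho>[OF strip_A, of "h B + d"] fAB by (simp add: ac_simps)
  then show ?thesis unfolding embed_def
    by (intro pdvd_add) (use \<rho> in \<open>auto intro: pdvd_mult\<close>)
qed

text \<open>The last strip of chain \<open>i\<close> ends at \<open>parts \<alpha> ! i\<close>, so
  its column alone detects the full order of the generator. If this column is \<open>B\<close>, the
  additional entry is subtracted; column \<open>A\<close> shows that it vanishes there.\<close>

lemma embed_reflects:
  assumes v: "v \<in> vecs" and small: "\<And>l. l < m \<Longrightarrow> pdvd (h l + f l) (embed v l)"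
    and i: "i < size \<alpha>"
  shows "pdvd (parts \<alpha> ! i) (v i)"
proof -
  have other: "pdvd (f l) (v (\<rho> l))" if l: "strip l" "l \<noteq> B" for l
    using small[OF stripD(1)[OF l(1)]] l v by (simp add: embed_def pdvd_power_mult_iff)
  have "pdvd (f l) (v (\<rho> l))" if l: "strip l" for l
  proof (cases "l = B")
    case True
    let ?t = "\<nu> \<otimes> (p [^] (h B + d) \<otimes> v (\<rho> A))"
    have "pdvd (h B + f B) ?t"
      by (rule pdvd_mult[OF pdvd_power_mult[OF other[OF strip_A not_AB]]]) (use fAB in auto)
    then have "pdvd (h B + f B) (embed v B \<ominus> ?t)"
      using small stripD(1)[OF strip_B] by (intro pdvd_minus) auto
    moreover have "embed v B \<ominus> ?t = p [^] h B \<otimes> v (\<rho> B)"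
      using strip_B v by (simp add: embed_def a_minus_def a_assoc r_neg)
    ultimately show ?thesis using True v by (simp add: pdvd_power_mult_iff)
  qed (use other l in simp)
  then show ?thesis using chain_end[OF i] by metis
qed

section \<open>Transport of the embedding along an automorphism of
  \<open>N\<^sub>\<beta>\<close>\<close>

context
  fixes \<beta> :: "nat multiset" and T T' :: "(nat \<Rightarrow> 'a) \<Rightarrow> nat \<Rightarrow> 'a"
  assumes size_\<beta>: "size \<beta> = m" and parts_\<beta>: "\<And>l. l < m \<Longrightarrow> parts \<beta> ! l = h l + f l"
    and T: "compatible \<beta> \<beta> T" and T': "compatible \<beta> \<beta> T'"
    and TT': "\<And>v. v \<in> vecs \<Longrightarrow> T (T' v) = v" and T'T: "\<And>v. v \<in> vecs \<Longrightarrow> T' (T v) = v"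
begin

lemma compatible_embed: "compatible \<alpha> \<beta> embed"
  unfolding compatible_def using embed_lin embed_pdvd size_\<beta> parts_\<beta> by simp

lemma compatible_twisted: "compatible \<alpha> \<beta> (\<lambda>r. T (embed r))"
  by (rule compatible_comp[OF compatible_embed T])

lemma twisted_inj: "inj_on (induced \<alpha> \<beta> (\<lambda>r. T (embed r))) (carrier (N_module R p \<alpha>))"
proof (rule induced_inj[OF compatible_twisted])
  fix v i assume v: "v \<in> vecs" and i: "i < size \<alpha>"
    and "\<And>j. j < size \<beta> \<Longrightarrow> pdvd (parts \<beta> ! j) (T (embed v) j)"
  then have "\<forall>j<size \<beta>. pdvd (parts \<beta> ! j) (T' (T (embed v)) j)"
    using T' compatible_vecs[OF compatible_twisted v] by (simp add: compatible_def)
  then have "\<And>l. l < m \<Longrightarrow> pdvd (h l + f l) (embed v l)"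
    using T'T[OF embed_vecs[OF v]] size_\<beta> parts_\<beta> by simp
  then show "pdvd (parts \<alpha> ! i) (v i)" by (rule embed_reflects[OF v _ i])
qed

text \<open>An automorphism does not change quotients up to isomorphism: composing the coordinates
  \<open>reduce x\<close> with the inverse \<open>T'\<close> adapts them to the moved
  submodule.\<close>

lemma twisted_tableau:
  assumes \<Gamma>: "\<And>x. \<Gamma> x = {#b \<in># image_mset (level x) (mset_set {..<m}). b \<noteq> 0#}"
  shows "has_tableau R p (N_module R p \<beta>)
    (induced \<alpha> \<beta> (\<lambda>r. T (embed r)) ` carrier (N_module R p \<alpha>)) \<Gamma>"
proof (rule has_tableau_induced[OF compatible_twisted, where \<theta> = "\<lambda>x v. reduce x (T' v)" and \<delta> = level])
  show "linear_functional (\<lambda>v. reduce x (T' v) j)" for x j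
    by (rule linear_functional_comp[where g = "\<lambda>v. reduce x v j"])
      (use reduce_lin T' in \<open>simp_all add: compatible_def\<close>)
  show "\<exists>v\<in>vecs. \<forall>l<size \<beta>. reduce x (T' v) l = w l" if w: "w \<in> vecs" for x w
  proof -
    obtain v where v: "v \<in> vecs" "\<forall>l<m. reduce x v l = w l" using reduce_onto[OF w] by blast
    then show ?thesis
      using T'T[OF v(1)] compatible_vecs[OF T v(1)] size_\<beta> by (intro bexI[of _ "T v"]) simp_all
  qed
  show "(\<exists>r\<in>vecs. \<forall>l<size \<beta>. pdvd (parts \<beta> ! l) (v l \<ominus> p [^] x \<otimes> T (embed r) l)) \<longleftrightarrow>
      (\<forall>l<size \<beta>. pdvd (level x l) (reduce x (T' v) l))" if v: "v \<in> vecs" for x v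
  proof -
    have "(\<forall>l<size \<beta>. pdvd (parts \<beta> ! l) (v l \<ominus> p [^] x \<otimes> T (embed r) l)) \<longleftrightarrow>
        (\<forall>l<size \<beta>. pdvd (parts \<beta> ! l) (T' v l \<ominus> p [^] x \<otimes> embed r l))" if r: "r \<in> vecs" for r
    proof -
      let ?u = "\<lambda>l. p [^] x \<otimes> embed r l"
      have u: "?u \<in> vecs" using embed_vecs[OF r] by (intro vecsI) simp
      have Tu: "T ?u = (\<lambda>l. p [^] x \<otimes> T (embed r) l)"
        by (rule compatible_smult[OF T _ embed_vecs[OF r]]) simp
      have Tuv: "T ?u \<in> vecs" by (rule compatible_vecs[OF T u])
      have T'v: "T' v \<in> vecs" by (rule compatible_vecs[OF T' v])
      have 1: "(\<lambda>l. T' v l \<ominus> ?u l) = T' (\<lambda>l. v l \<ominus> T ?u l)"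
        using compatible_minus[OF T' v Tuv] T'T[OF u] by simp
      have 2: "(\<lambda>l. v l \<ominus> T ?u l) = T (\<lambda>l. T' v l \<ominus> ?u l)"
        using compatible_minus[OF T T'v u] TT'[OF v] by simp
      have "(\<forall>l<size \<beta>. pdvd (parts \<beta> ! l) (v l \<ominus> T ?u l)) \<longleftrightarrow>
          (\<forall>l<size \<beta>. pdvd (parts \<beta> ! l) (T' v l \<ominus> ?u l))"
      proof
        assume "\<forall>l<size \<beta>. pdvd (parts \<beta> ! l) (v l \<ominus> T ?u l)"
        then have "\<forall>l<size \<beta>. pdvd (parts \<beta> ! l) (T' (\<lambda>l. v l \<ominus> T ?u l) l)"
          using T' vecs_minus[OF v Tuv] by (simp add: compatible_def)
        then show "\<forall>l<size \<beta>. pdvd (parts \<beta> ! l) (T' v l \<ominus> ?u l)"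
          unfolding 1[symmetric] .
      next
        assume "\<forall>l<size \<beta>. pdvd (parts \<beta> ! l) (T' v l \<ominus> ?u l)"
        then have "\<forall>l<size \<beta>. pdvd (parts \<beta> ! l) (T (\<lambda>l. T' v l \<ominus> ?u l) l)"
          using T vecs_minus[OF T'v u] by (simp add: compatible_def)
        then show "\<forall>l<size \<beta>. pdvd (parts \<beta> ! l) (v l \<ominus> T ?u l)"
          unfolding 2[symmetric] .
      qed
      then show ?thesis unfolding Tu .
    qed
    then have "(\<exists>r\<in>vecs. \<forall>l<size \<beta>. pdvd (parts \<beta> ! l) (v l \<ominus> p [^] x \<otimes> T (embed r) l)) \<longleftrightarrow>
        (\<exists>r\<in>vecs. \<forall>l<size \<beta>. pdvd (parts \<beta> ! l) (T' v l \<ominus> p [^] x \<otimes> embed r l))"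
      by (rule bex_cong[OF refl])
    also have "\<dots> \<longleftrightarrow> (\<exists>r\<in>vecs. \<forall>l<m. pdvd (h l + f l) (T' v l \<ominus> p [^] x \<otimes> embed r l))"
      using size_\<beta> parts_\<beta> by simp
    also have "\<dots> \<longleftrightarrow> (\<forall>l<m. pdvd (level x l) (reduce x (T' v) l))"
      by (rule reduce_kernel[OF compatible_vecs[OF T' v]])
    finally show ?thesis by (simp only: size_\<beta>)
  qed
  show "\<Gamma> x = {#b \<in># image_mset (level x) (mset_set {..<size \<beta>}). b \<noteq> 0#}" for x
    by (simp only: \<Gamma> size_\<beta>)
qed

end

end

section \<open>Assembly of the family and the change of basis\<close>

theorem theorem5p1:
  fixes K :: "('k, 'r) ring_scheme"
    and \<Lambda> :: "('k, 'a, 'm) module_scheme"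
    and p :: 'a
    and \<alpha> \<beta> \<gamma> :: "nat multiset"
    and \<Gamma> \<Gamma>' :: tableau
  assumes "algebraically_closed K"
    and "discrete_valuation_ring \<Lambda>"
    and "p \<in> carrier \<Lambda>" and "maximalideal (PIdl\<^bsub>\<Lambda>\<^esub> p) \<Lambda>"
    and "algebra K \<Lambda>"
    and "has_residue_field K \<Lambda> p"
    and "increasing_box_move \<alpha> \<beta> \<gamma> \<Gamma> \<Gamma>'"
  shows "\<exists>\<phi>. one_parameter_family K \<Lambda> p \<alpha> \<beta> \<phi> \<and>
    (\<forall>\<mu>\<in>carrier K. \<mu> \<noteq> \<zero>\<^bsub>K\<^esub> \<longrightarrow>
       has_tableau \<Lambda> p (N_module \<Lambda> p \<beta>) (\<phi> \<mu> ` carrier (N_module \<Lambda> p \<alpha>)) \<Gamma>) \<and>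
    has_tableau \<Lambda> p (N_module \<Lambda> p \<beta>) (\<phi> \<zero>\<^bsub>K\<^esub> ` carrier (N_module \<Lambda> p \<alpha>)) \<Gamma>'"
proof -
  interpret L: principal_domain \<Lambda> using assms(2) by (simp add: discrete_valuation_ring_def)
  interpret K: algebraically_closed K by fact
  interpret KL: algebra K \<Lambda> by fact
  have unif: "uniformizer \<Lambda> p"
  proof
    show "p \<in> carrier \<Lambda>" by fact
    show "p \<noteq> \<zero>\<^bsub>\<Lambda>\<^esub>"
    proof
      assume "p = \<zero>\<^bsub>\<Lambda>\<^esub>"
      moreover have "PIdl\<^bsub>\<Lambda>\<^esub> \<zero>\<^bsub>\<Lambda>\<^esub> = {\<zero>\<^bsub>\<Lambda>\<^esub>}"
        by (auto simp: cgenideal_def intro: exI[of _ "\<zero>\<^bsub>\<Lambda>\<^esub>"])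
      ultimately have "field \<Lambda>" using assms(4) L.zeromaximalideal_fieldI by simp
      then show False using assms(2) by (simp add: discrete_valuation_ring_def)
    qed
  qed
  then interpret uniformizer \<Lambda> p .
  obtain e f h P \<rho> A B where sys: "strip_system \<alpha> (size \<beta>) e f h P \<rho> A B"
    and hAB: "h B + (e B - e A) < h A" and parts: "\<And>l. l < size \<beta> \<Longrightarrow> parts \<beta> ! l = h l + f l"
    and \<Gamma>: "\<And>x. \<Gamma> x = {#b \<in># image_mset (\<lambda>l. h l + min (f l) (max x (e l - 1))) (mset_set {..<size \<beta>}). b \<noteq> 0#}"
    and \<Gamma>': "\<And>x. \<Gamma>' x = {#b \<in># image_mset (\<lambda>l. (h(A := h A - (e B - e A), B := h B + (e B - e A))) l +
      min ((f \<circ> transpose A B) l) (max x ((e \<circ> transpose A B) l - 1))) (mset_set {..<size \<beta>}). b \<noteq> 0#}"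
    using box_move_strip_system[OF assms(7)] unfolding Let_def by blast
  interpret S: strip_system \<alpha> "size \<beta>" e f h P \<rho> A B by (rule sys)
  define \<tau> where "\<tau> = transpose A B"
  define h' where "h' = h(A := h A - S.d, B := h B + S.d)"
  have hd: "h B + S.d < h A" using hAB by (simp add: S.d_def)
  have sys': "strip_system \<alpha> (size \<beta>) (e \<circ> \<tau>) (f \<circ> \<tau>) h' (\<tau> \<circ> P \<circ> \<tau>) (\<rho> \<circ> \<tau>) B A"
    unfolding \<tau>_def h'_def by (rule S.swap_strips) (use hd in simp)
  have \<tau>: "\<tau> A = B" "\<tau> B = A" "\<And>k. k \<noteq> A \<Longrightarrow> k \<noteq> B \<Longrightarrow> \<tau> k = k" by (simp_all add: \<tau>_def)
  \<comment> \<open>The member at 0 has no additional entry. The columns \<open>A\<close> and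
    \<open>B\<close> exchange roles because \<open>B\<close> now holds the strip with the smaller
    entries.\<close>
  interpret G': chain_system \<Lambda> p \<alpha> "size \<beta>" "e \<circ> \<tau>" "f \<circ> \<tau>" h' "\<tau> \<circ> P \<circ> \<tau>" "\<rho> \<circ> \<tau>" B A "\<zero>\<^bsub>\<Lambda>\<^esub>"
    by (intro chain_system.intro unif sys' chain_system_axioms.intro) simp
  have parts': "parts \<beta> ! l = h' l + (f \<circ> \<tau>) l" if "l < size \<beta>" for l
  proof -
    consider "l = A" | "l = B" | "l \<noteq> A" "l \<noteq> B" by blast
    then show ?thesis
      by cases (use parts[OF that] S.fAB hd S.not_AB \<tau> in \<open>simp_all add: h'_def\<close>)
  qed
  \<comment> \<open>The coefficient of \<open>\<mu>\<close>: the generator of the chain of strip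
    \<open>B\<close> keeps the entry that it has in column \<open>B\<close> under
    \<open>\<Gamma>\<close>.\<close>
  define F1 where "F1 r l = (if l = B then p [^]\<^bsub>\<Lambda>\<^esub> h B \<otimes>\<^bsub>\<Lambda>\<^esub> r (\<rho> B) else \<zero>\<^bsub>\<Lambda>\<^esub>)" for r and l :: nat
  have F0: "compatible \<alpha> \<beta> G'.embed"
    by (rule G'.compatible_embed[OF refl parts' compatible_id compatible_id]) simp_all
  have F1: "compatible \<alpha> \<beta> F1"
    unfolding compatible_def
  proof (intro conjI allI ballI impI)
    show "linear_functional (\<lambda>r. F1 r j)" for j
      unfolding F1_def by (intro linear_functional_intros) simp
    fix r j assume r: "r \<in> vecs" "\<forall>i<size \<alpha>. pdvd (parts \<alpha> ! i) (r i)" and j: "j < size \<beta>"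
    have "pdvd (h B + f B) (p [^]\<^bsub>\<Lambda>\<^esub> h B \<otimes>\<^bsub>\<Lambda>\<^esub> r (\<rho> B))"
      using S.chain_le[OF S.strip_B] r(2) by (intro pdvd_power_mult[of "parts \<alpha> ! \<rho> B"]) auto
    then show "pdvd (parts \<beta> ! j) (F1 r j)" using parts[OF j] by (simp add: F1_def)
  qed
  let ?\<iota> = "\<lambda>\<mu>. \<mu> \<odot>\<^bsub>\<Lambda>\<^esub> \<one>\<^bsub>\<Lambda>\<^esub>"
  define \<phi> where "\<phi> \<mu> = induced \<alpha> \<beta> (\<lambda>r l. G'.embed r l \<oplus>\<^bsub>\<Lambda>\<^esub> ?\<iota> \<mu> \<otimes>\<^bsub>\<Lambda>\<^esub> F1 r l)" for \<mu>
  have hom: "\<phi> \<mu> \<in> module_homs \<Lambda> (N_module \<Lambda> p \<alpha>) (N_module \<Lambda> p \<beta>)" if "\<mu> \<in> carrier K" for \<mu>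
    unfolding \<phi>_def
    by (rule induced_hom, rule compatible_sum[OF F0 compatible_scale[OF F1]]) (use that in simp)
  have poly: "polynomial_map K (Hom_module K (restrict_scalars \<Lambda> (N_module \<Lambda> p \<alpha>))
      (restrict_scalars \<Lambda> (N_module \<Lambda> p \<beta>))) \<phi>"
    unfolding \<phi>_def by (rule polynomial_map_induced[OF assms(5) unif F0 F1])
  have F0v: "G'.embed r l \<in> carrier \<Lambda>" and F1v: "F1 r l \<in> carrier \<Lambda>" if "r \<in> vecs" for r l
    using compatible_vecs[OF F0 that] compatible_vecs[OF F1 that] by simp_all
  have \<phi>0: "\<phi> \<zero>\<^bsub>K\<^esub> = induced \<alpha> \<beta> (\<lambda>r. G'.embed r)"
    unfolding \<phi>_def by (rule induced_cong) (simp add: KL.smult_l_null F0v F1v)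
  have at0: "inj_on (\<phi> \<zero>\<^bsub>K\<^esub>) (carrier (N_module \<Lambda> p \<alpha>))"
    "has_tableau \<Lambda> p (N_module \<Lambda> p \<beta>) (\<phi> \<zero>\<^bsub>K\<^esub> ` carrier (N_module \<Lambda> p \<alpha>)) \<Gamma>'"
  proof -
    show "inj_on (\<phi> \<zero>\<^bsub>K\<^esub>) (carrier (N_module \<Lambda> p \<alpha>))"
      unfolding \<phi>0 by (rule G'.twisted_inj[OF refl parts' compatible_id compatible_id]) simp_all
    show "has_tableau \<Lambda> p (N_module \<Lambda> p \<beta>) (\<phi> \<zero>\<^bsub>K\<^esub> ` carrier (N_module \<Lambda> p \<alpha>)) \<Gamma>'"
      unfolding \<phi>0
    proof (rule G'.twisted_tableau[OF refl parts' compatible_id compatible_id])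
      show "\<Gamma>' x = {#b \<in># image_mset (G'.level x) (mset_set {..<size \<beta>}). b \<noteq> 0#}" for x
        unfolding \<Gamma>'[of x, folded \<tau>_def S.d_def, folded h'_def] G'.level_def ..
    qed simp_all
  qed
  have not0: "inj_on (\<phi> \<mu>) (carrier (N_module \<Lambda> p \<alpha>)) \<and>
      has_tableau \<Lambda> p (N_module \<Lambda> p \<beta>) (\<phi> \<mu> ` carrier (N_module \<Lambda> p \<alpha>)) \<Gamma>"
    if \<mu>: "\<mu> \<in> carrier K" "\<mu> \<noteq> \<zero>\<^bsub>K\<^esub>" for \<mu>
  proof -
    define c where "c = ?\<iota> \<mu>"
    define \<nu> where "\<nu> = ?\<iota> (inv\<^bsub>K\<^esub> \<mu>)"
    have inv: "inv\<^bsub>K\<^esub> \<mu> \<in> carrier K" "\<mu> \<otimes>\<^bsub>K\<^esub> inv\<^bsub>K\<^esub> \<mu> = \<one>\<^bsub>K\<^esub>"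
      using \<mu> K.field_Units by auto
    have [simp]: "c \<in> carrier \<Lambda>" "\<nu> \<in> carrier \<Lambda>" using \<mu> inv by (simp_all add: c_def \<nu>_def)
    have c\<nu>: "c \<otimes>\<^bsub>\<Lambda>\<^esub> \<nu> = \<one>\<^bsub>\<Lambda>\<^esub>"
    proof -
      have "c \<otimes>\<^bsub>\<Lambda>\<^esub> \<nu> = \<mu> \<odot>\<^bsub>\<Lambda>\<^esub> (\<one>\<^bsub>\<Lambda>\<^esub> \<otimes>\<^bsub>\<Lambda>\<^esub> \<nu>)"
        unfolding c_def using \<mu> by (intro KL.smult_assoc2) simp_all
      also have "\<dots> = (\<mu> \<otimes>\<^bsub>K\<^esub> inv\<^bsub>K\<^esub> \<mu>) \<odot>\<^bsub>\<Lambda>\<^esub> \<one>\<^bsub>\<Lambda>\<^esub>"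
        using \<mu> inv(1) by (simp add: \<nu>_def KL.smult_assoc1)
      finally show ?thesis using inv by simp
    qed
    have \<nu>c: "\<nu> \<otimes>\<^bsub>\<Lambda>\<^esub> c = \<one>\<^bsub>\<Lambda>\<^esub>" using c\<nu> by (simp add: L.m_comm)
    interpret G: chain_system \<Lambda> p \<alpha> "size \<beta>" e f h P \<rho> A B \<nu>
      by (intro chain_system.intro unif sys chain_system_axioms.intro) simp
    \<comment> \<open>The difference of the heights \<open>h A + f A\<close> and
      \<open>h B + f B\<close>, so adding \<open>p^k\<close> times coordinate \<open>B\<close> to
      coordinate \<open>A\<close> is well defined on \<open>N\<^sub>\<beta>\<close>.\<close>
    define k where "k = h A - h B - S.d"
    \<comment> \<open>On generators: \<open>b_B\<close> goes to \<open>\<mu> b_B + p^k b_A\<close>,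
      and \<open>b_A\<close> to a multiple of itself. The factor \<open>- \<nu>\<close> on
      \<open>b_A\<close> has two uses: it cancels the unwanted \<open>b_A\<close> term of the chain
      of \<open>A\<close>, and the inverse is given by the same formula with \<open>c\<close> and
      \<open>\<nu>\<close> exchanged.\<close>
    define T where "T u l = (if l = A then p [^]\<^bsub>\<Lambda>\<^esub> k \<otimes>\<^bsub>\<Lambda>\<^esub> u B \<ominus>\<^bsub>\<Lambda>\<^esub> \<nu> \<otimes>\<^bsub>\<Lambda>\<^esub> u A
      else if l = B then c \<otimes>\<^bsub>\<Lambda>\<^esub> u B else u l)" for u and l :: nat
    define T' where "T' u l = (if l = A then p [^]\<^bsub>\<Lambda>\<^esub> k \<otimes>\<^bsub>\<Lambda>\<^esub> u B \<ominus>\<^bsub>\<Lambda>\<^esub> c \<otimes>\<^bsub>\<Lambda>\<^esub> u A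
      else if l = B then \<nu> \<otimes>\<^bsub>\<Lambda>\<^esub> u B else u l)" for u and l :: nat
    have comp: "compatible \<beta> \<beta> (\<lambda>u l. if l = A then p [^]\<^bsub>\<Lambda>\<^esub> k \<otimes>\<^bsub>\<Lambda>\<^esub> u B \<ominus>\<^bsub>\<Lambda>\<^esub> a \<otimes>\<^bsub>\<Lambda>\<^esub> u A
        else if l = B then b \<otimes>\<^bsub>\<Lambda>\<^esub> u B else u l)" if ab: "a \<in> carrier \<Lambda>" "b \<in> carrier \<Lambda>" for a b
      unfolding compatible_def
    proof (intro conjI allI ballI impI)
      show "linear_functional (\<lambda>u. if j = A then p [^]\<^bsub>\<Lambda>\<^esub> k \<otimes>\<^bsub>\<Lambda>\<^esub> u B \<ominus>\<^bsub>\<Lambda>\<^esub> a \<otimes>\<^bsub>\<Lambda>\<^esub> u A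
          else if j = B then b \<otimes>\<^bsub>\<Lambda>\<^esub> u B else u j)" for j
        by (intro linear_functional_intros) (use ab in simp_all)
      fix u j assume u: "u \<in> vecs" "\<forall>i<size \<beta>. pdvd (parts \<beta> ! i) (u i)" and j: "j < size \<beta>"
      have "A < size \<beta>" "B < size \<beta>" using S.stripD(1) S.strip_A S.strip_B by blast+
      then have uAB: "pdvd (h A + f A) (u A)" "pdvd (h B + f B) (u B)" using u(2) parts by auto
      have "pdvd (h A + f A) (p [^]\<^bsub>\<Lambda>\<^esub> k \<otimes>\<^bsub>\<Lambda>\<^esub> u B)"
        by (rule pdvd_power_mult[OF uAB(2)]) (use hd S.fAB in \<open>simp add: k_def\<close>)
      then have "pdvd (h A + f A) (p [^]\<^bsub>\<Lambda>\<^esub> k \<otimes>\<^bsub>\<Lambda>\<^esub> u B \<ominus>\<^bsub>\<Lambda>\<^esub> a \<otimes>\<^bsub>\<Lambda>\<^esub> u A)"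
        by (rule pdvd_minus[OF _ pdvd_mult[OF uAB(1) ab(1)]])
      moreover have "pdvd (h B + f B) (b \<otimes>\<^bsub>\<Lambda>\<^esub> u B)" by (rule pdvd_mult[OF uAB(2) ab(2)])
      ultimately show "pdvd (parts \<beta> ! j) (if j = A then p [^]\<^bsub>\<Lambda>\<^esub> k \<otimes>\<^bsub>\<Lambda>\<^esub> u B \<ominus>\<^bsub>\<Lambda>\<^esub> a \<otimes>\<^bsub>\<Lambda>\<^esub> u A
          else if j = B then b \<otimes>\<^bsub>\<Lambda>\<^esub> u B else u j)"
        using u(2) j parts by auto
    qed
    have T: "compatible \<beta> \<beta> T" and T': "compatible \<beta> \<beta> T'"
      unfolding T_def T'_def by (rule comp; simp)+
    have cancel: "x \<ominus>\<^bsub>\<Lambda>\<^esub> (x \<ominus>\<^bsub>\<Lambda>\<^esub> y) = y" if "x \<in> carrier \<Lambda>" "y \<in> carrier \<Lambda>" for x y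
      using that by (simp add: a_minus_def L.minus_add L.a_assoc[symmetric] L.r_neg)
    have inverse: "(\<lambda>l. if l = A then p [^]\<^bsub>\<Lambda>\<^esub> k \<otimes>\<^bsub>\<Lambda>\<^esub> (b \<otimes>\<^bsub>\<Lambda>\<^esub> u B) \<ominus>\<^bsub>\<Lambda>\<^esub> b \<otimes>\<^bsub>\<Lambda>\<^esub> (p [^]\<^bsub>\<Lambda>\<^esub> k \<otimes>\<^bsub>\<Lambda>\<^esub> u B \<ominus>\<^bsub>\<Lambda>\<^esub> a \<otimes>\<^bsub>\<Lambda>\<^esub> u A)
        else if l = B then a \<otimes>\<^bsub>\<Lambda>\<^esub> (b \<otimes>\<^bsub>\<Lambda>\<^esub> u B) else u l) = u"
      if u: "u \<in> vecs" and ab: "a \<in> carrier \<Lambda>" "b \<in> carrier \<Lambda>" "a \<otimes>\<^bsub>\<Lambda>\<^esub> b = \<one>\<^bsub>\<Lambda>\<^esub>" for a b u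
    proof
      fix l
      have ba: "b \<otimes>\<^bsub>\<Lambda>\<^esub> a = \<one>\<^bsub>\<Lambda>\<^esub>" using ab by (simp add: L.m_comm)
      have "b \<otimes>\<^bsub>\<Lambda>\<^esub> (p [^]\<^bsub>\<Lambda>\<^esub> k \<otimes>\<^bsub>\<Lambda>\<^esub> u B \<ominus>\<^bsub>\<Lambda>\<^esub> a \<otimes>\<^bsub>\<Lambda>\<^esub> u A) =
          p [^]\<^bsub>\<Lambda>\<^esub> k \<otimes>\<^bsub>\<Lambda>\<^esub> (b \<otimes>\<^bsub>\<Lambda>\<^esub> u B) \<ominus>\<^bsub>\<Lambda>\<^esub> (b \<otimes>\<^bsub>\<Lambda>\<^esub> a) \<otimes>\<^bsub>\<Lambda>\<^esub> u A"
        using u ab by (simp add: a_minus_def L.r_distr L.r_minus L.m_assoc L.m_lcomm)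
      moreover have "a \<otimes>\<^bsub>\<Lambda>\<^esub> (b \<otimes>\<^bsub>\<Lambda>\<^esub> u B) = u B"
        using u ab(1,2) by (simp add: ab(3) flip: L.m_assoc)
      ultimately show "(if l = A then p [^]\<^bsub>\<Lambda>\<^esub> k \<otimes>\<^bsub>\<Lambda>\<^esub> (b \<otimes>\<^bsub>\<Lambda>\<^esub> u B) \<ominus>\<^bsub>\<Lambda>\<^esub>
            b \<otimes>\<^bsub>\<Lambda>\<^esub> (p [^]\<^bsub>\<Lambda>\<^esub> k \<otimes>\<^bsub>\<Lambda>\<^esub> u B \<ominus>\<^bsub>\<Lambda>\<^esub> a \<otimes>\<^bsub>\<Lambda>\<^esub> u A)
          else if l = B then a \<otimes>\<^bsub>\<Lambda>\<^esub> (b \<otimes>\<^bsub>\<Lambda>\<^esub> u B) else u l) = u l"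
        using u ab by (simp add: ba cancel)
    qed
    have TT': "T (T' v) = v" if "v \<in> vecs" for v
      by (rule trans[OF ext inverse[OF that, of c \<nu>]])
        (use S.not_AB c\<nu> in \<open>simp_all add: T_def T'_def\<close>)
    have T'T: "T' (T v) = v" if "v \<in> vecs" for v
      by (rule trans[OF ext inverse[OF that, of \<nu> c]])
        (use S.not_AB \<nu>c in \<open>simp_all add: T_def T'_def\<close>)
    \<comment> \<open>On the chain of \<open>A\<close> the entries
      \<open>p^(h A) b_A + \<nu> p^(h B + d) b_B\<close> become \<open>p^(h B + d) b_B\<close>,
      because \<open>h B + d + k = h A\<close> and \<open>\<nu>\<close> is inverse to
      \<open>c\<close>. On the chain of \<open>B\<close>, \<open>p^(h B) b_B\<close> becomes
      \<open>c p^(h B) b_B + p^(h A - d) b_A\<close>.\<close>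
    have \<phi>\<mu>: "\<phi> \<mu> = induced \<alpha> \<beta> (\<lambda>r. T (G.embed r))"
      unfolding \<phi>_def c_def[symmetric]
    proof (rule induced_cong, rule ext)
      fix r l assume r: "r \<in> vecs"
      let ?a = "p [^]\<^bsub>\<Lambda>\<^esub> h A \<otimes>\<^bsub>\<Lambda>\<^esub> r (\<rho> A)" and ?b = "p [^]\<^bsub>\<Lambda>\<^esub> h B \<otimes>\<^bsub>\<Lambda>\<^esub> r (\<rho> B)"
      let ?x = "p [^]\<^bsub>\<Lambda>\<^esub> (h B + S.d) \<otimes>\<^bsub>\<Lambda>\<^esub> r (\<rho> A)"
      have pow: "p [^]\<^bsub>\<Lambda>\<^esub> i \<otimes>\<^bsub>\<Lambda>\<^esub> (p [^]\<^bsub>\<Lambda>\<^esub> j \<otimes>\<^bsub>\<Lambda>\<^esub> y) = p [^]\<^bsub>\<Lambda>\<^esub> (i + j) \<otimes>\<^bsub>\<Lambda>\<^esub> y"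
        if "y \<in> carrier \<Lambda>" for i j :: nat and y
        using that by (simp add: L.m_assoc flip: L.nat_pow_mult)
      have strip': "is_strip (size \<beta>) (e \<circ> \<tau>) (f \<circ> \<tau>) l \<longleftrightarrow> S.strip (\<tau> l)"
        using S.strip_A S.strip_B \<tau> by (cases "l = A"; cases "l = B") (auto simp: is_strip_def)
      have E': "G'.embed r l = (if S.strip (\<tau> l) then p [^]\<^bsub>\<Lambda>\<^esub> h' l \<otimes>\<^bsub>\<Lambda>\<^esub> r (\<rho> (\<tau> l)) else \<zero>\<^bsub>\<Lambda>\<^esub>)"
        unfolding G'.embed_def strip' using r by simp
      have EA: "G.embed r A = ?a" and EB: "G.embed r B = ?b \<oplus>\<^bsub>\<Lambda>\<^esub> \<nu> \<otimes>\<^bsub>\<Lambda>\<^esub> ?x"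
        using S.strip_A S.strip_B S.not_AB r by (simp_all add: G.embed_def)
      consider "l = A" | "l = B" | "l \<noteq> A" "l \<noteq> B" by blast
      then show "G'.embed r l \<oplus>\<^bsub>\<Lambda>\<^esub> c \<otimes>\<^bsub>\<Lambda>\<^esub> F1 r l = T (G.embed r) l"
      proof cases
        case 1
        have "T (G.embed r) l = p [^]\<^bsub>\<Lambda>\<^esub> k \<otimes>\<^bsub>\<Lambda>\<^esub> ?b \<oplus>\<^bsub>\<Lambda>\<^esub> (p [^]\<^bsub>\<Lambda>\<^esub> k \<otimes>\<^bsub>\<Lambda>\<^esub> (\<nu> \<otimes>\<^bsub>\<Lambda>\<^esub> ?x) \<ominus>\<^bsub>\<Lambda>\<^esub> \<nu> \<otimes>\<^bsub>\<Lambda>\<^esub> ?a)"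
          unfolding 1 T_def EA EB using r by (simp add: L.r_distr a_minus_def L.a_assoc)
        also have "p [^]\<^bsub>\<Lambda>\<^esub> k \<otimes>\<^bsub>\<Lambda>\<^esub> (\<nu> \<otimes>\<^bsub>\<Lambda>\<^esub> ?x) = \<nu> \<otimes>\<^bsub>\<Lambda>\<^esub> (p [^]\<^bsub>\<Lambda>\<^esub> k \<otimes>\<^bsub>\<Lambda>\<^esub> ?x)"
          using r by (intro L.m_lcomm) simp_all
        also have "p [^]\<^bsub>\<Lambda>\<^esub> k \<otimes>\<^bsub>\<Lambda>\<^esub> ?x = ?a" using r hd by (simp add: pow k_def)
        also have "p [^]\<^bsub>\<Lambda>\<^esub> k \<otimes>\<^bsub>\<Lambda>\<^esub> ?b = p [^]\<^bsub>\<Lambda>\<^esub> (h A - S.d) \<otimes>\<^bsub>\<Lambda>\<^esub> r (\<rho> B)"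
          using r hd by (simp add: pow k_def)
        finally show ?thesis
          using 1 r E' \<tau> S.strip_B S.not_AB by (simp add: F1_def h'_def a_minus_def L.r_neg)
      next
        case 2
        have "T (G.embed r) l = c \<otimes>\<^bsub>\<Lambda>\<^esub> ?b \<oplus>\<^bsub>\<Lambda>\<^esub> (c \<otimes>\<^bsub>\<Lambda>\<^esub> \<nu>) \<otimes>\<^bsub>\<Lambda>\<^esub> ?x"
          unfolding 2 T_def EB using r S.not_AB by (simp add: L.r_distr L.m_assoc)
        then show ?thesis
          using 2 r E' \<tau> S.strip_A S.not_AB by (simp add: F1_def h'_def c\<nu> L.a_comm)
      next
        case 3
        then show ?thesis
          using r E' \<tau> by (simp add: F1_def h'_def T_def G.embed_def)
      qed
    qed
    show ?thesis
      unfolding \<phi>\<mu>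
    proof
      show "inj_on (induced \<alpha> \<beta> (\<lambda>r. T (G.embed r))) (carrier (N_module \<Lambda> p \<alpha>))"
        by (rule G.twisted_inj[OF refl parts T T' TT' T'T])
      show "has_tableau \<Lambda> p (N_module \<Lambda> p \<beta>)
          (induced \<alpha> \<beta> (\<lambda>r. T (G.embed r)) ` carrier (N_module \<Lambda> p \<alpha>)) \<Gamma>"
      proof (rule G.twisted_tableau[OF refl parts T T' TT' T'T])
        show "\<Gamma> x = {#b \<in># image_mset (S.level x) (mset_set {..<size \<beta>}). b \<noteq> 0#}" for x
          unfolding \<Gamma>[of x] S.level_def ..
      qed
    qed
  qed
  have part: "is_partition \<alpha>" "is_partition \<beta>"
  proof -
    have LR: "LR_tableau \<alpha> \<beta> \<gamma> \<Gamma>" using assms(7) by (auto simp: increasing_box_move_def)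
    then show "is_partition \<alpha>" by (simp add: LR_tableau_def)
    obtain s where "\<Gamma> s = \<beta>" using LR by (auto simp: LR_tableau_def)
    then show "is_partition \<beta>" using LR by (auto simp: LR_tableau_def is_tableau_def)
  qed
  have "inj_on (\<phi> \<mu>) (carrier (N_module \<Lambda> p \<alpha>))" if "\<mu> \<in> carrier K" for \<mu>
    using at0(1) not0[of \<mu>] that by (cases "\<mu> = \<zero>\<^bsub>K\<^esub>") auto
  then have "one_parameter_family K \<Lambda> p \<alpha> \<beta> \<phi>"
    unfolding one_parameter_family_def using part hom poly by blast
  then show ?thesis using at0(2) not0 by blast
qed

end
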